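(* There exist mixed $p$-spin models $\xi_0$ with $\xi_0''(0)>0$ such that $$\mathrm{AT}\not\subset \mathrm{RS}.$$ That is, there exists a function $\xi_0(r)=\sum_{p\ge 2}\beta_p r^p$, with non-negative coefficients $(\beta_p)_{p\ge2}$ of which only finitely many are non-zero and with $\xi_0''(0)>0$, and there exist $\beta>0$ and $h\in\mathbb R$ such that $\alpha(\beta,h)\le 1$ and yet the Parisi measure associated with $(\xi_0,\beta,h)$ is not a Dirac measure.
   Context: A mixed $p$-spin model (with Ising spins) is specified by a function $\xi_0(r)=\sum_{p\ge2}\beta_p r^p$, $r\in\mathbb R$, where $(\beta_p)_{p\ge2}$ is a sequence of non-negative coefficients with only finitely many non-zero entries. Let $\beta>0$ (inverse temperature) and $h\in\mathbb R$ (external field), and set $\xi(r)=\beta^2\xi_0(r)$. Parisi functional and Parisi measure. For a probability measure $\mu$ on $[0,1]$ (we write $\mu\in\mathcal P([0,1])$), define $$\mathcal P(\mu;\xi_0,\beta,h)=u_\mu(0,h)-\frac12\int_0^1\xi''(s)\,\mu([0,s])\,s\,ds,$$ where $u_\mu$ is the unique weak solution of the Parisi PDE $$\partial_r u_\mu(r,x)+\frac{\xi''(r)}{2}\Bigl(\partial_{xx}u_\mu(r,x)+\mu([0,r])\bigl(\partial_x u_\mu(r,x)\bigr)^2\Bigr)=0,\quad (r,x)\in(0,1)\times\mathbb R,\qquad u_\mu(1,x)=\log\cosh(x).$$ It is known that $\mu\mapsto\mathcal P(\mu;\xi_0,\beta,h)$ has a unique minimizer over $\mathcal P([0,1])$;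 it is called the Parisi measure associated with $(\xi_0,\beta,h)$. Generalized AT criterion. Let $Z$ be a standard Gaussian random variable and define $$Q^*(\beta,h)=\Bigl\{q\in[0,1]:\ \mathbb E\bigl[\tanh^2(\sqrt{\xi'(q)}\,Z+h)\bigr]=q\Bigr\},$$ $$\alpha(q,\beta,h)=\xi''(q)\,\mathbb E\bigl[\operatorname{sech}^4(\sqrt{\xi'(q)}\,Z+h)\bigr],\qquad \alpha(\beta,h)=\min_{q\in Q^*(\beta,h)}\alpha(q,\beta,h).$$ For a given $\xi_0$, the two regions are $$\mathrm{AT}=\{(\beta,h):\ \alpha(\beta,h)\le 1\},$$ $$\mathrm{RS}=\{(\beta,h):\ \text{the Parisi measure is a Dirac measure }\delta_q\text{ for some }q\in[0,1]\}.$$ *)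

theory Defs
  imports "HOL-Probability.Probability" "HOL-Computational_Algebra.Polynomial"
begin

text \<open>A finitely supported sequence of coefficients is the coefficient sequence of a polynomial,
  so \<open>\<xi>\<^sub>0(r) = \<Sum>\<^bsub>p \<ge> 2\<^esub> \<beta>\<^sub>p r\<^sup>p\<close> is a polynomial with \<open>coeff \<xi>\<^sub>0 p = \<beta>\<^sub>p\<close> and no terms of degree \<open>0\<close> or \<open>1\<close>.\<close>

definition mixed_p_spin :: "real poly \<Rightarrow> bool" where
  "mixed_p_spin \<xi>0 \<longleftrightarrow> (\<forall>p. coeff \<xi>0 p \<ge> 0) \<and> (\<forall>p<2. coeff \<xi>0 p = 0)"

definition scaled_xi :: "real poly \<Rightarrow> real \<Rightarrow> real poly" where
  "scaled_xi \<xi>0 \<beta> = smult (\<beta>\<^sup>2) \<xi>0"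

definition partial_t :: "(real \<times> real \<Rightarrow> real) \<Rightarrow> real \<times> real \<Rightarrow> real" where
  "partial_t f = (\<lambda>(t, x). deriv (\<lambda>s. f (s, x)) t)"

definition partial_x :: "(real \<times> real \<Rightarrow> real) \<Rightarrow> real \<times> real \<Rightarrow> real" where
  "partial_x f = (\<lambda>(t, x). deriv (\<lambda>y. f (t, y)) x)"

fun C_k :: "nat \<Rightarrow> (real \<times> real \<Rightarrow> real) \<Rightarrow> bool" where
  "C_k 0 f \<longleftrightarrow> continuous_on UNIV f"
| "C_k (Suc k) f \<longleftrightarrow>
     (\<forall>t x. (\<lambda>s. f (s, x)) differentiable at t \<and> (\<lambda>y. f (t, y)) differentiable at x) \<and>
     C_k k (partial_t f) \<and> C_k k (partial_x f)"

definition test_functions :: "(real \<times> real) set \<Rightarrow> (real \<times> real \<Rightarrow> real) set" where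
  "test_functions \<Omega> = {\<phi>. (\<forall>k. C_k k \<phi>) \<and> (\<exists>K. compact K \<and> K \<subseteq> \<Omega> \<and> (\<forall>z. z \<notin> K \<longrightarrow> \<phi> z = 0))}"

definition pde_domain :: "(real \<times> real) set" where
  "pde_domain = {0<..<1} \<times> UNIV"

text \<open>\<open>g\<close> is an essentially bounded weak derivative \<open>\<partial>\<^sub>x u\<close> on \<open>(0,1) \<times> \<real>\<close>.\<close>

definition bounded_weak_partial_x ::
    "(real \<times> real \<Rightarrow> real) \<Rightarrow> (real \<times> real \<Rightarrow> real) \<Rightarrow> bool" where
  "bounded_weak_partial_x u g \<longleftrightarrow>
     g \<in> borel_measurable borel \<and>
     (\<exists>C. AE z in lborel. z \<in> pde_domain \<longrightarrow> \<bar>g z\<bar> \<le> C) \<and>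
     (\<forall>\<phi> \<in> test_functions pde_domain.
        (LINT z:pde_domain|lborel. u z * partial_x \<phi> z) = - (LINT z:pde_domain|lborel. g z * \<phi> z))"

text \<open>A weak solution is a continuous function on \<open>[0,1] \<times> \<real>\<close> with essentially bounded weak
  derivative \<open>\<partial>\<^sub>x u\<close> that attains the terminal value pointwise and satisfies the equation after
  the other derivatives have been moved to the test function by integration by parts.\<close>

definition parisi_weak_solution ::
    "real poly \<Rightarrow> real measure \<Rightarrow> (real \<times> real \<Rightarrow> real) \<Rightarrow> bool" where
  "parisi_weak_solution \<xi> \<mu> u \<longleftrightarrow>
     continuous_on ({0..1} \<times> UNIV) u \<and>
     (\<forall>x. u (1, x) = ln (cosh x)) \<and>
     (\<exists>g. bounded_weak_partial_x u g \<and>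
       (\<forall>\<phi> \<in> test_functions pde_domain.
          (LINT z:pde_domain|lborel.
             - u z * partial_t \<phi> z
             + poly (pderiv (pderiv \<xi>)) (fst z) / 2 *
               (u z * partial_x (partial_x \<phi>) z + measure \<mu> {0..fst z} * (g z)\<^sup>2 * \<phi> z)) = 0))"

text \<open>The solution is only determined on \<open>[0,1] \<times> \<real>\<close>; requiring it to be \<open>extensional\<close> fixes the
  irrelevant values, so that the definite description denotes.\<close>

definition parisi_solution :: "real poly \<Rightarrow> real measure \<Rightarrow> real \<times> real \<Rightarrow> real" where
  "parisi_solution \<xi> \<mu> =
     (THE u. parisi_weak_solution \<xi> \<mu> u \<and> u \<in> extensional ({0..1} \<times> UNIV))"

abbreviation unit_interval :: "real measure" where
  "unit_interval \<equiv> restrict_space borel {0..1}"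

definition parisi_functional :: "real poly \<Rightarrow> real \<Rightarrow> real \<Rightarrow> real measure \<Rightarrow> real" where
  "parisi_functional \<xi>0 \<beta> h \<mu> =
     parisi_solution (scaled_xi \<xi>0 \<beta>) \<mu> (0, h)
     - 1 / 2 * (LINT s:{0..1}|lborel.
         poly (pderiv (pderiv (scaled_xi \<xi>0 \<beta>))) s * measure \<mu> {0..s} * s)"

text \<open>\<open>space (prob_algebra unit_interval)\<close> is the set of Borel probability measures on \<open>[0,1]\<close>.
  The minimizer is known to exist and to be unique, so that \<open>\<mu>\<close> is the Parisi measure
  iff it is a minimizer.\<close>

definition is_parisi_measure :: "real poly \<Rightarrow> real \<Rightarrow> real \<Rightarrow> real measure \<Rightarrow> bool" where
  "is_parisi_measure \<xi>0 \<beta> h \<mu> \<longleftrightarrow>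
     is_arg_min (parisi_functional \<xi>0 \<beta> h) (\<lambda>\<nu>. \<nu> \<in> space (prob_algebra unit_interval)) \<mu>"

definition RS :: "real poly \<Rightarrow> (real \<times> real) set" where
  "RS \<xi>0 = {(\<beta>, h). \<beta> > 0 \<and> (\<exists>q\<in>{0..1}. is_parisi_measure \<xi>0 \<beta> h (return unit_interval q))}"

definition Q_star :: "real poly \<Rightarrow> real \<Rightarrow> real \<Rightarrow> real set" where
  "Q_star \<xi>0 \<beta> h = {q \<in> {0..1}.
     (LINT z|std_normal_distribution.
        (tanh (sqrt (poly (pderiv (scaled_xi \<xi>0 \<beta>)) q) * z + h))\<^sup>2) = q}"

definition alpha_at :: "real poly \<Rightarrow> real \<Rightarrow> real \<Rightarrow> real \<Rightarrow> real" where
  "alpha_at \<xi>0 \<beta> h q = poly (pderiv (pderiv (scaled_xi \<xi>0 \<beta>))) q *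
     (LINT z|std_normal_distribution.
        1 / (cosh (sqrt (poly (pderiv (scaled_xi \<xi>0 \<beta>)) q) * z + h)) ^ 4)"

text \<open>\<open>Q_star\<close> is nonempty and compact and \<open>alpha_at\<close> is continuous in \<open>q\<close>, so the infimum is the
  minimum.\<close>

definition alpha :: "real poly \<Rightarrow> real \<Rightarrow> real \<Rightarrow> real" where
  "alpha \<xi>0 \<beta> h = (INF q\<in>Q_star \<xi>0 \<beta> h. alpha_at \<xi>0 \<beta> h q)"

definition AT :: "real poly \<Rightarrow> (real \<times> real) set" where
  "AT \<xi>0 = {(\<beta>, h). \<beta> > 0 \<and> alpha \<xi>0 \<beta> h \<le> 1}"

end

(* Take xi0(r) = r^2/2 + 16 r^1001, beta = 1 and h = 0. Then 0 lies in Q* and alpha(0) = xi''(0) = 1,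
   so (1, 0) satisfies the AT criterion. No Dirac measure is a minimizer, because
   nu = (delta_0 + delta_1)/2 has a smaller value than each of them: the Hopf-Cole transform gives
   P(nu) <= 2 log 2 + xi(1)/4, while with D = xi(q) + (1 - q) xi'(q)
   P(delta_q) = E log cosh(sqrt(xi'(q)) Z) + (xi(1) - D)/2,
   which is larger since either D <= 4, or q^500 > 1/10 and the Gaussian term dominates.

   The functional is only defined through the unique weak solution of the Parisi PDE. For
   uniqueness, the difference w of two solutions solves a backward heat equation with source F,
   |F| <= 2L |w_x|. Testing with cut-off Gaussian kernels gives the mild formulation, hence a
   Lipschitz bound on w(t, .) by a weakly singular time integral of sup |F|, and the map
   is a contraction for the norm sup exp(lambda xi'(t)) |w_x| when lambda is large. *)

theory Submission
  imports Defs
begin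

section \<open>Smooth functions and cutoffs\<close>

text \<open>The claim only compares values of the functional, so no general existence theory is
  developed: explicit solutions are given for the Dirac measures and for \<nu>, and uniqueness
  identifies them with the function selected by \<open>THE\<close>. The obstacle is that uniqueness
  must hold against any competitor that is merely continuous with an essentially bounded weak
  derivative. Hence its test functions come from an explicit class of smooth functions closed under
  differentiation, and a bound on the weak derivative is exchanged with a Lipschitz bound in x in
  both directions: one gives linear growth of w, the other turns the estimate from the mild formula
  back into a bound on w_x. The inequality |F| <= 2L |w_x| comes from factoring a difference of
  squares and from \<mu>([0,t]) <= 1. The weight contains \<xi>' because the kernel between t0 and t
  has variance \<xi>'(t) - \<xi>'(t0) up to a regularization: with \<xi>' as clock, the weight is a
  function of that variance and the singular time integral is of order \<lambda>^(-1/2).\<close>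

definition flat_exp :: "nat \<Rightarrow> real \<Rightarrow> real" where
  "flat_exp n x = (if x \<le> 0 then 0 else exp (- (1 / x)) / x ^ n)"

lemma flat_exp_nonpos [simp]: "x \<le> 0 \<Longrightarrow> flat_exp n x = 0"
  by (simp add: flat_exp_def)

lemma flat_exp_pos: "x > 0 \<Longrightarrow> flat_exp n x > 0"
  by (simp add: flat_exp_def)

lemma flat_exp_nonneg: "flat_exp n x \<ge> 0"
  by (simp add: flat_exp_def)

text \<open>With y = 1/x this is the decay of y^n / exp y at infinity.\<close>

lemma flat_exp_tendsto_0: "(flat_exp n \<longlongrightarrow> 0) (at_right 0)"
proof -
  have "((\<lambda>x::real. (1 / x) ^ n / exp (1 / x)) \<longlongrightarrow> 0) (at_right 0)"
    by (rule filterlim_compose[OF tendsto_power_div_exp_0])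
       (use filterlim_inverse_at_top_right in \<open>simp add: inverse_eq_divide\<close>)
  moreover have "eventually (\<lambda>x. (1 / x) ^ n / exp (1 / x) = flat_exp n x) (at_right (0::real))"
    by (rule eventually_at_rightI[of 0 1])
       (auto simp: flat_exp_def exp_minus field_simps)
  ultimately show ?thesis
    by (rule Lim_transform_eventually)
qed

text \<open>Carrying the power n makes the family closed under differentiation. At 0 the difference
  quotient from the right is \<open>flat_exp (Suc n)\<close>, so the preceding limit yields the
  derivative 0.\<close>

lemma has_real_derivative_flat_exp:
  "(flat_exp n has_real_derivative flat_exp (n + 2) x - real n * flat_exp (Suc n) x) (at x)"
proof -
  consider "x > 0" | "x < 0" | "x = 0" by linarith
  then show ?thesis
  proof cases
    case 1
    have "((\<lambda>x. exp (- (1 / x)) * (1 / x) ^ n) has_real_derivative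
        exp (- (1 / x)) * (1 / x) ^ n * (1 / x) ^ 2 -
        exp (- (1 / x)) * (real n * (1 / x) ^ (n - 1) * (1 / x) ^ 2)) (at x)"
      using 1 by (auto intro!: derivative_eq_intros simp: power2_eq_square algebra_simps)
    moreover have "real n * (1 / x) ^ (n - 1) * (1 / x) ^ 2 = real n * (1 / x) ^ Suc n"
      by (cases n) (auto simp: power2_eq_square)
    moreover have "exp (- (1 / x)) * (1 / x) ^ n * (1 / x) ^ 2 -
        exp (- (1 / x)) * (real n * (1 / x) ^ Suc n) = flat_exp (n + 2) x - real n * flat_exp (Suc n) x"
      using 1 by (simp add: flat_exp_def power_divide power2_eq_square mult_ac)
    moreover have "(\<lambda>x::real. exp (- (1 / x)) * (1 / x) ^ n) = (\<lambda>x. exp (- (1 / x)) / x ^ n)"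
      by (simp add: power_divide)
    ultimately have "((\<lambda>x. exp (- (1 / x)) / x ^ n) has_real_derivative
        flat_exp (n + 2) x - real n * flat_exp (Suc n) x) (at x)"
      by (simp only: mult.assoc)
    moreover have "eventually (\<lambda>y. exp (- (1 / y)) / y ^ n = flat_exp n y) (nhds x)"
      using eventually_nhds_in_open[of "{0<..}" x] 1
      by (auto elim!: eventually_mono simp: flat_exp_def)
    ultimately show ?thesis
      by (rule DERIV_cong_ev[THEN iffD1, OF refl _ refl, rotated])
  next
    case 2
    have "((\<lambda>x. 0) has_real_derivative 0) (at x)" by simp
    moreover have "eventually (\<lambda>y. 0 = flat_exp n y) (nhds x)"
      using eventually_nhds_in_open[of "{..<0}" x] 2
      by (auto elim!: eventually_mono)
    ultimately show ?thesis
      using DERIV_cong_ev[OF refl, of "\<lambda>x. 0" "flat_exp n" x 0 0] 2 by auto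
  next
    case 3
    have R: "((\<lambda>h. flat_exp n h / h) \<longlongrightarrow> 0) (at_right 0)"
      by (rule Lim_transform_eventually[OF flat_exp_tendsto_0[of "Suc n"]])
         (auto simp: flat_exp_def intro!: eventually_at_rightI[of 0 1])
    have L: "((\<lambda>h. flat_exp n h / h) \<longlongrightarrow> 0) (at_left 0)"
      by (rule Lim_transform_eventually[OF tendsto_const])
         (auto simp: flat_exp_def intro!: eventually_at_leftI[of "-1" 0])
    show ?thesis
      using filterlim_split_at[OF L R] 3 by (simp add: has_field_derivative_iff)
  qed
qed

lemma continuous_flat: "continuous_on A (flat_exp n)"
  by (meson DERIV_continuous_on has_real_derivative_flat_exp has_field_derivative_at_within)

text \<open>This class is closed under both partial derivatives, so that all its members are smooth.\<close>

inductive_set smooth2 :: "(real \<times> real \<Rightarrow> real) set" where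
  smooth2_const: "(\<lambda>z. c) \<in> smooth2"
| smooth2_fst: "fst \<in> smooth2"
| smooth2_snd: "snd \<in> smooth2"
| smooth2_add: "f \<in> smooth2 \<Longrightarrow> g \<in> smooth2 \<Longrightarrow> (\<lambda>z. f z + g z) \<in> smooth2"
| smooth2_mult: "f \<in> smooth2 \<Longrightarrow> g \<in> smooth2 \<Longrightarrow> (\<lambda>z. f z * g z) \<in> smooth2"
| smooth2_exp: "f \<in> smooth2 \<Longrightarrow> (\<lambda>z. exp (f z)) \<in> smooth2"
| smooth2_inverse: "f \<in> smooth2 \<Longrightarrow> (\<And>z. f z \<noteq> 0) \<Longrightarrow> (\<lambda>z. inverse (f z)) \<in> smooth2"
| smooth2_ln: "f \<in> smooth2 \<Longrightarrow> (\<And>z. f z > 0) \<Longrightarrow> (\<lambda>z. ln (f z)) \<in> smooth2"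
| smooth2_flat: "f \<in> smooth2 \<Longrightarrow> (\<lambda>z. flat_exp n (f z)) \<in> smooth2"

lemma smooth2_minus: "f \<in> smooth2 \<Longrightarrow> (\<lambda>z. - f z) \<in> smooth2"
  using smooth2_mult[OF smooth2_const[of "-1"]] by force

lemma smooth2_diff: "f \<in> smooth2 \<Longrightarrow> g \<in> smooth2 \<Longrightarrow> (\<lambda>z. f z - g z) \<in> smooth2"
  using smooth2_add[OF _ smooth2_minus] by force

lemma smooth2_divide:
  "f \<in> smooth2 \<Longrightarrow> g \<in> smooth2 \<Longrightarrow> (\<And>z. g z \<noteq> 0) \<Longrightarrow> (\<lambda>z. f z / g z) \<in> smooth2"
  using smooth2_mult[OF _ smooth2_inverse] by (simp add: divide_inverse)

lemma smooth2_power: "f \<in> smooth2 \<Longrightarrow> (\<lambda>z. f z ^ n) \<in> smooth2"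
  by (induction n) (auto intro: smooth2.intros)

lemma smooth2_poly: "f \<in> smooth2 \<Longrightarrow> (\<lambda>z. poly p (f z)) \<in> smooth2"
  by (induction p) (auto intro: smooth2.intros)

lemmas smooth2_intros = smooth2.intros smooth2_minus smooth2_diff smooth2_divide
  smooth2_power smooth2_poly

lemma smooth2_continuous: "f \<in> smooth2 \<Longrightarrow> continuous_on A f"
proof (induction arbitrary: A rule: smooth2.induct)
  case (smooth2_ln f)
  have "f z \<noteq> 0" for z using smooth2_ln.hyps(2)[of z] by simp
  then show ?case using smooth2_ln.IH by (auto intro!: continuous_intros)
next
  case (smooth2_flat f n)
  then show ?case
    using continuous_on_compose[OF smooth2_flat.IH[of A] continuous_flat[of "f ` A" n]]
    by (simp add: o_def)
qed (auto intro!: continuous_intros)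

text \<open>Existence of a derivative inside the class is the form that rule induction can carry;
  uniqueness of derivatives later identifies the witness with \<open>partial_t f\<close>.\<close>

lemma smooth2_partial_t_ex:
  "f \<in> smooth2 \<Longrightarrow> \<exists>f'\<in>smooth2. \<forall>t x. ((\<lambda>s. f (s, x)) has_real_derivative f' (t, x)) (at t)"
proof (induction rule: smooth2.induct)
  case (smooth2_const c)
  show ?case by (rule bexI[OF _ smooth2.smooth2_const[of 0]]) auto
next
  case smooth2_fst
  show ?case by (rule bexI[OF _ smooth2.smooth2_const[of 1]]) auto
next
  case smooth2_snd
  show ?case by (rule bexI[OF _ smooth2.smooth2_const[of 0]]) auto
next
  case (smooth2_add f g)
  then obtain f' g' where "f' \<in> smooth2" "g' \<in> smooth2"
    "\<And>t x. ((\<lambda>s. f (s, x)) has_real_derivative f' (t, x)) (at t)"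
    "\<And>t x. ((\<lambda>s. g (s, x)) has_real_derivative g' (t, x)) (at t)" by blast
  with smooth2_add.hyps show ?case
    by (intro bexI[of _ "\<lambda>z. f' z + g' z"]) (auto intro!: smooth2_intros derivative_intros)
next
  case (smooth2_mult f g)
  then obtain f' g' where "f' \<in> smooth2" "g' \<in> smooth2"
    "\<And>t x. ((\<lambda>s. f (s, x)) has_real_derivative f' (t, x)) (at t)"
    "\<And>t x. ((\<lambda>s. g (s, x)) has_real_derivative g' (t, x)) (at t)" by blast
  with smooth2_mult.hyps show ?case
    by (intro bexI[of _ "\<lambda>z. f' z * g z + g' z * f z"])
       (auto intro!: smooth2_intros DERIV_mult)
next
  case (smooth2_exp f)
  then obtain f' where "f' \<in> smooth2"
    "\<And>t x. ((\<lambda>s. f (s, x)) has_real_derivative f' (t, x)) (at t)" by blast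
  with smooth2_exp.hyps show ?case
    by (intro bexI[of _ "\<lambda>z. exp (f z) * f' z"])
       (auto intro!: smooth2_intros DERIV_fun_exp)
next
  case (smooth2_inverse f)
  then obtain f' where "f' \<in> smooth2"
    "\<And>t x. ((\<lambda>s. f (s, x)) has_real_derivative f' (t, x)) (at t)" by blast
  with smooth2_inverse.hyps show ?case
    by (intro bexI[of _ "\<lambda>z. - (inverse (f z) * f' z * inverse (f z))"])
       (auto intro!: smooth2_intros derivative_intros)
next
  case (smooth2_ln f)
  then obtain f' where f': "f' \<in> smooth2"
    "\<And>t x. ((\<lambda>s. f (s, x)) has_real_derivative f' (t, x)) (at t)" by blast
  have nz: "f z \<noteq> 0" for z using smooth2_ln.hyps(2)[of z] by simp
  from f' smooth2_ln.hyps nz show ?case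
    by (intro bexI[of _ "\<lambda>z. inverse (f z) * f' z"])
       (auto intro!: smooth2_intros derivative_eq_intros simp: field_simps)
next
  case (smooth2_flat f n)
  then obtain f' where f': "f' \<in> smooth2"
    "\<And>t x. ((\<lambda>s. f (s, x)) has_real_derivative f' (t, x)) (at t)" by blast
  have "((\<lambda>s. flat_exp n (f (s, x))) has_real_derivative
      (flat_exp (n + 2) (f (t, x)) - real n * flat_exp (Suc n) (f (t, x))) * f' (t, x)) (at t)" for t x
    by (rule DERIV_chain2[OF has_real_derivative_flat_exp]) (rule f')
  with f' smooth2_flat.hyps show ?case
    by (intro bexI[of _ "\<lambda>z. (flat_exp (n + 2) (f z) - real n * flat_exp (Suc n) (f z)) * f' z"])
       (auto intro!: smooth2_intros)
qed

text \<open>The class is symmetric in its two variables, which reduces \<open>\<partial>\<^sub>x\<close> to \<open>\<partial>\<^sub>t\<close>.\<close>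

lemma smooth2_swap: "f \<in> smooth2 \<Longrightarrow> (\<lambda>z. f (snd z, fst z)) \<in> smooth2"
proof (induction rule: smooth2.induct)
  case smooth2_fst
  then show ?case using smooth2.smooth2_snd by (simp add: eta_contract_eq[symmetric])
next
  case smooth2_snd
  then show ?case using smooth2.smooth2_fst by simp
qed (auto intro!: smooth2_intros)

lemma smooth2_partial_x_ex:
  assumes "f \<in> smooth2"
  shows "\<exists>f'\<in>smooth2. \<forall>t x. ((\<lambda>y. f (t, y)) has_real_derivative f' (t, x)) (at x)"
proof -
  obtain f' where "f' \<in> smooth2" "\<And>t x. ((\<lambda>s. f (x, s)) has_real_derivative f' (t, x)) (at t)"
    using smooth2_partial_t_ex[OF smooth2_swap[OF assms]] by auto
  then show ?thesis
    by (intro bexI[OF _ smooth2_swap[of f']]) auto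
qed

lemma smooth2_partial_t:
  assumes "f \<in> smooth2"
  shows "partial_t f \<in> smooth2"
    and "((\<lambda>s. f (s, x)) has_real_derivative partial_t f (t, x)) (at t)"
proof -
  obtain f' where f': "f' \<in> smooth2"
      "\<And>t x. ((\<lambda>s. f (s, x)) has_real_derivative f' (t, x)) (at t)"
    using smooth2_partial_t_ex[OF assms] by blast
  then have "partial_t f = f'"
    by (auto simp: partial_t_def fun_eq_iff intro!: DERIV_imp_deriv)
  with f' show "partial_t f \<in> smooth2"
      "((\<lambda>s. f (s, x)) has_real_derivative partial_t f (t, x)) (at t)"
    by auto
qed

lemma smooth2_partial_x:
  assumes "f \<in> smooth2"
  shows "partial_x f \<in> smooth2"
    and "((\<lambda>y. f (t, y)) has_real_derivative partial_x f (t, x)) (at x)"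
proof -
  obtain f' where f': "f' \<in> smooth2"
      "\<And>t x. ((\<lambda>y. f (t, y)) has_real_derivative f' (t, x)) (at x)"
    using smooth2_partial_x_ex[OF assms] by blast
  then have "partial_x f = f'"
    by (auto simp: partial_x_def fun_eq_iff intro!: DERIV_imp_deriv)
  with f' show "partial_x f \<in> smooth2"
      "((\<lambda>y. f (t, y)) has_real_derivative partial_x f (t, x)) (at x)"
    by auto
qed

lemma smooth2_C_k: "f \<in> smooth2 \<Longrightarrow> C_k k f"
proof (induction k arbitrary: f)
  case 0
  then show ?case by (simp add: smooth2_continuous)
next
  case (Suc k)
  then show ?case
    using smooth2_partial_t[OF Suc.prems] smooth2_partial_x[OF Suc.prems]
    by (simp add: real_differentiable_def) blast
qed

lemma smooth2_test_function:
  assumes "f \<in> smooth2" "compact K" "K \<subseteq> \<Omega>" "\<And>z. z \<notin> K \<Longrightarrow> f z = 0"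
  shows "f \<in> test_functions \<Omega>"
  using assms smooth2_C_k by (auto simp: test_functions_def)

section \<open>The smooth transition from 0 to 1\<close>

definition step :: "real \<Rightarrow> real" where
  "step x = flat_exp 0 x / (flat_exp 0 x + flat_exp 0 (1 - x))"

lemma step_denominator: "flat_exp 0 x + flat_exp 0 (1 - x) > 0"
  by (cases "x > 0") (auto simp: add_pos_nonneg flat_exp_pos flat_exp_nonneg add_nonneg_pos)

lemma step_nonneg: "step x \<ge> 0"
  using step_denominator[of x] by (simp add: step_def flat_exp_nonneg)

lemma step_le_1: "step x \<le> 1"
  using step_denominator[of x] by (simp add: step_def flat_exp_nonneg)

lemma step_0 [simp]: "x \<le> 0 \<Longrightarrow> step x = 0"
  by (simp add: step_def)

lemma step_1 [simp]: "x \<ge> 1 \<Longrightarrow> step x = 1"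
  using step_denominator[of x] by (simp add: step_def)

lemma smooth2_step: "f \<in> smooth2 \<Longrightarrow> (\<lambda>z. step (f z)) \<in> smooth2"
proof -
  assume f: "f \<in> smooth2"
  have nz: "flat_exp 0 (f z) + flat_exp 0 (1 - f z) \<noteq> 0" for z
    using step_denominator[of "f z"] by simp
  show ?thesis
    unfolding step_def by (intro smooth2_intros f nz)
qed

lemma step_smooth_fst: "(\<lambda>z. step (fst z)) \<in> smooth2"
  by (intro smooth2_step smooth2_intros)

text \<open>Composition with \<open>fst\<close> places functions of one variable in
  \<open>smooth2\<close>, so that both derivatives and their continuity are inherited from the class
  in two variables.\<close>

lemma has_real_derivative_step:
    "(step has_real_derivative deriv step x) (at x)"
  and continuous_deriv_step: "continuous_on A (deriv step)"
  and has_real_derivative_deriv_step: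
    "(deriv step has_real_derivative deriv (deriv step) x) (at x)"
  and continuous_deriv_deriv_step: "continuous_on A (deriv (deriv step))"
proof -
  have *: "partial_t (\<lambda>z. h (fst z)) = (\<lambda>z. deriv h (fst z))" for h
    by (simp add: partial_t_def fun_eq_iff)
  have 1: "(\<lambda>z. deriv step (fst z)) \<in> smooth2"
      "(step has_real_derivative deriv step t) (at t)" for t
    using smooth2_partial_t(1)[OF step_smooth_fst] smooth2_partial_t(2)[OF step_smooth_fst, where t = t]
    by (auto simp: *[of step])
  have 2: "(\<lambda>z. deriv (deriv step) (fst z)) \<in> smooth2"
      "(deriv step has_real_derivative deriv (deriv step) t) (at t)" for t
    using smooth2_partial_t(1)[OF 1(1)] smooth2_partial_t(2)[OF 1(1), where t = t]
    by (auto simp: *[of "deriv step"])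
  show "(step has_real_derivative deriv step x) (at x)" using 1(2) by simp
  show "(deriv step has_real_derivative deriv (deriv step) x) (at x)" using 2(2) by simp
  have **: "continuous_on A h" if "(\<lambda>z::real\<times>real. h (fst z)) \<in> smooth2" for h
    using continuous_on_compose2[OF smooth2_continuous[OF that, of UNIV], of A "\<lambda>t. (t, 0)"]
    by (simp add: continuous_on_Pair)
  show "continuous_on A (deriv step)" "continuous_on A (deriv (deriv step))"
    using ** 1(1) 2(1) by auto
qed

text \<open>On the open half-lines h is locally constant. The zero set of h' is closed by
  continuity, which adds the endpoints 0 and 1.\<close>

lemma deriv_const_on_half_lines:
  fixes h :: "real \<Rightarrow> real"
  assumes "\<And>x. (h has_real_derivative h' x) (at x)" and "continuous_on UNIV h'"
    and "\<And>x. x \<le> 0 \<Longrightarrow> h x = a" and "\<And>x. x \<ge> 1 \<Longrightarrow> h x = b"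
    and "x \<le> 0 \<or> x \<ge> 1"
  shows "h' x = 0"
proof -
  have iso: "h' y = 0" if "y < 0 \<or> y > 1" for y
  proof -
    have "eventually (\<lambda>z. h z = (if y < 0 then a else b)) (nhds y)"
    proof (cases "y < 0")
      case True
      then show ?thesis using eventually_nhds_in_open[of "{..<0}" y] assms(3)
        by (auto elim!: eventually_mono)
    next
      case False
      then show ?thesis using eventually_nhds_in_open[of "{1<..}" y] assms(4) that
        by (auto elim!: eventually_mono)
    qed
    then have "(h has_real_derivative 0) (at y)"
      using DERIV_cong_ev[of y y h "\<lambda>_. if y < 0 then a else b" 0 0] by simp
    then show ?thesis using assms(1) DERIV_unique by blast
  qed
  have cl: "closed {y. h' y = 0}"
    using assms(2) by (intro closed_Collect_eq continuous_intros) auto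
  have "h' 0 = 0"
  proof -
    have "closure {..<(0::real)} \<subseteq> {y. h' y = 0}"
      by (rule closure_minimal) (use iso cl in auto)
    then show ?thesis by auto
  qed
  moreover have "h' 1 = 0"
  proof -
    have "closure {(1::real)<..} \<subseteq> {y. h' y = 0}"
      by (rule closure_minimal) (use iso cl in auto)
    then show ?thesis by auto
  qed
  ultimately show ?thesis using iso[of x] assms(5) by (cases "x = 0"; cases "x = 1") auto
qed

lemma deriv_step_0 [simp]: "x \<le> 0 \<or> x \<ge> 1 \<Longrightarrow> deriv step x = 0"
  by (rule deriv_const_on_half_lines[OF has_real_derivative_step continuous_deriv_step, of 0 1]) auto

lemma deriv_deriv_step_0 [simp]: "x \<le> 0 \<or> x \<ge> 1 \<Longrightarrow> deriv (deriv step) x = 0"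
  by (rule deriv_const_on_half_lines[OF has_real_derivative_deriv_step
        continuous_deriv_deriv_step, of 0 0]) auto

lemma bounded_compact_support:
  fixes h :: "real \<Rightarrow> real"
  assumes "continuous_on UNIV h" "\<And>x. x \<le> 0 \<or> x \<ge> 1 \<Longrightarrow> h x = 0"
  shows "\<exists>B>0. \<forall>x. \<bar>h x\<bar> \<le> B"
proof -
  have "compact (h ` {0..1})"
    by (rule compact_continuous_image) (auto intro: continuous_on_subset[OF assms(1)])
  then obtain B where B: "\<And>y. y \<in> h ` {0..1} \<Longrightarrow> \<bar>y\<bar> \<le> B" "B > 0"
    by (metis compact_imp_bounded bounded_pos real_norm_def)
  have "\<bar>h x\<bar> \<le> B" for x
    using B(1)[of "h x"] B(2) assms(2)[of x] by (cases "x \<in> {0..1}") auto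
  then show ?thesis using B(2) by blast
qed

section \<open>Weak derivatives and Lipschitz bounds\<close>

lemma lborel2_fubini:
  fixes f :: "real \<times> real \<Rightarrow> real"
  assumes "integrable lborel f"
  shows "(LINT z|lborel. f z) = (LINT t|lborel. LINT y|lborel. f (t, y))"
    and "(LINT z|lborel. f z) = (LINT y|lborel. LINT t|lborel. f (t, y))"
proof -
  have i: "integrable (lborel \<Otimes>\<^sub>M lborel) f"
    using assms by (simp add: lborel_prod)
  show "(LINT z|lborel. f z) = (LINT t|lborel. LINT y|lborel. f (t, y))"
    using lborel_pair.integral_fst'[OF i] by (simp add: lborel_prod)
  then show "(LINT z|lborel. f z) = (LINT y|lborel. LINT t|lborel. f (t, y))"
    using lborel_pair.Fubini_integral[of "\<lambda>t y. f (t, y)"] i by simp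
qed

text \<open>The kernel k step'(k s) is a one-sided approximate identity with mass on 0 < s < 1/k.
  The sign \<sigma> points from the endpoint e into the interval: 1 at the left end and -1 at the
  right end. After the substitution x = e + \<sigma> s / k, dominated convergence applies.\<close>

lemma delta_limit:
  fixes f :: "real \<Rightarrow> real"
  assumes cd: "c < d" and f: "continuous_on {c..d} f"
    and e: "\<sigma> = 1 \<and> e = c \<or> \<sigma> = -1 \<and> e = d"
  shows "(\<lambda>k. LINT x:{c..d}|lborel. f x * (real k * deriv step (real k * (\<sigma> * (x - e))))) \<longlonglongrightarrow> f e"
proof -
  have [measurable]: "(\<lambda>x. indicator {c..d} x * f x) \<in> borel_measurable borel"
    using borel_measurable_continuous_on_indicator[OF _ f] by simp
  have [measurable]: "deriv step \<in> borel_measurable borel"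
    using continuous_deriv_step[of UNIV] by (rule borel_measurable_continuous_onI)
  obtain B1 where B1: "B1 > 0" "\<And>x. \<bar>deriv step x\<bar> \<le> B1"
    using bounded_compact_support[OF continuous_deriv_step deriv_step_0] by blast
  have "compact (f ` {c..d})"
    by (rule compact_continuous_image[OF f]) auto
  then obtain B where B: "B > 0" "\<And>x. x \<in> {c..d} \<Longrightarrow> \<bar>f x\<bar> \<le> B"
    by (metis bounded_pos compact_imp_bounded imageI real_norm_def)
  let ?h = "\<lambda>k s. indicator {c..d} (e + \<sigma> / real k * s) * f (e + \<sigma> / real k * s) * deriv step s"
  have eq: "(LINT x:{c..d}|lborel. f x * (real k * deriv step (real k * (\<sigma> * (x - e))))) =
      (LINT s|lborel. ?h k s)" if "k \<ge> 1" for k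
  proof -
    have \<sigma>: "\<sigma> * \<sigma> = 1" "\<bar>\<sigma>\<bar> = 1" "\<sigma> \<noteq> 0" using e by auto
    have "real k * (\<sigma> * (e + \<sigma> / real k * s - e)) = s" for s
      using that \<sigma>(1) by (simp add: field_simps)
    then show ?thesis
      unfolding set_lebesgue_integral_def
      by (subst lborel_integral_real_affine[where c = "\<sigma> / real k" and t = e])
         (use that \<sigma> in \<open>simp_all add: abs_divide mult_ac flip: integral_mult_right_zero\<close>)
  qed
  have lim: "(\<lambda>k. LINT s|lborel. ?h k s) \<longlonglongrightarrow> (LINT s|lborel. f e * (deriv step s * indicator {0..1} s))"
  proof (rule integral_dominated_convergence[where w = "\<lambda>s. B * B1 * indicator {0..1} s"])
    show "AE s in lborel. (\<lambda>k. ?h k s) \<longlonglongrightarrow> f e * (deriv step s * indicator {0..1} s)"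
    proof (rule AE_I2)
      fix s :: real
      show "(\<lambda>k. ?h k s) \<longlonglongrightarrow> f e * (deriv step s * indicator {0..1} s)"
      proof (cases "0 < s \<and> s < 1")
        case True
        have l0: "(\<lambda>k. \<sigma> / real k * s) \<longlonglongrightarrow> 0"
          using tendsto_mult_left_zero[OF tendsto_divide_0[OF tendsto_const filterlim_real_at_infinity_sequentially], where c = s] .
        then have l: "(\<lambda>k. e + \<sigma> / real k * s) \<longlonglongrightarrow> e"
          using tendsto_add[OF tendsto_const[of e] l0] by simp
        have "eventually (\<lambda>k. \<bar>\<sigma> / real k * s\<bar> < d - c) sequentially"
          using tendstoD[OF l0, of "d - c"] cd by (simp add: dist_real_def)
        moreover have "eventually (\<lambda>k. k \<ge> (1::nat)) sequentially" by (rule eventually_ge_at_top)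
        ultimately have ev: "eventually (\<lambda>k. e + \<sigma> / real k * s \<in> {c..d}) sequentially"
        proof eventually_elim
          case (elim k)
          have "s / real k \<ge> 0" "\<bar>s\<bar> = s" using True by auto
          with e elim cd show ?case by auto
        qed
        have "e \<in> {c..d}" using e cd by auto
        then have "(\<lambda>k. f (e + \<sigma> / real k * s)) \<longlonglongrightarrow> f e"
          using f l ev by (rule_tac continuous_on_tendsto_compose) auto
        then have "(\<lambda>k. f (e + \<sigma> / real k * s) * deriv step s) \<longlonglongrightarrow> f e * deriv step s"
          by (intro tendsto_intros)
        moreover have "eventually (\<lambda>k. f (e + \<sigma> / real k * s) * deriv step s = ?h k s) sequentially"
          using ev by eventually_elim simp
        ultimately show ?thesis
          using True by (auto intro: Lim_transform_eventually)
      qed auto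
    qed
    show "AE s in lborel. norm (?h k s) \<le> B * B1 * indicator {0..1} s" for k
    proof (rule AE_I2)
      fix s :: real
      show "norm (?h k s) \<le> B * B1 * indicator {0..1} s"
        using B B1 by (cases "s \<in> {0..1}") (auto simp: indicator_def abs_mult intro!: mult_mono)
    qed
  qed (auto simp: ennreal_mult_less_top)
  \<comment> \<open>The total mass of the kernel is step 1 - step 0 = 1.\<close>
  have "(LINT s|lborel. f e * (deriv step s * indicator {0..1} s)) = f e * (step 1 - step 0)"
    using integral_FTC_Icc_real[of 0 1 step "deriv step"] has_real_derivative_step
      continuous_deriv_step[of UNIV] by (simp add: continuous_on_eq_continuous_at)
  with lim have "(\<lambda>k. LINT s|lborel. ?h k s) \<longlonglongrightarrow> f e * (step 1 - step 0)"
    by (simp only:)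
  then have "(\<lambda>k. LINT s|lborel. ?h k s) \<longlonglongrightarrow> f e"
    by simp
  moreover have "eventually (\<lambda>k. (LINT s|lborel. ?h k s) =
      (LINT x:{c..d}|lborel. f x * (real k * deriv step (real k * (\<sigma> * (x - e)))))) sequentially"
    using eventually_ge_at_top[of 1] by eventually_elim (simp add: eq)
  ultimately show ?thesis
    by (rule Lim_transform_eventually)
qed

text \<open>A smooth plateau over (c, d) with edges of width 1/k. As k grows it approximates the
  indicator; with k = 1 and a growing interval it serves as the cutoff in space.\<close>

definition bump :: "real \<Rightarrow> real \<Rightarrow> real \<Rightarrow> real \<Rightarrow> real" where
  "bump k c d x = step (k * (x - c)) * step (k * (d - x))"

definition bump' :: "real \<Rightarrow> real \<Rightarrow> real \<Rightarrow> real \<Rightarrow> real" where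
  "bump' k c d x = k * deriv step (k * (x - c)) * step (k * (d - x)) -
     k * step (k * (x - c)) * deriv step (k * (d - x))"

lemma has_real_derivative_bump: "(bump k c d has_real_derivative bump' k c d x) (at x)"
proof -
  have 1: "((\<lambda>x. step (k * (x - c))) has_real_derivative deriv step (k * (x - c)) * k) (at x)"
    by (rule DERIV_chain2[OF has_real_derivative_step]) (auto intro!: derivative_eq_intros)
  have 2: "((\<lambda>x. step (k * (d - x))) has_real_derivative deriv step (k * (d - x)) * - k) (at x)"
    by (rule DERIV_chain2[OF has_real_derivative_step]) (auto intro!: derivative_eq_intros)
  show ?thesis
    unfolding bump_def[abs_def] bump'_def
    using DERIV_mult[OF 1 2] by (simp add: algebra_simps)
qed

lemma bump_bounds: "0 \<le> bump k c d x" "bump k c d x \<le> 1"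
  by (auto simp: bump_def step_nonneg step_le_1 mult_le_one)

lemma bump_eq_0: "k \<ge> 0 \<Longrightarrow> x \<notin> {c<..<d} \<Longrightarrow> bump k c d x = 0"
  by (auto simp: bump_def mult_nonneg_nonpos not_less)

lemma bump_deriv_eq_0: "k \<ge> 0 \<Longrightarrow> x \<notin> {c<..<d} \<Longrightarrow> bump' k c d x = 0"
  by (auto simp: bump'_def mult_nonneg_nonpos not_less)

lemma bump_eq_1: "k * (x - c) \<ge> 1 \<Longrightarrow> k * (d - x) \<ge> 1 \<Longrightarrow> bump k c d x = 1"
  by (simp add: bump_def)

lemma eventually_real_mult_ge_1: "(a::real) > 0 \<Longrightarrow> eventually (\<lambda>k. real k * a \<ge> 1) sequentially"
  using eventually_ge_at_top[of "nat \<lceil>1 / a\<rceil>"]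
  by eventually_elim (auto simp: field_simps nat_le_iff ceiling_le_iff)

lemma bump_tendsto: "(\<lambda>k. bump (real k) c d x) \<longlonglongrightarrow> indicator {c<..<d} x"
proof (cases "x \<in> {c<..<d}")
  case True
  have "eventually (\<lambda>k. indicator {c<..<d} x = bump (real k) c d x) sequentially"
    using eventually_real_mult_ge_1[of "x - c"] eventually_real_mult_ge_1[of "d - x"] True
    by (simp, elim eventually_rev_mp) (auto simp: bump_eq_1 intro!: always_eventually)
  then show ?thesis
    by (rule Lim_transform_eventually[OF tendsto_const])
qed (auto simp: bump_eq_0)

lemma continuous_bump: "continuous_on A (bump k c d)"
  by (meson DERIV_continuous_on has_real_derivative_bump has_field_derivative_at_within)

lemma continuous_step: "continuous_on A step"
  by (meson DERIV_continuous_on has_real_derivative_step has_field_derivative_at_within)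

lemma continuous_bump_deriv: "continuous_on A (bump' k c d)"
  unfolding bump'_def
  by (intro continuous_intros continuous_on_compose2[OF continuous_deriv_step[of UNIV]]
      continuous_on_compose2[OF continuous_step[of UNIV]]) auto

lemma bump_measurable [measurable]: "bump k c d \<in> borel_measurable borel"
    "bump' k c d \<in> borel_measurable borel"
  using continuous_bump continuous_bump_deriv by (auto intro: borel_measurable_continuous_onI)

lemma smooth2_bump_fst: "(\<lambda>z. bump k c d (fst z)) \<in> smooth2"
  and smooth2_bump_snd: "(\<lambda>z. bump k c d (snd z)) \<in> smooth2"
  unfolding bump_def by (intro smooth2_intros smooth2_step)+

lemma set_integrable_continuous_compact:
  fixes f :: "'a::euclidean_space \<Rightarrow> real"
  shows "compact S \<Longrightarrow> continuous_on S f \<Longrightarrow> set_integrable lborel S f"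
  unfolding set_integrable_def by (rule borel_integrable_compact)

text \<open>In the limit, differentiating the indicator of (c, d) gives a point mass at c minus a
  point mass at d. This is how weak identities produce boundary values.\<close>

lemma bump_deriv_tendsto:
  fixes f :: "real \<Rightarrow> real"
  assumes cd: "c < d" and f: "continuous_on {c..d} f"
  shows "(\<lambda>k. LINT x:{c..d}|lborel. f x * bump' (real k) c d x) \<longlonglongrightarrow> f c - f d"
proof -
  let ?p = "\<lambda>k x. real k * deriv step (real k * (1 * (x - c)))"
  let ?m = "\<lambda>k x. real k * deriv step (real k * (-1 * (x - d)))"
  have lim: "(\<lambda>k. (LINT x:{c..d}|lborel. f x * ?p k x) - (LINT x:{c..d}|lborel. f x * ?m k x))
      \<longlonglongrightarrow> f c - f d"
    by (intro tendsto_diff delta_limit[OF cd f]) auto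
  have "eventually (\<lambda>k. (LINT x:{c..d}|lborel. f x * ?p k x) - (LINT x:{c..d}|lborel. f x * ?m k x)
      = (LINT x:{c..d}|lborel. f x * bump' (real k) c d x)) sequentially"
    \<comment> \<open>As soon as k (d - c) >= 2 the two edges are disjoint. Where one step varies
      the other equals 1, and \<open>bump'\<close> splits into two one-sided kernels.\<close>
    using eventually_real_mult_ge_1[OF half_gt_zero[of "d - c"], simplified, OF cd]
  proof eventually_elim
    case (elim k)
    then have k: "real k * (d - c) \<ge> 2" using cd by simp
    have split: "real k * (d - x) = real k * (d - c) - real k * (x - c)" for x
      by (simp add: algebra_simps)
    have b: "bump' (real k) c d x = ?p k x - ?m k x" for x
    proof -
      have 1: "deriv step (real k * (x - c)) * step (real k * (d - x)) = deriv step (real k * (x - c))"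
        using k split[of x] by (cases "0 \<le> real k * (x - c) \<and> real k * (x - c) \<le> 1") auto
      have 2: "step (real k * (x - c)) * deriv step (real k * (d - x)) = deriv step (real k * (d - x))"
        using k split[of x] by (cases "0 \<le> real k * (d - x) \<and> real k * (d - x) \<le> 1") auto
      have 3: "- 1 * (x - d) = d - x" by simp
      show ?thesis
        unfolding bump'_def 3 mult.assoc 1 2 by simp
    qed
    have c: "continuous_on {c..d} (\<lambda>x. f x * (real k * deriv step (real k * (\<sigma> * (x - e)))))" for \<sigma> e
      by (intro continuous_intros f continuous_on_compose2[OF continuous_deriv_step[of UNIV]]) auto
    have i: "set_integrable lborel {c..d} (\<lambda>x. f x * (real k * deriv step (real k * (\<sigma> * (x - e)))))" for \<sigma> e
      by (intro set_integrable_continuous_compact c) auto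
    show ?case
      unfolding b right_diff_distrib[of "f x" for x]
      using set_integral_diff(2)[OF i[of 1 c] i[of "-1" d]] by (simp only:)
  qed
  then show ?thesis
    using lim by (rule Lim_transform_eventually[rotated])
qed

lemma continuous_on_integral_param:
  fixes f :: "real \<times> real \<Rightarrow> real"
  assumes "continuous_on (A \<times> {c..d}) f"
  shows "continuous_on A (\<lambda>t. LINT y:{c..d}|lborel. f (t, y))"
proof -
  have "continuous_on A (\<lambda>t. integral (cbox c d) (\<lambda>y. f (t, y)))"
    using assms by (intro integral_continuous_on_param) (simp add: case_prod_unfold)
  moreover have "(LINT y:{c..d}|lborel. f (t, y)) = integral (cbox c d) (\<lambda>y. f (t, y))" if "t \<in> A" for t
  proof -
    have "continuous_on {c..d} (\<lambda>y. f (t, y))"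
      by (rule continuous_on_compose2[OF assms]) (use that in \<open>auto intro!: continuous_intros\<close>)
    then show ?thesis
      using set_borel_integral_eq_integral(2)[OF set_integrable_continuous_compact[of "{c..d}"]]
      by simp
  qed
  ultimately show ?thesis
    by (simp cong: continuous_on_cong)
qed

lemma bump_deriv_tendsto_fst:
  fixes f :: "real \<times> real \<Rightarrow> real"
  assumes ab: "a < b" and f: "continuous_on ({a..b} \<times> {c..d}) f"
  shows "(\<lambda>k. LINT z:{a..b}\<times>{c..d}|lborel. f z * bump' (real k) a b (fst z)) \<longlonglongrightarrow>
    (LINT y:{c..d}|lborel. f (a, y)) - (LINT y:{c..d}|lborel. f (b, y))"
proof -
  have "(LINT z:{a..b}\<times>{c..d}|lborel. f z * bump' (real k) a b (fst z)) =
      (LINT t:{a..b}|lborel. (LINT y:{c..d}|lborel. f (t, y)) * bump' (real k) a b t)" for k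
  proof -
    have "set_integrable lborel ({a..b}\<times>{c..d}) (\<lambda>z. f z * bump' (real k) a b (fst z))"
      by (intro set_integrable_continuous_compact compact_Times continuous_intros f
           continuous_on_compose2[OF continuous_bump_deriv[of UNIV]]) auto
    then show ?thesis
      unfolding set_lebesgue_integral_def set_integrable_def
      by (subst lborel2_fubini(1))
         (auto simp: indicator_times mult_ac simp flip: integral_mult_right_zero integral_mult_left_zero)
  qed
  then show ?thesis
    using bump_deriv_tendsto[OF ab continuous_on_integral_param[OF f]] by simp
qed

lemma bump_deriv_tendsto_snd:
  fixes f :: "real \<times> real \<Rightarrow> real"
  assumes cd: "c < d" and f: "continuous_on ({a..b} \<times> {c..d}) f"
  shows "(\<lambda>k. LINT z:{a..b}\<times>{c..d}|lborel. f z * bump' (real k) c d (snd z)) \<longlonglongrightarrow>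
    (LINT t:{a..b}|lborel. f (t, c)) - (LINT t:{a..b}|lborel. f (t, d))"
proof -
  have f': "continuous_on ({c..d} \<times> {a..b}) (\<lambda>(y, t). f (t, y))"
    unfolding case_prod_unfold
    by (rule continuous_on_compose2[OF f]) (auto intro!: continuous_intros)
  have "(LINT z:{a..b}\<times>{c..d}|lborel. f z * bump' (real k) c d (snd z)) =
      (LINT y:{c..d}|lborel. (LINT t:{a..b}|lborel. f (t, y)) * bump' (real k) c d y)" for k
  proof -
    have "set_integrable lborel ({a..b}\<times>{c..d}) (\<lambda>z. f z * bump' (real k) c d (snd z))"
      by (intro set_integrable_continuous_compact compact_Times continuous_intros f
           continuous_on_compose2[OF continuous_bump_deriv[of UNIV]]) auto
    then show ?thesis
      unfolding set_lebesgue_integral_def set_integrable_def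
      by (subst lborel2_fubini(2))
         (auto simp: indicator_times mult_ac simp flip: integral_mult_right_zero integral_mult_left_zero)
  qed
  then show ?thesis
    using bump_deriv_tendsto[OF cd continuous_on_integral_param[OF f']] by simp
qed

section \<open>Weak derivative in x versus Lipschitz constant in x\<close>

lemma box_subset_domain: "0 < a \<Longrightarrow> b < 1 \<Longrightarrow> {a..b} \<times> B \<subseteq> pde_domain"
  by (auto simp: pde_domain_def)

lemma pde_domain_sets [measurable]: "pde_domain \<in> sets borel"
  unfolding pde_domain_def by (intro borel_open open_Times) auto

lemma box_sets [measurable]: "{a..b} \<times> {c..d} \<in> sets (borel :: (real \<times> real) measure)"
  by (intro borel_closed closed_Times) auto

lemma emeasure_box_finite: "emeasure lborel ({a..b} \<times> {c..d} :: (real \<times> real) set) < \<infinity>"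
  using emeasure_compact_finite[OF compact_Times[OF compact_Icc compact_Icc]] by simp

lemma bump_fst_snd_measurable [measurable]:
  "(\<lambda>z::real\<times>real. bump k c d (fst z)) \<in> borel_measurable borel"
  "(\<lambda>z::real\<times>real. bump k c d (snd z)) \<in> borel_measurable borel"
  using smooth2_bump_fst smooth2_bump_snd
  by (auto intro!: borel_measurable_continuous_onI smooth2_continuous)

lemma set_integral_supported:
  assumes "K \<subseteq> \<Omega>" "\<And>z. z \<in> \<Omega> \<Longrightarrow> z \<notin> K \<Longrightarrow> f z = (0::real)"
  shows "(LINT z:\<Omega>|M. f z) = (LINT z:K|M. f z)"
  unfolding set_lebesgue_integral_def
  using assms by (intro Bochner_Integration.integral_cong refl) (auto simp: indicator_def)

lemma set_integrable_box_ess_bounded: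
  fixes g :: "real \<times> real \<Rightarrow> real" and B a b :: real
  assumes [measurable]: "g \<in> borel_measurable borel"
    and b: "AE z in lborel. z \<in> pde_domain \<longrightarrow> \<bar>g z\<bar> \<le> B" and ab: "0 < a" "b < 1"
  shows "set_integrable lborel ({a..b} \<times> {c..d}) g"
  unfolding set_integrable_def
proof (rule integrableI_bounded_set[of "{a..b} \<times> {c..d}" _ _ B])
  show "AE z in lborel. z \<in> {a..b} \<times> {c..d} \<longrightarrow> norm (indicator ({a..b} \<times> {c..d}) z *\<^sub>R g z) \<le> B"
    using b box_subset_domain[OF ab, of "{c..d}"] by (auto elim!: AE_mp)
qed (use emeasure_box_finite in auto)

lemma AE_not_negligible:
  fixes N :: "'a::euclidean_space set"
  assumes "negligible N"
  shows "AE z in lborel. z \<notin> N"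
proof -
  have "AE z in lebesgue. z \<notin> N"
    using assms by (intro AE_not_in) (simp add: negligible_iff_null_sets)
  then show ?thesis by (simp add: AE_completion_iff)
qed

lemma AE_open_box:
  fixes a b c d :: real
  shows "AE z in lborel. z \<in> {a..b} \<times> {c..d} \<longrightarrow> z \<in> {a<..<b} \<times> {c<..<d}"
proof -
  have "AE z in lborel. z \<notin> (cbox (a, c) (b, d) - box (a, c) (b, d) :: (real \<times> real) set)"
    by (intro AE_not_negligible negligible_frontier_interval)
  then show ?thesis
    by eventually_elim (auto simp: box_def cbox_def Basis_prod_def)
qed

text \<open>Dominated convergence with the integrable function itself as majorant. Convergence is
  only asked for on the open box, since the edges of the box form a null set.\<close>

lemma bump_box_tendsto:
  fixes g :: "real \<times> real \<Rightarrow> real"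
  assumes g: "set_integrable lborel ({a..b} \<times> {c..d}) g"
    and s: "\<And>k. s k \<in> borel_measurable borel" "\<And>k z. \<bar>s k z\<bar> \<le> 1"
    and lim: "\<And>z. z \<in> {a<..<b} \<times> {c<..<d} \<Longrightarrow> (\<lambda>k. s k z) \<longlonglongrightarrow> r z"
    and r: "r \<in> borel_measurable borel"
  shows "(\<lambda>k. LINT z:{a..b} \<times> {c..d}|lborel. g z * s k z) \<longlonglongrightarrow> (LINT z:{a..b} \<times> {c..d}|lborel. g z * r z)"
proof -
  let ?g = "\<lambda>z. indicator ({a..b} \<times> {c..d}) z *\<^sub>R g z"
  have g': "integrable lborel ?g" using g by (simp add: set_integrable_def)
  have "(\<lambda>k. LINT z|lborel. ?g z * s k z) \<longlonglongrightarrow> (LINT z|lborel. ?g z * r z)"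
  proof (rule integral_dominated_convergence[where w = "\<lambda>z. \<bar>?g z\<bar>"])
    show "AE z in lborel. (\<lambda>k. ?g z * s k z) \<longlonglongrightarrow> ?g z * r z"
      using AE_open_box[of a b c d]
    proof eventually_elim
      case (elim z)
      then show ?case
        using lim[of z] by (cases "z \<in> {a..b} \<times> {c..d}") (auto intro!: tendsto_intros)
    qed
    show "AE z in lborel. norm (?g z * s k z) \<le> \<bar>?g z\<bar>" for k
      using s(2)[of k] by (intro AE_I2) (simp add: abs_mult mult_left_le)
  qed (use g' s(1) r in auto)
  then show ?thesis
    by (simp add: set_lebesgue_integral_def mult.assoc)
qed

text \<open>The fundamental theorem of calculus in x, averaged over a time interval. A product of
  two bumps is the test function: sharpening the x-bump turns its derivative into values of u at c
  and d, and then the t-bump is sharpened to the indicator.\<close>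

lemma weak_partial_x_box:
  assumes u: "continuous_on ({0..1} \<times> UNIV) u" and g: "bounded_weak_partial_x u g"
    and ab: "0 < a" "a < b" "b < 1" and cd: "c < d"
  shows "(LINT t:{a..b}|lborel. u (t, d) - u (t, c)) = (LINT z:{a..b} \<times> {c..d}|lborel. g z)"
proof -
  obtain B where gm: "g \<in> borel_measurable borel"
      and B: "AE z in lborel. z \<in> pde_domain \<longrightarrow> \<bar>g z\<bar> \<le> B"
    using g by (auto simp: bounded_weak_partial_x_def)
  note gi = set_integrable_box_ess_bounded[OF gm B ab(1,3)]
  note [measurable] = gm
  let ?K = "{a..b} \<times> {c..d}"
  have uK: "continuous_on ({a..b} \<times> {c..d}) u"
    by (rule continuous_on_subset[OF u]) (use ab in auto)
  have ut: "continuous_on {a..b} (\<lambda>t. u (t, y))" for y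
    by (rule continuous_on_compose2[OF u]) (use ab in \<open>auto intro!: continuous_intros\<close>)
  have test: "(LINT z:?K|lborel. (u z * bump (real j) a b (fst z)) * bump' (real k) c d (snd z)) =
     - (LINT z:?K|lborel. (g z * bump (real j) a b (fst z)) * bump (real k) c d (snd z))" for j k
  proof -
    let ?\<phi> = "\<lambda>z. bump (real j) a b (fst z) * bump (real k) c d (snd z)"
    have 0: "?\<phi> z = 0" if "z \<notin> ?K" for z
      using that bump_eq_0[of "real j" "fst z" a b] bump_eq_0[of "real k" "snd z" c d]
      by (cases z) auto
    have px: "partial_x ?\<phi> z = bump (real j) a b (fst z) * bump' (real k) c d (snd z)" for z
      unfolding partial_x_def case_prod_unfold
      by (rule DERIV_imp_deriv)
         (auto intro!: derivative_eq_intros has_real_derivative_bump)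
    have px0: "partial_x ?\<phi> z = 0" if "z \<notin> ?K" for z
      using that bump_eq_0[of "real j" "fst z" a b] bump_deriv_eq_0[of "real k" "snd z" c d]
      unfolding px by (cases z) auto
    have "?\<phi> \<in> test_functions pde_domain"
      by (rule smooth2_test_function[of _ ?K])
         (use 0 box_subset_domain ab in \<open>auto intro!: smooth2_mult smooth2_bump_fst smooth2_bump_snd compact_Times\<close>)
    then have "(LINT z:pde_domain|lborel. u z * partial_x ?\<phi> z) =
        - (LINT z:pde_domain|lborel. g z * ?\<phi> z)"
      using g by (auto simp: bounded_weak_partial_x_def)
    moreover have "(LINT z:pde_domain|lborel. u z * partial_x ?\<phi> z) =
        (LINT z:?K|lborel. u z * partial_x ?\<phi> z)"
      by (rule set_integral_supported) (use px0 box_subset_domain ab in auto)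
    moreover have "(LINT z:pde_domain|lborel. g z * ?\<phi> z) = (LINT z:?K|lborel. g z * ?\<phi> z)"
      by (rule set_integral_supported) (use 0 box_subset_domain ab in auto)
    ultimately show ?thesis
      unfolding px by (simp add: mult.assoc)
  qed
  have cb: "continuous_on A (\<lambda>z. bump k a b (fst z))" for A :: "(real \<times> real) set" and k
    by (intro continuous_on_compose2[OF continuous_bump[of UNIV]] continuous_intros) auto
  \<comment> \<open>The limit in x is taken with the time bump j fixed. The left side of
    \<open>test\<close> yields boundary values, the right side loses its x-cutoff, and both are
    limits of the same sequence.\<close>
  have step1: "(LINT t:{a..b}|lborel. (u (t, c) - u (t, d)) * bump (real j) a b t) =
     - (LINT z:?K|lborel. g z * bump (real j) a b (fst z))" for j
  proof -
    have ci: "set_integrable lborel {a..b} (\<lambda>t. u (t, y) * bump (real j) a b t)" for y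
      by (intro set_integrable_continuous_compact continuous_intros ut continuous_bump) auto
    have "(\<lambda>k. LINT z:?K|lborel. (u z * bump (real j) a b (fst z)) * bump' (real k) c d (snd z))
      \<longlonglongrightarrow> (LINT t:{a..b}|lborel. u (t, c) * bump (real j) a b t) -
           (LINT t:{a..b}|lborel. u (t, d) * bump (real j) a b t)"
      using bump_deriv_tendsto_snd[OF cd, of a b "\<lambda>z. u z * bump (real j) a b (fst z)"]
      by (simp add: continuous_on_mult[OF uK cb])
    moreover have "(\<lambda>k. LINT z:?K|lborel. (u z * bump (real j) a b (fst z)) * bump' (real k) c d (snd z))
      \<longlonglongrightarrow> - (LINT z:?K|lborel. (g z * bump (real j) a b (fst z)) * 1)"
      unfolding test
    proof (intro tendsto_minus bump_box_tendsto)
      show "set_integrable lborel ?K (\<lambda>z. g z * bump (real j) a b (fst z))"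
        by (rule set_integrable_bound[OF gi])
           (auto simp: set_borel_measurable_def abs_mult bump_bounds mult_left_le)
      show "\<bar>bump (real k) c d (snd z)\<bar> \<le> 1" for k z
        using bump_bounds[of "real k" c d "snd z"] by simp
      show "(\<lambda>k. bump (real k) c d (snd z)) \<longlonglongrightarrow> 1" if "z \<in> {a<..<b} \<times> {c<..<d}" for z
        using bump_tendsto[of c d "snd z"] that by (cases z) auto
    qed auto
    ultimately have "(LINT t:{a..b}|lborel. u (t, c) * bump (real j) a b t) -
           (LINT t:{a..b}|lborel. u (t, d) * bump (real j) a b t) =
           - (LINT z:?K|lborel. (g z * bump (real j) a b (fst z)) * 1)"
      by (rule LIMSEQ_unique)
    then show ?thesis
      using set_integral_diff(2)[OF ci[of c] ci[of d]] by (simp add: left_diff_distrib)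
  qed
  have "(\<lambda>j. LINT t:{a..b}|lborel. (u (t, c) - u (t, d)) * bump (real j) a b t) \<longlonglongrightarrow>
     - (LINT z:?K|lborel. g z * 1)"
    unfolding step1
  proof (intro tendsto_minus bump_box_tendsto gi)
    show "\<bar>bump (real k) a b (fst z)\<bar> \<le> 1" for k z
      using bump_bounds[of "real k" a b "fst z"] by simp
    show "(\<lambda>k. bump (real k) a b (fst z)) \<longlonglongrightarrow> 1" if "z \<in> {a<..<b} \<times> {c<..<d}" for z
      using bump_tendsto[of a b "fst z"] that by (cases z) auto
  qed auto
  moreover have "(\<lambda>j. LINT t:{a..b}|lborel. (u (t, c) - u (t, d)) * bump (real j) a b t) \<longlonglongrightarrow>
     (LINT t:{a..b}|lborel. u (t, c) - u (t, d))"
  proof -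
    let ?f = "\<lambda>t. indicator {a..b} t *\<^sub>R (u (t, c) - u (t, d))"
    have f: "integrable lborel ?f"
      unfolding set_integrable_def[symmetric]
      by (intro set_integrable_continuous_compact continuous_intros ut) auto
    have "(\<lambda>j. LINT t|lborel. ?f t * bump (real j) a b t) \<longlonglongrightarrow> (LINT t|lborel. ?f t)"
    proof (rule integral_dominated_convergence[where w = "\<lambda>t. \<bar>?f t\<bar>"])
      have "AE t in lborel. t \<notin> {a, b}" by (intro AE_not_in countable_imp_null_set_lborel) auto
      then show "AE t in lborel. (\<lambda>j. ?f t * bump (real j) a b t) \<longlonglongrightarrow> ?f t"
      proof eventually_elim
        case (elim t)
        then show ?case
          using tendsto_mult_left[OF bump_tendsto[of a b t], of "?f t"]
          by (cases "t \<in> {a..b}") auto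
      qed
      show "AE t in lborel. norm (?f t * bump (real j) a b t) \<le> \<bar>?f t\<bar>" for j
        using bump_bounds[of "real j" a b] by (intro AE_I2) (simp add: abs_mult mult_left_le)
    qed (use f in auto)
    then show ?thesis
      by (simp add: set_lebesgue_integral_def mult.assoc)
  qed
  ultimately have "(LINT t:{a..b}|lborel. u (t, c) - u (t, d)) = - (LINT z:?K|lborel. g z * 1)"
    using LIMSEQ_unique by blast
  moreover have "(LINT t:{a..b}|lborel. u (t, c) - u (t, d)) = - (LINT t:{a..b}|lborel. u (t, d) - u (t, c))"
    unfolding set_lebesgue_integral_def
    by (subst integral_minus[symmetric]) (auto intro!: Bochner_Integration.integral_cong simp: algebra_simps)
  ultimately show ?thesis by simp
qed

lemma box_integral_bound:
  fixes g :: "real \<times> real \<Rightarrow> real"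
  assumes g: "set_integrable lborel ({a..b} \<times> {c..d}) g" and ab: "a \<le> b" "c \<le> d"
    and B: "AE z in lborel. z \<in> {a..b} \<times> {c..d} \<longrightarrow> \<bar>g z\<bar> \<le> B"
  shows "\<bar>LINT z:{a..b} \<times> {c..d}|lborel. g z\<bar> \<le> B * ((b - a) * (d - c))"
proof -
  let ?K = "{a..b} \<times> {c..d}"
  have m: "measure lborel ?K = (b - a) * (d - c)"
    using ab content_Pair[of a c b d] by (simp add: cbox_Pair_eq)
  have c: "set_integrable lborel ?K (\<lambda>z. B)"
    by (intro set_integrable_continuous_compact compact_Times) auto
  have "\<bar>LINT z:?K|lborel. g z\<bar> \<le> (LINT z:?K|lborel. \<bar>g z\<bar>)"
    using set_integral_norm_bound[OF g] by simp
  also have "\<dots> \<le> (LINT z:?K|lborel. B)"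
    using B by (intro set_integral_mono_AE set_integrable_abs g c) auto
  also have "\<dots> = B * ((b - a) * (d - c))"
    unfolding set_lebesgue_integral_def using m by (simp add: mult.commute)
  finally show ?thesis .
qed

text \<open>A violation at one time persists by continuity on a short time interval, where averaging
  contradicts the box identity.\<close>

lemma weak_partial_x_lipschitz_less:
  assumes u: "continuous_on ({0..1} \<times> UNIV) u" and g: "bounded_weak_partial_x u g"
    and B: "AE z in lborel. z \<in> pde_domain \<longrightarrow> \<bar>g z\<bar> \<le> B"
    and cd: "c < d" and t: "t \<in> {0..1}"
  shows "\<bar>u (t, d) - u (t, c)\<bar> \<le> B * (d - c)"
proof -
  have gm: "g \<in> borel_measurable borel"
    using g by (auto simp: bounded_weak_partial_x_def)
  have uc: "continuous_on {0..1} (\<lambda>t. u (t, y))" for y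
    by (rule continuous_on_compose2[OF u]) (auto intro!: continuous_intros)
  \<comment> \<open>The sign \<sigma> replaces the absolute value, so that the time average of the
    increment stays linear in u.\<close>
  have key: "\<sigma> * (u (s, d) - u (s, c)) \<le> B * (d - c)"
    if \<sigma>: "\<sigma> = 1 \<or> \<sigma> = -1" and s: "s \<in> {0<..<1}" for \<sigma> s
  proof (rule ccontr)
    let ?D = "\<lambda>t. \<sigma> * (u (t, d) - u (t, c))"
    assume "\<not> ?thesis"
    then obtain m where m: "B * (d - c) < m" "m < ?D s"
      using dense[of "B * (d - c)" "?D s"] by auto
    have Dc: "continuous_on {0..1} ?D" by (intro continuous_intros uc)
    then have "isCont ?D s"
      using s continuous_on_interior[of "{0..1}" ?D s] by simp
    then have "(?D \<longlongrightarrow> ?D s) (nhds s)"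
      by (intro iffD1[OF tendsto_at_iff_tendsto_nhds[where g = ?D]]) (simp add: isCont_def)
    then have "eventually (\<lambda>t. m < ?D t) (nhds s)"
      using m(2) by (rule order_tendstoD(1))
    moreover have "eventually (\<lambda>t. t \<in> {0<..<1}) (nhds s)"
      using s by (intro eventually_nhds_in_open) auto
    ultimately have "eventually (\<lambda>t. m < ?D t \<and> t \<in> {0<..<1}) (nhds s)"
      by eventually_elim simp
    then obtain e where e: "e > 0" "\<And>t. dist t s < e \<Longrightarrow> m < ?D t \<and> t \<in> {0<..<1}"
      by (auto simp: eventually_nhds_metric)
    let ?b = "s + e / 2"
    have in_e: "m < ?D t \<and> t \<in> {0<..<1}" if "t \<in> {s..?b}" for t
      using that e by (auto simp: dist_real_def)
    have sb: "0 < s" "s < ?b" "?b < 1" using in_e[of ?b] s e by auto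
    have eq: "(LINT t:{s..?b}|lborel. ?D t) = \<sigma> * (LINT z:{s..?b} \<times> {c..d}|lborel. g z)"
      using weak_partial_x_box[OF u g sb cd] by simp
    have "m * (?b - s) = (LINT t:{s..?b}|lborel. m)"
      using e unfolding set_lebesgue_integral_def by simp
    also have "\<dots> \<le> (LINT t:{s..?b}|lborel. ?D t)"
      using in_e sb
      by (intro set_integral_mono set_integrable_continuous_compact continuous_on_subset[OF Dc])
         (auto intro: less_imp_le)
    also have "\<dots> \<le> B * ((?b - s) * (d - c))"
    proof -
      have "\<bar>LINT z:{s..?b} \<times> {c..d}|lborel. g z\<bar> \<le> B * ((?b - s) * (d - c))"
        using B box_subset_domain[OF sb(1,3), of "{c..d}"] sb cd
        by (intro box_integral_bound set_integrable_box_ess_bounded[OF gm B]) (auto elim!: AE_mp)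
      then show ?thesis
        unfolding eq using \<sigma> by auto
    qed
    finally have "m * (?b - s) \<le> (B * (d - c)) * (?b - s)" by (simp add: mult_ac)
    then show False
      using m(1) sb(2) by simp
  qed
  have "\<bar>u (s, d) - u (s, c)\<bar> \<le> B * (d - c)" if "s \<in> {0<..<1}" for s
    using key[of 1 s] key[of "-1" s] that by auto
  \<comment> \<open>The times 0 and 1 are reached by continuity.\<close>
  then show ?thesis
    using continuous_le_on_closure[of "{0<..<1}" "\<lambda>t. \<bar>u (t, d) - u (t, c)\<bar>" t "B * (d - c)"] t
    by (simp add: continuous_intros uc)
qed

lemma weak_partial_x_lipschitz:
  assumes "continuous_on ({0..1} \<times> UNIV) u" "bounded_weak_partial_x u g"
    and "AE z in lborel. z \<in> pde_domain \<longrightarrow> \<bar>g z\<bar> \<le> B" and "t \<in> {0..1}"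
  shows "\<bar>u (t, y) - u (t, x)\<bar> \<le> B * \<bar>y - x\<bar>"
proof (cases x y rule: linorder_cases)
  case less
  then show ?thesis using weak_partial_x_lipschitz_less[OF assms(1-3) less assms(4)] by simp
next
  case greater
  then show ?thesis using weak_partial_x_lipschitz_less[OF assms(1-3) greater assms(4)] by simp
qed simp

text \<open>Converse of the previous lemma, with a constant that may depend on time. By Lebesgue
  differentiation g is almost everywhere the limit of its averages over small squares, and the box
  identity writes each average as a mean of difference quotients of u.\<close>

lemma lipschitz_weak_partial_x:
  assumes u: "continuous_on ({0..1} \<times> UNIV) u" and g: "bounded_weak_partial_x u g"
    and K: "continuous_on {0<..<1} K"
    and lip: "\<And>t x y. t \<in> {0<..<1} \<Longrightarrow> \<bar>u (t, y) - u (t, x)\<bar> \<le> K t * \<bar>y - x\<bar>"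
  shows "AE z in lborel. z \<in> pde_domain \<longrightarrow> \<bar>g z\<bar> \<le> K (fst z)"
proof -
  obtain B where gm[measurable]: "g \<in> borel_measurable borel"
      and B: "AE z in lborel. z \<in> pde_domain \<longrightarrow> \<bar>g z\<bar> \<le> B"
    using g by (auto simp: bounded_weak_partial_x_def)
  \<comment> \<open>Extension by zero makes g integrable on every box, as the differentiation
    theorem asks.\<close>
  let ?f = "\<lambda>z. indicator pde_domain z * g z"
  have fi: "?f integrable_on cbox a b" for a b
  proof -
    have "set_integrable lborel (cbox a b) ?f"
      unfolding set_integrable_def
    proof (rule integrableI_bounded_set[of "cbox a b" _ _ "max B 0"])
      show "AE z in lborel. z \<in> cbox a b \<longrightarrow> norm (indicator (cbox a b) z *\<^sub>R ?f z) \<le> max B 0"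
        using B by eventually_elim (auto simp: indicator_def)
    qed (auto simp: emeasure_lborel_cbox_eq)
    then show ?thesis by (rule set_borel_integral_eq_integral)
  qed
  have One: "(\<Sum>(Basis :: (real \<times> real) set)) = (1, 1)"
    by (simp add: Basis_prod_def)
  obtain N where N: "negligible N" and lim: "\<And>x e. x \<notin> N \<Longrightarrow> 0 < e \<Longrightarrow>
      \<exists>d>0. \<forall>h. 0 < h \<and> h < d \<longrightarrow>
        norm (integral (cbox x (x + h *\<^sub>R One)) ?f /\<^sub>R h ^ DIM(real \<times> real) - ?f x) < e"
    using integrable_ccontinuous_explicit[OF fi] by blast
  have "\<bar>g (t, y)\<bar> \<le> K t" if tN: "(t, y) \<notin> N" and t: "t \<in> {0<..<1}" for t y
  proof (rule ccontr)
    assume neg: "\<not> ?thesis"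
    \<comment> \<open>Half of the excess: one e pays for the variation of K near t, the other for
      the error of the average.\<close>
    define e where "e = (\<bar>g (t, y)\<bar> - K t) / 2"
    have e: "e > 0" using neg by (simp add: e_def)
    obtain \<eta> where \<eta>: "\<eta> > 0" "\<And>h. 0 < h \<Longrightarrow> h < \<eta> \<Longrightarrow>
        norm (integral (cbox (t, y) ((t, y) + h *\<^sub>R One)) ?f /\<^sub>R h ^ DIM(real \<times> real) - ?f (t, y)) < e"
      using lim[OF tN e] by blast
    have "isCont K t" using K t by (simp add: continuous_on_eq_continuous_at)
    then have "(K \<longlongrightarrow> K t) (nhds t)"
      by (intro iffD1[OF tendsto_at_iff_tendsto_nhds]) (simp add: isCont_def)
    then have "eventually (\<lambda>s. K s < K t + e) (nhds t)"
      by (rule order_tendstoD(2)) (use e in linarith)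
    then obtain \<delta> where \<delta>: "\<delta> > 0" "\<And>s. dist s t < \<delta> \<Longrightarrow> K s < K t + e"
      by (auto simp: eventually_nhds_metric)
    obtain h where h: "h > 0" "h < \<eta>" "h < \<delta>" "h < 1 - t"
      using dense[of 0 "min \<eta> (min \<delta> (1 - t))"] \<eta>(1) \<delta>(1) t by auto
    let ?K = "{t..t + h} \<times> {y..y + h}"
    have th: "0 < t" "t < t + h" "t + h < 1" using t h by auto
    have gi: "set_integrable lborel ?K g"
      by (rule set_integrable_box_ess_bounded[OF gm B th(1,3)])
    have "cbox (t, y) ((t, y) + h *\<^sub>R One) = ?K"
      by (simp add: One cbox_Pair_eq)
    then have "integral (cbox (t, y) ((t, y) + h *\<^sub>R One)) ?f = integral ?K g"
      using box_subset_domain[OF th(1,3), of "{y..y+h}"]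
      by (auto intro!: Henstock_Kurzweil_Integration.integral_cong simp: indicator_def)
    also have "\<dots> = (LINT z:?K|lborel. g z)"
      using set_borel_integral_eq_integral(2)[OF gi] by simp
    also have "\<dots> = (LINT s:{t..t+h}|lborel. u (s, y + h) - u (s, y))"
      using weak_partial_x_box[OF u g th, of y "y + h"] h by simp
    finally have I: "integral (cbox (t, y) ((t, y) + h *\<^sub>R One)) ?f =
       (LINT s:{t..t+h}|lborel. u (s, y + h) - u (s, y))" .
    have uc: "continuous_on {t..t+h} (\<lambda>t. u (t, y))" for y
      by (rule continuous_on_compose2[OF u]) (use th in \<open>auto intro!: continuous_intros\<close>)
    have ui: "set_integrable lborel {t..t+h} (\<lambda>s. u (s, y + h) - u (s, y))"
      by (intro set_integrable_continuous_compact continuous_intros uc) auto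
    have "\<bar>LINT s:{t..t+h}|lborel. u (s, y + h) - u (s, y)\<bar> \<le>
        (LINT s:{t..t+h}|lborel. \<bar>u (s, y + h) - u (s, y)\<bar>)"
      using set_integral_norm_bound[OF ui] by simp
    also have "\<dots> \<le> (LINT s:{t..t+h}|lborel. (K t + e) * h)"
    proof (intro set_integral_mono set_integrable_abs ui)
      fix s assume s: "s \<in> {t..t+h}"
      then have "\<bar>u (s, y + h) - u (s, y)\<bar> \<le> K s * h" using lip[of s "y + h" y] th h by auto
      also have "\<dots> \<le> (K t + e) * h"
        using \<delta>(2)[of s] s h by (intro mult_right_mono less_imp_le) (auto simp: dist_real_def)
      finally show "\<bar>u (s, y + h) - u (s, y)\<bar> \<le> (K t + e) * h" .
    qed (intro set_integrable_continuous_compact, auto)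
    also have "\<dots> = (K t + e) * h ^ 2"
      unfolding set_lebesgue_integral_def using h by (simp add: power2_eq_square)
    finally have "\<bar>(LINT s:{t..t+h}|lborel. u (s, y + h) - u (s, y)) / h ^ 2\<bar> \<le> K t + e"
      using h by (simp add: abs_divide field_simps)
    moreover have "\<bar>(LINT s:{t..t+h}|lborel. u (s, y + h) - u (s, y)) / h ^ 2 - g (t, y)\<bar> < e"
    proof -
      have "(t, y) \<in> pde_domain" using t by (simp add: pde_domain_def)
      then show ?thesis
        using \<eta>(2)[OF h(1,2)] unfolding I by (simp add: divide_inverse mult.commute power2_eq_square)
    qed
    ultimately have "\<bar>g (t, y)\<bar> < K t + 2 * e" by linarith
    then show False by (simp add: e_def field_simps)
  qed
  moreover have "AE z in lborel. z \<notin> N"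
    by (rule AE_not_negligible[OF N])
  ultimately show ?thesis
    by (auto simp: pde_domain_def elim!: AE_mp)
qed

section \<open>The mild formulation\<close>

lemma derivative_eq_0_outside:
  fixes h :: "real \<Rightarrow> real"
  assumes "(h has_real_derivative D) (at y)" "\<And>y. \<bar>y\<bar> > R \<Longrightarrow> h y = 0" "\<bar>y\<bar> > R"
  shows "D = 0"
proof -
  have "open {y::real. R < \<bar>y\<bar>}" by (intro open_Collect_less continuous_intros)
  then have "(h has_real_derivative 0) (at y)"
    using has_field_derivative_transform_within_open[OF DERIV_const[of 0 "at y"], of "{y. R < \<bar>y\<bar>}" h]
      assms(2,3) by auto
  then show ?thesis using assms(1) DERIV_unique by blast
qed

lemma norm_mult_bump_le: "norm (a * bump k c d x) \<le> norm (a::real)"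
  using bump_bounds[of k c d x] by (simp add: abs_mult mult_left_le)

lemma null_sequence_less_1:
  "\<exists>s :: nat \<Rightarrow> real. (\<forall>n. 0 < s n) \<and> (\<forall>n. s n < 1) \<and> s \<longlonglongrightarrow> 0"
proof (intro exI conjI allI)
  show "(\<lambda>n. (1 / 2) ^ Suc n :: real) \<longlonglongrightarrow> 0"
    by (intro LIMSEQ_Suc LIMSEQ_power_zero) simp
  show "(1 / 2) ^ Suc n < (1 :: real)" for n
    by (rule power_Suc_less_one) auto
qed simp

text \<open>In the application \<open>P\<close> is \<xi>', \<open>w\<close> the difference of two
  weak solutions and \<open>F\<close> the difference of their quadratic terms. Linear growth makes w
  integrable against Gaussian kernels.\<close>

locale heat_source =
  fixes P :: "real poly" and w F :: "real \<times> real \<Rightarrow> real" and A B :: real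
  assumes P_mono: "\<And>t. t \<ge> 0 \<Longrightarrow> poly (pderiv P) t \<ge> 0"
    and w_cont: "continuous_on ({0..1} \<times> UNIV) w"
    and w_1: "\<And>x. w (1, x) = 0"
    and w_growth: "\<And>t y. t \<in> {0..1} \<Longrightarrow> \<bar>w (t, y)\<bar> \<le> A * (1 + \<bar>y\<bar>)"
    and F_meas: "F \<in> borel_measurable borel"
    and F_bound: "AE z in lborel. \<bar>F z\<bar> \<le> B"
    and weak: "\<And>\<phi>. \<phi> \<in> test_functions pde_domain \<Longrightarrow>
      (LINT z:pde_domain|lborel. - w z * partial_t \<phi> z
         + poly (pderiv P) (fst z) / 2 * (w z * partial_x (partial_x \<phi>) z + F z * \<phi> z)) = 0"
begin

text \<open>The diffusion coefficient: the equation reads w_t + q (w_xx + F) = 0.\<close>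

definition q :: "real \<Rightarrow> real" where "q t = poly (pderiv P) t / 2"

lemma q_nonneg: "t \<ge> 0 \<Longrightarrow> q t \<ge> 0"
  using P_mono by (simp add: q_def)

lemma continuous_q: "continuous_on S q"
  unfolding q_def[abs_def] by (intro continuous_intros) simp

lemma continuous_q_fst: "continuous_on S (\<lambda>z::real\<times>real. q (fst z))"
  by (intro continuous_on_compose2[OF continuous_q[of UNIV]] continuous_intros) auto

lemma set_integrable_integrand:
  fixes a b c d :: real
  assumes \<phi>: "\<phi> \<in> smooth2" and ab: "0 \<le> a" "b \<le> 1"
  shows "set_integrable lborel ({a..b} \<times> {c..d}) (\<lambda>z. - w z * partial_t \<phi> z
    + q (fst z) * (w z * partial_x (partial_x \<phi>) z + F z * \<phi> z))"
proof -
  let ?K = "{a..b} \<times> {c..d}"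
  note [measurable] = F_meas
  have wK: "continuous_on ?K w"
    by (rule continuous_on_subset[OF w_cont]) (use ab in auto)
  note px = smooth2_partial_x[OF \<phi>] and pt = smooth2_partial_t[OF \<phi>]
  note pxx = smooth2_partial_x[OF px(1)]
  note cs = smooth2_continuous[OF \<phi>] smooth2_continuous[OF pt(1)] smooth2_continuous[OF pxx(1)]
    have 1: "set_integrable lborel ?K (\<lambda>z. - w z * partial_t \<phi> z + q (fst z) * w z * partial_x (partial_x \<phi>) z)"
      by (intro set_integrable_continuous_compact compact_Times continuous_intros wK cs continuous_q_fst) auto
    have c2: "continuous_on ?K (\<lambda>z. q (fst z) * \<phi> z)"
      by (intro continuous_intros cs continuous_q_fst)
    have "compact ((\<lambda>z. q (fst z) * \<phi> z) ` ?K)"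
      by (intro compact_continuous_image c2 compact_Times) auto
    then obtain C where C: "C > 0" "\<And>z. z \<in> ?K \<Longrightarrow> \<bar>q (fst z) * \<phi> z\<bar> \<le> C"
      by (metis (no_types, lifting) bounded_pos compact_imp_bounded imageI real_norm_def)
    have [measurable]: "(\<lambda>z. q (fst z) * \<phi> z) \<in> borel_measurable borel"
      by (intro borel_measurable_continuous_onI continuous_intros cs continuous_q_fst)
    have 2: "set_integrable lborel ?K (\<lambda>z. F z * (q (fst z) * \<phi> z))"
      unfolding set_integrable_def
    proof (rule integrableI_bounded_set[of ?K _ _ "B * C"])
      show "AE z in lborel. z \<in> ?K \<longrightarrow> norm (indicator ?K z *\<^sub>R (F z * (q (fst z) * \<phi> z))) \<le> B * C"
        using F_bound
      proof eventually_elim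
        case (elim z)
        then show ?case
          using mult_mono'[OF elim C(2)[of z]] by (auto simp: abs_mult)
      qed
    qed (use emeasure_box_finite in auto)
    show ?thesis
      using set_integral_add(1)[OF 1 2] by (simp add: algebra_simps)
qed

text \<open>Here \<phi> has bounded support in y only. A time bump makes it admissible, and
  sharpening that bump leaves the values of w at t0 and t1 as boundary terms.\<close>

lemma weak_compact_strict:
  assumes \<phi>: "\<phi> \<in> smooth2" and supp: "\<And>t y. \<bar>y\<bar> \<ge> R \<Longrightarrow> \<phi> (t, y) = 0"
    and t: "0 < t0" "t0 < t1" "t1 < 1"
  shows "(LINT y:{-R..R}|lborel. w (t0, y) * \<phi> (t0, y)) - (LINT y:{-R..R}|lborel. w (t1, y) * \<phi> (t1, y)) =
    (LINT z:{t0..t1} \<times> {-R..R}|lborel. - w z * partial_t \<phi> z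
       + q (fst z) * (w z * partial_x (partial_x \<phi>) z + F z * \<phi> z))"
proof -
  let ?K = "{t0..t1} \<times> {-R..R}"
  note [measurable] = F_meas
  have wK: "continuous_on ?K w"
    by (rule continuous_on_subset[OF w_cont]) (use t in auto)
  note px = smooth2_partial_x[OF \<phi>] and pt = smooth2_partial_t[OF \<phi>]
  note pxx = smooth2_partial_x[OF px(1)]
  note cs = smooth2_continuous[OF \<phi>] smooth2_continuous[OF pt(1)] smooth2_continuous[OF pxx(1)]
  let ?h = "\<lambda>z. - w z * partial_t \<phi> z + q (fst z) * (w z * partial_x (partial_x \<phi>) z + F z * \<phi> z)"
  have hi: "set_integrable lborel ?K ?h"
    by (rule set_integrable_integrand[OF \<phi>]) (use t in auto)
  have out: "\<phi> z = 0 \<and> partial_t \<phi> z = 0 \<and> partial_x (partial_x \<phi>) z = 0" if "\<bar>snd z\<bar> > R" for z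
  proof -
    obtain t y where z: "z = (t, y)" by (cases z)
    have y: "\<bar>y\<bar> > R" using that z by simp
    have x0: "partial_x \<phi> (t, y') = 0" if "\<bar>y'\<bar> > R" for y'
      by (rule derivative_eq_0_outside[OF px(2) _ that]) (use supp in auto)
    have "partial_x (partial_x \<phi>) (t, y) = 0"
      by (rule derivative_eq_0_outside[OF pxx(2) x0 y])
    moreover have "partial_t \<phi> (t, y) = 0"
      using DERIV_unique[OF pt(2)[of y t], of 0] y supp by simp
    ultimately show ?thesis using y supp z by auto
  qed
  have nK: "fst z \<notin> {t0<..<t1} \<or> \<bar>snd z\<bar> > R" if "z \<notin> ?K" for z
    using that by (cases z) (auto simp: abs_less_iff not_le)
  \<comment> \<open>The weak equation tested with bump times \<phi>. Only the time derivative hits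
    the bump, which gives the left side; all other terms just carry the bump as a factor.\<close>
  have test: "(LINT z:?K|lborel. (w z * \<phi> z) * bump' (real k) t0 t1 (fst z)) =
      (LINT z:?K|lborel. ?h z * bump (real k) t0 t1 (fst z))" for k
  proof -
    let ?\<psi> = "\<lambda>z. bump (real k) t0 t1 (fst z) * \<phi> z"
    have 0: "?\<psi> z = 0" if "z \<notin> ?K" for z
      using nK[OF that] bump_eq_0[of "real k" "fst z" t0 t1] out[of z] by (elim disjE) simp_all
    have "?\<psi> \<in> test_functions pde_domain"
      by (rule smooth2_test_function[of _ ?K])
         (use 0 box_subset_domain t in \<open>auto intro!: smooth2_mult smooth2_bump_fst compact_Times \<phi>\<close>)
    note w0 = weak[OF this]
    have t': "partial_t ?\<psi> z = bump' (real k) t0 t1 (fst z) * \<phi> z + bump (real k) t0 t1 (fst z) * partial_t \<phi> z" for z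
    proof (cases z)
      case (Pair t y)
      have "((\<lambda>s. ?\<psi> (s, y)) has_real_derivative
        bump' (real k) t0 t1 t * \<phi> (t, y) + bump (real k) t0 t1 t * partial_t \<phi> (t, y)) (at t)"
        using DERIV_mult[OF has_real_derivative_bump[of "real k" t0 t1 t] pt(2)[of y t]]
        by (simp add: mult.commute)
      then show ?thesis unfolding Pair by (simp add: partial_t_def DERIV_imp_deriv)
    qed
    have x': "partial_x ?\<psi> = (\<lambda>z. bump (real k) t0 t1 (fst z) * partial_x \<phi> z)"
    proof
      fix z :: "real \<times> real"
      obtain t y where z: "z = (t, y)" by (cases z)
      have "((\<lambda>y. ?\<psi> (t, y)) has_real_derivative bump (real k) t0 t1 t * partial_x \<phi> (t, y)) (at y)"
        using DERIV_cmult[OF px(2)[of t y]] by simp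
      then show "partial_x ?\<psi> z = bump (real k) t0 t1 (fst z) * partial_x \<phi> z"
        unfolding z by (simp add: partial_x_def DERIV_imp_deriv)
    qed
    have x'': "partial_x (partial_x ?\<psi>) z = bump (real k) t0 t1 (fst z) * partial_x (partial_x \<phi>) z" for z
    proof (cases z)
      case (Pair t y)
      have "((\<lambda>y. partial_x ?\<psi> (t, y)) has_real_derivative
          bump (real k) t0 t1 t * partial_x (partial_x \<phi>) (t, y)) (at y)"
        unfolding x' using DERIV_cmult[OF pxx(2)[of t y]] by simp
      then show ?thesis unfolding Pair by (simp add: partial_x_def[of "partial_x ?\<psi>"] DERIV_imp_deriv)
    qed
    let ?i = "\<lambda>z. ?h z * bump (real k) t0 t1 (fst z) - (w z * \<phi> z) * bump' (real k) t0 t1 (fst z)"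
    have eq: "- w z * partial_t ?\<psi> z
         + poly (pderiv P) (fst z) / 2 * (w z * partial_x (partial_x ?\<psi>) z + F z * ?\<psi> z) = ?i z" for z
      unfolding t' x'' q_def by (simp add: algebra_simps)
    have "(LINT z:pde_domain|lborel. ?i z) = (LINT z:?K|lborel. ?i z)"
    proof (rule set_integral_supported)
      fix z assume z: "z \<notin> ?K"
      show "?i z = 0"
        using nK[OF z]
      proof
        assume "fst z \<notin> {t0<..<t1}"
        then have "bump (real k) t0 t1 (fst z) = 0" "bump' (real k) t0 t1 (fst z) = 0"
          using bump_eq_0[of "real k" "fst z" t0 t1] bump_deriv_eq_0[of "real k" "fst z" t0 t1] by simp_all
        then show ?thesis by simp
      next
        assume "\<bar>snd z\<bar> > R"
        from out[OF this] show ?thesis by simp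
      qed
    qed (use box_subset_domain t in auto)
    with w0 have "(LINT z:?K|lborel. ?i z) = 0"
      unfolding eq by (simp only:)
    moreover have "set_integrable lborel ?K (\<lambda>z. ?h z * bump (real k) t0 t1 (fst z))"
    proof (rule set_integrable_bound[OF hi])
      show "set_borel_measurable lborel ?K (\<lambda>z. ?h z * bump (real k) t0 t1 (fst z))"
      proof -
        have "(\<lambda>z. (indicator ?K z *\<^sub>R ?h z) * bump (real k) t0 t1 (fst z)) \<in> borel_measurable lborel"
          using borel_measurable_integrable[OF hi[unfolded set_integrable_def]]
          by (intro borel_measurable_times bump_fst_snd_measurable) simp_all
        then show ?thesis
          unfolding set_borel_measurable_def by (simp only: real_scaleR_def mult.assoc)
      qed
    qed (intro AE_I2 impI norm_mult_bump_le)
    moreover have "set_integrable lborel ?K (\<lambda>z. (w z * \<phi> z) * bump' (real k) t0 t1 (fst z))"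
      by (intro set_integrable_continuous_compact compact_Times continuous_intros wK cs
          continuous_on_compose2[OF continuous_bump_deriv[of UNIV]]) auto
    ultimately show ?thesis
      by (simp add: set_integral_diff)
  qed
  have "(\<lambda>k. LINT z:?K|lborel. (w z * \<phi> z) * bump' (real k) t0 t1 (fst z)) \<longlonglongrightarrow>
      (LINT y:{-R..R}|lborel. w (t0, y) * \<phi> (t0, y)) - (LINT y:{-R..R}|lborel. w (t1, y) * \<phi> (t1, y))"
    using bump_deriv_tendsto_fst[OF t(2), of "-R" R "\<lambda>z. w z * \<phi> z"] by (simp add: continuous_on_mult wK cs)
  moreover have "(\<lambda>k. LINT z:?K|lborel. (w z * \<phi> z) * bump' (real k) t0 t1 (fst z)) \<longlonglongrightarrow>
      (LINT z:?K|lborel. ?h z * 1)"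
    unfolding test
  proof (rule bump_box_tendsto[OF hi])
    show "\<bar>bump (real k) t0 t1 (fst z)\<bar> \<le> 1" for k and z :: "real \<times> real"
      using bump_bounds[of "real k" t0 t1 "fst z"] by simp
    show "(\<lambda>k. bump (real k) t0 t1 (fst z)) \<longlonglongrightarrow> 1" if "z \<in> {t0<..<t1} \<times> {-R<..<R}" for z
      using bump_tendsto[of t0 t1 "fst z"] that by (cases z) auto
  qed auto
  ultimately show ?thesis
    using LIMSEQ_unique by fastforce
qed

text \<open>The upper time is moved to 1, where the boundary term disappears because w vanishes
  there.\<close>

lemma weak_compact:
  assumes \<phi>: "\<phi> \<in> smooth2" and supp: "\<And>t y. \<bar>y\<bar> \<ge> R \<Longrightarrow> \<phi> (t, y) = 0"
    and t: "0 < t0" "t0 < 1"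
  shows "(LINT y:{-R..R}|lborel. w (t0, y) * \<phi> (t0, y)) =
    (LINT z:{t0..1} \<times> {-R..R}|lborel. - w z * partial_t \<phi> z
       + q (fst z) * (w z * partial_x (partial_x \<phi>) z + F z * \<phi> z))"
proof -
  let ?h = "\<lambda>z. - w z * partial_t \<phi> z + q (fst z) * (w z * partial_x (partial_x \<phi>) z + F z * \<phi> z)"
  let ?W = "\<lambda>t. LINT y:{-R..R}|lborel. w (t, y) * \<phi> (t, y)"
  let ?K = "{t0..1} \<times> {-R..R}"
  note [measurable] = F_meas
  have wK: "continuous_on ?K w"
    by (rule continuous_on_subset[OF w_cont]) (use t in auto)
  note px = smooth2_partial_x[OF \<phi>] and pt = smooth2_partial_t[OF \<phi>]
  note pxx = smooth2_partial_x[OF px(1)]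
  note cs = smooth2_continuous[OF \<phi>] smooth2_continuous[OF pt(1)] smooth2_continuous[OF pxx(1)]
  obtain s :: "nat \<Rightarrow> real" where s: "\<And>n. 0 < s n" "\<And>n. s n < 1" "s \<longlonglongrightarrow> 0"
    using null_sequence_less_1 by blast
  \<comment> \<open>Upper times in (t0, 1) that converge to 1.\<close>
  define r where "r n = 1 - (1 - t0) * s n" for n :: nat
  have r: "t0 < r n" "r n < 1" for n
  proof -
    have "0 < (1 - t0) * s n" "(1 - t0) * s n < (1 - t0) * 1"
      using t s(1)[of n] s(2)[of n] by (auto intro!: mult_strict_left_mono)
    then show "t0 < r n" "r n < 1" by (simp_all add: r_def)
  qed
  have "(\<lambda>n. 1 - (1 - t0) * s n) \<longlonglongrightarrow> 1 - 0"
    by (intro tendsto_diff tendsto_const tendsto_mult_right_zero s(3))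
  then have rlim: "r \<longlonglongrightarrow> 1"
    by (simp add: r_def[abs_def])
  have hi: "set_integrable lborel ?K ?h"
    by (rule set_integrable_integrand[OF \<phi>]) (use t in auto)
  have "(\<lambda>n. ?W (r n)) \<longlonglongrightarrow> ?W 1"
  proof (rule continuous_on_tendsto_compose[of "{t0..1}" ?W])
    show "continuous_on {t0..1} ?W"
      by (rule continuous_on_integral_param[of "{t0..1}" "-R" R "\<lambda>z. w z * \<phi> z", simplified])
         (intro continuous_intros wK cs)
  qed (use rlim r t in \<open>auto intro!: always_eventually less_imp_le\<close>)
  then have 1: "(\<lambda>n. ?W t0 - ?W (r n)) \<longlonglongrightarrow> ?W t0"
    using tendsto_diff[OF tendsto_const[of "?W t0"], of "\<lambda>n. ?W (r n)" "?W 1"] by (simp add: w_1)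
  have "(\<lambda>n. LINT z:?K|lborel. ?h z * indicator {..r n} (fst z)) \<longlonglongrightarrow> (LINT z:?K|lborel. ?h z * 1)"
  proof (rule bump_box_tendsto[OF hi])
    show "(\<lambda>n. indicator {..r n} (fst z)) \<longlonglongrightarrow> (1::real)" if "z \<in> {t0<..<1} \<times> {-R<..<R}" for z
    proof (rule tendsto_eventually)
      have "eventually (\<lambda>n. r n > fst z) sequentially"
        by (rule order_tendstoD(1)[OF rlim]) (use that in auto)
      then show "eventually (\<lambda>n. indicator {..r n} (fst z) = (1::real)) sequentially"
        by eventually_elim simp
    qed
    show "(\<lambda>z. indicator {..r k} (fst z)) \<in> borel_measurable borel" for k
      by (rule measurable_compose[of fst borel borel])
         (auto intro!: borel_measurable_continuous_onI continuous_intros)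
  qed (auto simp: indicator_def)
  moreover have "(LINT z:?K|lborel. ?h z * indicator {..r n} (fst z)) = ?W t0 - ?W (r n)" for n
  proof -
    have "(LINT z:?K|lborel. ?h z * indicator {..r n} (fst z)) = (LINT z:{t0..r n} \<times> {-R..R}|lborel. ?h z)"
      unfolding set_lebesgue_integral_def
      by (intro Bochner_Integration.integral_cong refl) (use r[of n] in \<open>auto simp: indicator_def\<close>)
    then show ?thesis
      using weak_compact_strict[OF \<phi> supp t(1) r(1) r(2)[of n]] by simp
  qed
  ultimately show ?thesis
    using LIMSEQ_unique[OF 1] by simp
qed

end

section \<open>Removing the cutoff in space\<close>

lemma integrable_mult_fst_snd:
  fixes f g :: "real \<Rightarrow> real"
  assumes f: "integrable lborel f" and g: "integrable lborel g"
  shows "integrable lborel (\<lambda>z. f (fst z) * g (snd z))"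
proof -
  have [measurable]: "f \<in> borel_measurable borel" "g \<in> borel_measurable borel"
    using f g by (auto dest: borel_measurable_integrable)
  have "integrable (lborel \<Otimes>\<^sub>M lborel) (\<lambda>z. f (fst z) * g (snd z))"
  proof (rule lborel_pair.Fubini_integrable)
    show "integrable lborel (\<lambda>x. LINT y|lborel. norm (f (fst (x, y)) * g (snd (x, y))))"
      using f g by (simp add: abs_mult)
    show "AE x in lborel. integrable lborel (\<lambda>y. f (fst (x, y)) * g (snd (x, y)))"
      using g by simp
  qed measurable
  then show ?thesis by (simp add: lborel_prod)
qed

definition bump'' :: "real \<Rightarrow> real \<Rightarrow> real \<Rightarrow> real \<Rightarrow> real" where
  "bump'' k c d x = k\<^sup>2 * (deriv (deriv step) (k * (x - c)) * step (k * (d - x))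
     - 2 * deriv step (k * (x - c)) * deriv step (k * (d - x))
     + step (k * (x - c)) * deriv (deriv step) (k * (d - x)))"

lemma has_real_derivative_bump': "(bump' k c d has_real_derivative bump'' k c d x) (at x)"
proof -
  have 1: "((\<lambda>x. step (k * (x - c))) has_real_derivative deriv step (k * (x - c)) * k) (at x)"
    by (rule DERIV_chain2[OF has_real_derivative_step]) (auto intro!: derivative_eq_intros)
  have 2: "((\<lambda>x. step (k * (d - x))) has_real_derivative deriv step (k * (d - x)) * - k) (at x)"
    by (rule DERIV_chain2[OF has_real_derivative_step]) (auto intro!: derivative_eq_intros)
  have 3: "((\<lambda>x. deriv step (k * (x - c))) has_real_derivative deriv (deriv step) (k * (x - c)) * k) (at x)"
    by (rule DERIV_chain2[OF has_real_derivative_deriv_step]) (auto intro!: derivative_eq_intros)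
  have 4: "((\<lambda>x. deriv step (k * (d - x))) has_real_derivative deriv (deriv step) (k * (d - x)) * - k) (at x)"
    by (rule DERIV_chain2[OF has_real_derivative_deriv_step]) (auto intro!: derivative_eq_intros)
  show ?thesis
    unfolding bump'_def[abs_def] bump''_def mult.assoc
    by (rule DERIV_cong[OF DERIV_diff[OF DERIV_cmult[OF DERIV_mult[OF 3 2]] DERIV_cmult[OF DERIV_mult[OF 1 4]]]])
       (simp add: algebra_simps power2_eq_square)
qed

text \<open>With k = 1 the edges have fixed width, so widening the plateau does not increase the
  derivatives. This uniformity provides a single majorant for all cutoffs.\<close>

lemma bump_derivs_bounded:
  "\<exists>C>0. \<forall>c d x. \<bar>bump' 1 c d x\<bar> \<le> C \<and> \<bar>bump'' 1 c d x\<bar> \<le> C"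
proof -
  obtain B1 where B1: "B1 > 0" "\<And>x. \<bar>deriv step x\<bar> \<le> B1"
    using bounded_compact_support[OF continuous_deriv_step deriv_step_0] by blast
  obtain B2 where B2: "B2 > 0" "\<And>x. \<bar>deriv (deriv step) x\<bar> \<le> B2"
    using bounded_compact_support[OF continuous_deriv_deriv_step deriv_deriv_step_0] by blast
  have s: "\<bar>step x\<bar> \<le> 1" for x using step_nonneg[of x] step_le_1[of x] by simp
  have *: "\<bar>a * b\<bar> \<le> K * L" if "\<bar>a\<bar> \<le> K" "\<bar>b\<bar> \<le> L" for a b K L :: real
    using that by (auto simp: abs_mult intro!: mult_mono)
  show ?thesis
  proof (intro exI[of _ "2 * B1 + (2 * B2 + 2 * (B1 * B1))"] conjI allI)
    fix c d x
    have "\<bar>bump' 1 c d x\<bar> \<le> 2 * B1"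
      using *[OF B1(2)[of "x - c"] s[of "d - x"]] *[OF s[of "x - c"] B1(2)[of "d - x"]]
      unfolding bump'_def by simp
    then show "\<bar>bump' 1 c d x\<bar> \<le> 2 * B1 + (2 * B2 + 2 * (B1 * B1))"
      using B1(1) B2(1) mult_pos_pos[OF B1(1) B1(1)] by linarith
    have "\<bar>bump'' 1 c d x\<bar> \<le> 2 * B2 + 2 * (B1 * B1)"
      using *[OF B2(2)[of "x - c"] s[of "d - x"]] *[OF s[of "x - c"] B2(2)[of "d - x"]]
        *[OF B1(2)[of "x - c"] B1(2)[of "d - x"]]
      unfolding bump''_def by (simp add: mult.assoc)
    then show "\<bar>bump'' 1 c d x\<bar> \<le> 2 * B1 + (2 * B2 + 2 * (B1 * B1))"
      using B1(1) B2(1) mult_pos_pos[OF B1(1) B1(1)] by linarith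
  qed (use B1 B2 in \<open>simp add: add_pos_pos\<close>)
qed

context heat_source
begin

text \<open>Since H solves the adjoint heat equation, the terms with w cancel except where a
  derivative falls on the cutoff. Those terms live far out and vanish in the limit, dominated by a
  multiple of (1 + |y|) D(y); the first factor comes from the growth of w.\<close>

lemma weak_global:
  assumes H: "H \<in> smooth2"
    and heat: "\<And>t y. t \<in> {t0..1} \<Longrightarrow> partial_t H (t, y) = q t * partial_x (partial_x H) (t, y)"
    and D: "\<And>t y. t \<in> {t0..1} \<Longrightarrow> \<bar>H (t, y)\<bar> \<le> D y" "\<And>t y. t \<in> {t0..1} \<Longrightarrow> \<bar>partial_x H (t, y)\<bar> \<le> D y"
    and Di: "integrable lborel (\<lambda>y. (1 + \<bar>y\<bar>) * D y)"
    and t: "0 < t0" "t0 < 1"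
  shows "(LINT y|lborel. w (t0, y) * H (t0, y)) =
    (LINT z:{t0..1} \<times> UNIV|lborel. q (fst z) * (F z * H z))"
proof -
  note [measurable] = F_meas
  note px = smooth2_partial_x[OF H] and pt = smooth2_partial_t[OF H]
  note pxx = smooth2_partial_x[OF px(1)]
  \<comment> \<open>The radius n + 1 makes the cutoff constantly 1 on |y| <= n.\<close>
  define R where "R n = real n + 1" for n :: nat
  define cut where "cut n = bump 1 (- R n) (R n)" for n
  define cut' where "cut' n = bump' 1 (- R n) (R n)" for n
  define cut'' where "cut'' n = bump'' 1 (- R n) (R n)" for n
  obtain C where C: "C > 0" "\<And>n y. \<bar>cut' n y\<bar> \<le> C" "\<And>n y. \<bar>cut'' n y\<bar> \<le> C"
    using bump_derivs_bounded unfolding cut'_def cut''_def by blast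
  have cut1: "\<bar>cut n y\<bar> \<le> 1" for n y using bump_bounds by (simp add: cut_def)
  have ev: "eventually (\<lambda>n. cut n y = 1 \<and> cut' n y = 0 \<and> cut'' n y = 0) sequentially" for y
    using eventually_ge_at_top[of "nat \<lceil>\<bar>y\<bar>\<rceil>"]
  proof eventually_elim
    case (elim n)
    then have "\<bar>y\<bar> \<le> real n" by linarith
    then have "y + R n \<ge> 1" "R n - y \<ge> 1" by (auto simp: R_def)
    then show ?case
      by (simp add: cut_def cut'_def cut''_def bump_def bump'_def bump''_def)
  qed
  define \<phi> where "\<phi> n = (\<lambda>z. cut n (snd z) * H z)" for n
  have \<phi>_app: "\<phi> n (t, y) = cut n y * H (t, y)" for n t y
    by (simp add: \<phi>_def)
  have cut0: "cut n y = 0" if "\<bar>y\<bar> \<ge> R n" for n y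
    unfolding cut_def by (rule bump_eq_0) (use that in auto)
  have \<phi>S: "\<phi> n \<in> smooth2" for n
    unfolding \<phi>_def cut_def by (intro smooth2_mult smooth2_bump_snd H)
  have \<phi>t: "partial_t (\<phi> n) (t, y) = cut n y * partial_t H (t, y)" for n t y
  proof -
    have "((\<lambda>s. \<phi> n (s, y)) has_real_derivative cut n y * partial_t H (t, y)) (at t)"
      unfolding \<phi>_def using DERIV_cmult[OF pt(2)[of y t], of "cut n y"] by simp
    then show ?thesis by (simp add: partial_t_def[of "\<phi> n"] DERIV_imp_deriv)
  qed
  have cutd: "(cut n has_real_derivative cut' n y) (at y)" "(cut' n has_real_derivative cut'' n y) (at y)" for n y
    unfolding cut_def cut'_def cut''_def by (rule has_real_derivative_bump has_real_derivative_bump')+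
  have \<phi>x: "partial_x (\<phi> n) = (\<lambda>z. cut' n (snd z) * H z + cut n (snd z) * partial_x H z)" for n
  proof
    fix z :: "real \<times> real"
    obtain t y where z: "z = (t, y)" by (cases z)
    have "((\<lambda>y. \<phi> n (t, y)) has_real_derivative cut' n y * H (t, y) + cut n y * partial_x H (t, y)) (at y)"
      unfolding \<phi>_def using DERIV_mult[OF cutd(1) px(2)[of t y], of n] by (simp add: mult.commute)
    then show "partial_x (\<phi> n) z = cut' n (snd z) * H z + cut n (snd z) * partial_x H z"
      unfolding z by (simp add: partial_x_def[of "\<phi> n"] DERIV_imp_deriv)
  qed
  have \<phi>xx: "partial_x (partial_x (\<phi> n)) (t, y) =
      cut'' n y * H (t, y) + 2 * (cut' n y * partial_x H (t, y)) + cut n y * partial_x (partial_x H) (t, y)" for n t y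
  proof -
    have "((\<lambda>y. partial_x (\<phi> n) (t, y)) has_real_derivative
      cut'' n y * H (t, y) + 2 * (cut' n y * partial_x H (t, y)) + cut n y * partial_x (partial_x H) (t, y)) (at y)"
      using DERIV_add[OF DERIV_mult[OF cutd(2) px(2)[of t y]] DERIV_mult[OF cutd(1) pxx(2)[of t y]], of n n]
      unfolding \<phi>x by (simp add: algebra_simps)
    then show ?thesis
      by (simp add: partial_x_def[of "partial_x (\<phi> n)"] DERIV_imp_deriv)
  qed
  \<comment> \<open>What remains of the integrand after the heat equation for H has been used: two
    commutator terms with the cutoff, and the source.\<close>
  define h where "h n z = q (fst z) * (w z * (cut'' n (snd z) * H z + 2 * (cut' n (snd z) * partial_x H z))
      + F z * cut n (snd z) * H z)" for n z
  let ?S = "{t0..1} \<times> (UNIV :: real set)"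
  have eqn: "(LINT y|lborel. w (t0, y) * \<phi> n (t0, y)) = (LINT z:?S|lborel. h n z)" for n
  proof -
    have supp: "\<phi> n (t, y) = 0" if "\<bar>y\<bar> \<ge> R n" for t y
      using cut0[OF that] by (simp add: \<phi>_def)
    have hh: "- w z * partial_t (\<phi> n) z + q (fst z) * (w z * partial_x (partial_x (\<phi> n)) z + F z * \<phi> n z)
        = h n z" if "z \<in> ?S" for z
      using that heat[of "fst z" "snd z"]
      by (cases z) (simp add: \<phi>t \<phi>xx h_def \<phi>_app algebra_simps)
    have cut0': "cut n y = 0 \<and> cut' n y = 0 \<and> cut'' n y = 0" if "\<bar>y\<bar> > R n" for y
    proof -
      have "y + R n \<le> 0 \<or> R n - y \<le> 0" using that by auto
      then show ?thesis by (auto simp: cut_def cut'_def cut''_def bump_def bump'_def bump''_def)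
    qed
    have "(LINT y|lborel. w (t0, y) * \<phi> n (t0, y)) = (LINT y:{- R n..R n}|lborel. w (t0, y) * \<phi> n (t0, y))"
      unfolding set_lebesgue_integral_def
    proof (intro Bochner_Integration.integral_cong refl)
      fix y
      have "y \<in> {- R n..R n} \<or> \<bar>y\<bar> \<ge> R n" by auto
      then show "w (t0, y) * \<phi> n (t0, y) = indicator {- R n..R n} y *\<^sub>R (w (t0, y) * \<phi> n (t0, y))"
        using supp[of y t0] by (auto simp: indicator_def)
    qed
    also have "\<dots> = (LINT z:{t0..1} \<times> {- R n..R n}|lborel.
        - w z * partial_t (\<phi> n) z + q (fst z) * (w z * partial_x (partial_x (\<phi> n)) z + F z * \<phi> n z))"
      by (rule weak_compact[OF \<phi>S supp t])
    also have "\<dots> = (LINT z:{t0..1} \<times> {- R n..R n}|lborel. h n z)"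
      unfolding set_lebesgue_integral_def
      by (intro Bochner_Integration.integral_cong refl) (use hh in \<open>auto simp: indicator_def\<close>)
    also have "\<dots> = (LINT z:?S|lborel. h n z)"
    proof (rule set_integral_supported[symmetric])
      fix z assume z: "z \<in> ?S" "z \<notin> {t0..1} \<times> {- R n..R n}"
      then have "\<bar>snd z\<bar> > R n" by (cases z) auto
      then show "h n z = 0" using cut0'[of "snd z"] by (simp add: h_def)
    qed auto
    finally show ?thesis .
  qed
  have Dpos: "D y \<ge> 0" for y using D(1)[of t0 y] t by (smt (verit) atLeastAtMost_iff)
  have w0c: "continuous_on UNIV (\<lambda>y. w (t0, y))"
    by (rule continuous_on_compose2[OF w_cont]) (use t in \<open>auto intro!: continuous_intros\<close>)
  have H0c: "continuous_on UNIV (\<lambda>y. H (t0, y))"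
    by (rule continuous_on_compose2[OF smooth2_continuous[OF H, of UNIV]]) (auto intro!: continuous_intros)
  have cutc: "continuous_on UNIV (cut n)" for n unfolding cut_def by (rule continuous_bump)
  have cut'c: "continuous_on UNIV (cut' n)" for n unfolding cut'_def by (rule continuous_bump_deriv)
  have cut''c: "continuous_on UNIV (cut'' n)" for n
    unfolding cut''_def bump''_def[abs_def]
    by (intro continuous_intros continuous_on_compose2[OF continuous_deriv_step[of UNIV]]
      continuous_on_compose2[OF continuous_step[of UNIV]]
      continuous_on_compose2[OF continuous_deriv_deriv_step[of UNIV]]) auto
  note [measurable] = borel_measurable_continuous_onI[OF w0c] borel_measurable_continuous_onI[OF H0c]
    borel_measurable_continuous_onI[OF cutc]
  have lim1: "(\<lambda>n. LINT y|lborel. w (t0, y) * \<phi> n (t0, y)) \<longlonglongrightarrow> (LINT y|lborel. w (t0, y) * H (t0, y))"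
  proof (rule integral_dominated_convergence[where w = "\<lambda>y. A * ((1 + \<bar>y\<bar>) * D y)"])
    show "AE y in lborel. (\<lambda>n. w (t0, y) * \<phi> n (t0, y)) \<longlonglongrightarrow> w (t0, y) * H (t0, y)"
      by (intro AE_I2 tendsto_eventually eventually_mono[OF ev]) (auto simp: \<phi>_def)
    show "AE y in lborel. norm (w (t0, y) * \<phi> n (t0, y)) \<le> A * ((1 + \<bar>y\<bar>) * D y)" for n
    proof (rule AE_I2)
      fix y
      have "\<bar>cut n y\<bar> * \<bar>H (t0, y)\<bar> \<le> 1 * D y"
        by (rule mult_mono) (use D(1)[of t0 y] t cut1 in auto)
      then have "\<bar>w (t0, y)\<bar> * (\<bar>cut n y\<bar> * \<bar>H (t0, y)\<bar>) \<le> (A * (1 + \<bar>y\<bar>)) * D y"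
        using w_growth[of t0 y] t Dpos[of y] by (intro mult_mono) auto
      then show "norm (w (t0, y) * \<phi> n (t0, y)) \<le> A * ((1 + \<bar>y\<bar>) * D y)"
        by (simp add: \<phi>_def abs_mult mult.assoc)
    qed
  qed (use Di in \<open>simp_all add: \<phi>_def\<close>)
  obtain Q where Q: "Q > 0" "\<And>t. t \<in> {t0..1} \<Longrightarrow> \<bar>q t\<bar> \<le> Q"
  proof -
    have "compact (q ` {t0..1})" by (intro compact_continuous_image continuous_q) auto
    then show ?thesis using that by (metis bounded_pos compact_imp_bounded imageI real_norm_def)
  qed
  have [measurable]: "?S \<in> sets borel" by (intro borel_closed closed_Times) auto
  have wm: "(\<lambda>z. indicator ?S z * w z) \<in> borel_measurable borel"
  proof -
    have "continuous_on ?S w" by (rule continuous_on_subset[OF w_cont]) (use t in auto)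
    then show ?thesis using borel_measurable_continuous_on_indicator[of ?S w] by simp
  qed
  have cm1: "(\<lambda>z::real \<times> real. q (fst z)) \<in> borel_measurable borel" "H \<in> borel_measurable borel"
      "partial_x H \<in> borel_measurable borel"
    using borel_measurable_continuous_onI[OF continuous_q_fst]
      borel_measurable_continuous_onI[OF smooth2_continuous[OF H]]
      borel_measurable_continuous_onI[OF smooth2_continuous[OF px(1)]] by simp_all
  have cm2: "(\<lambda>z::real \<times> real. c (snd z)) \<in> borel_measurable borel" if "continuous_on UNIV c"
    for c :: "real \<Rightarrow> real"
    by (intro borel_measurable_continuous_onI continuous_on_compose2[OF that] continuous_intros) auto
  note cm = cm1 cm2[OF cutc] cm2[OF cut'c] cm2[OF cut''c]
  have hm: "(\<lambda>z. indicator ?S z *\<^sub>R h n z) \<in> borel_measurable lborel" for n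
  proof -
    \<comment> \<open>Continuity of w is known on the strip only, so the integrand is rearranged to
      let w occur solely in its product with the indicator, which is Borel on the plane.\<close>
    have eq: "(\<lambda>z. indicator ?S z *\<^sub>R h n z) = (\<lambda>z. q (fst z) * ((indicator ?S z * w z) * (cut'' n (snd z) * H z + 2 * (cut' n (snd z) * partial_x H z))
      + indicator ?S z * (F z * cut n (snd z) * H z)))"
      by (simp add: h_def fun_eq_iff algebra_simps)
    note [measurable] = wm cm
    show ?thesis unfolding eq by measurable
  qed
  have hlm: "(\<lambda>z. indicator ?S z *\<^sub>R (q (fst z) * (F z * H z))) \<in> borel_measurable lborel"
  proof -
    note [measurable] = cm
    show ?thesis by measurable
  qed
  define K where "K = Q * (A * (C + 2 * C) + B)"
  have lim2: "(\<lambda>n. LINT z:?S|lborel. h n z) \<longlonglongrightarrow> (LINT z:?S|lborel. q (fst z) * (F z * H z))"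
    unfolding set_lebesgue_integral_def
  proof (rule integral_dominated_convergence[OF hlm hm,
        where w = "\<lambda>z. K * (indicator {t0..1} (fst z) * ((1 + \<bar>snd z\<bar>) * D (snd z)))"])
    show "integrable lborel (\<lambda>z::real\<times>real. K * (indicator {t0..1} (fst z) * ((1 + \<bar>snd z\<bar>) * D (snd z))))"
      using integrable_mult_fst_snd[OF integrable_real_indicator[of "{t0..1}" lborel] Di] t by simp
    show "AE z in lborel. (\<lambda>n. indicator ?S z *\<^sub>R h n z) \<longlonglongrightarrow> indicator ?S z *\<^sub>R (q (fst z) * (F z * H z))"
    proof (intro AE_I2 tendsto_eventually)
      fix z :: "real \<times> real"
      show "eventually (\<lambda>n. indicator ?S z *\<^sub>R h n z = indicator ?S z *\<^sub>R (q (fst z) * (F z * H z))) sequentially"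
        using ev[of "snd z"] by eventually_elim (simp add: h_def)
    qed
    show "AE z in lborel. norm (indicator ?S z *\<^sub>R h n z) \<le>
        K * (indicator {t0..1} (fst z) * ((1 + \<bar>snd z\<bar>) * D (snd z)))" for n
      using F_bound
    proof eventually_elim
      case (elim z)
      obtain t y where z: "z = (t, y)" by (cases z)
      show ?case
      proof (cases "t \<in> {t0..1}")
        case True
        have t01: "t \<in> {0..1}" using True t by auto
        have 1: "\<bar>cut'' n y * H z + 2 * (cut' n y * partial_x H z)\<bar> \<le> (C + 2 * C) * D y"
        proof -
          have "\<bar>cut'' n y * H z\<bar> \<le> C * D y" "\<bar>cut' n y * partial_x H z\<bar> \<le> C * D y"
            unfolding abs_mult using C D[OF True, of y] z by (auto intro!: mult_mono)
          then show ?thesis unfolding distrib_right by linarith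
        qed
        have "\<bar>w z * (cut'' n y * H z + 2 * (cut' n y * partial_x H z))\<bar> \<le> (A * (1 + \<bar>y\<bar>)) * ((C + 2 * C) * D y)"
          unfolding abs_mult[of "w z"] using w_growth[OF t01, of y] 1 z by (intro mult_mono) auto
        moreover have "\<bar>F z * cut n y * H z\<bar> \<le> (B * 1) * ((1 + \<bar>y\<bar>) * D y)"
        proof -
          have "\<bar>H z\<bar> \<le> (1 + \<bar>y\<bar>) * D y"
            using D(1)[OF True, of y] z Dpos[of y] by (simp add: distrib_right add_increasing2)
          then show ?thesis
            unfolding abs_mult using elim cut1[of n y] by (intro mult_mono) auto
        qed
        ultimately have "\<bar>w z * (cut'' n y * H z + 2 * (cut' n y * partial_x H z)) + F z * cut n y * H z\<bar>
            \<le> (A * (C + 2 * C) + B) * ((1 + \<bar>y\<bar>) * D y)"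
          by (simp add: algebra_simps)
        then have "\<bar>q t * (w z * (cut'' n y * H z + 2 * (cut' n y * partial_x H z)) + F z * cut n y * H z)\<bar>
            \<le> Q * ((A * (C + 2 * C) + B) * ((1 + \<bar>y\<bar>) * D y))"
          unfolding abs_mult[of "q t"] using Q(2)[OF True] Q(1) by (intro mult_mono) auto
        then show ?thesis
          using True by (simp add: h_def z K_def mult.assoc)
      qed (simp add: z)
    qed
  qed
  show ?thesis
    using LIMSEQ_unique[OF lim1] lim2 unfolding eqn by blast
qed

end

section \<open>Gaussian kernels\<close>

text \<open>A test function is defined for all times, also where the variance \<open>\<xi>'(t) - \<xi>'(t0) + e\<close> of
  the Gaussian kernel is negative; the kernel only matters for \<open>t \<ge> t0\<close>.\<close>

lemma smooth_positive_extension: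
  fixes p :: "real poly"
  assumes pos: "\<And>t. t \<ge> t0 \<Longrightarrow> poly p t > 0"
  obtains \<tau> :: "real \<Rightarrow> real" and \<tau>' where
    "(\<lambda>z. \<tau> (fst z)) \<in> smooth2" "\<And>t. \<tau> t > 0" "\<And>t. (\<tau> has_real_derivative \<tau>' t) (at t)"
    "\<And>t. t \<ge> t0 \<Longrightarrow> \<tau> t = poly p t" "\<And>t. t \<ge> t0 \<Longrightarrow> \<tau>' t = poly (pderiv p) t"
proof -
  have "(poly p \<longlongrightarrow> poly p t0) (nhds t0)"
    by (intro iffD1[OF tendsto_at_iff_tendsto_nhds]) (metis isCont_def poly_isCont)
  then have "eventually (\<lambda>s. 0 < poly p s) (nhds t0)"
    by (rule order_tendstoD(1)) (use pos in auto)
  then obtain d where d: "d > 0" "\<And>s. dist s t0 < d \<Longrightarrow> 0 < poly p s"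
    by (auto simp: eventually_nhds_metric)
  define \<delta> where "\<delta> = d / 2"
  have \<delta>: "\<delta> > 0" using d by (simp add: \<delta>_def)
  have pos': "poly p t > 0" if "t \<ge> t0 - \<delta>" for t
    using d(2)[of t] pos[of t] that d(1) by (cases "t \<ge> t0") (auto simp: \<delta>_def dist_real_def)
  \<comment> \<open>A switch from 0 at t0 - \<delta> to 1 at t0, so that \<tau> is a convex
    combination of the constant 1 and p. Where the weight of p is nonzero, p is positive.\<close>
  define s where "s t = step ((t - t0) / \<delta> + 1)" for t
  define \<tau> where "\<tau> t = 1 + s t * (poly p t - 1)" for t
  define \<tau>' where "\<tau>' t = deriv step ((t - t0) / \<delta> + 1) * (1 / \<delta>) * (poly p t - 1) + s t * poly (pderiv p) t" for t
  have s1: "s t = 1" if "t \<ge> t0" for t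
    using that \<delta> by (simp add: s_def)
  show ?thesis
  proof (rule that[of \<tau> \<tau>'])
    show "(\<lambda>z. \<tau> (fst z)) \<in> smooth2"
      unfolding \<tau>_def s_def using \<delta> by (intro smooth2_intros smooth2_step) auto
    show "\<tau> t > 0" for t
    proof (cases "t \<ge> t0 - \<delta>")
      case True
      have "\<tau> t = (1 - s t) + s t * poly p t" by (simp add: \<tau>_def algebra_simps)
      moreover have "0 \<le> s t" "s t \<le> 1" by (simp_all add: s_def step_nonneg step_le_1)
      ultimately show ?thesis
        using pos'[OF True] by (cases "s t = 0") (auto intro!: add_nonneg_pos)
    next
      case False
      then have "s t = 0" using \<delta> by (auto simp: s_def field_simps intro!: step_0)
      then show ?thesis by (simp add: \<tau>_def)
    qed
    show "(\<tau> has_real_derivative \<tau>' t) (at t)" for t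
    proof -
      have "((\<lambda>t. (t - t0) / \<delta> + 1) has_real_derivative 1 / \<delta>) (at t)"
        using \<delta> by (auto intro!: derivative_eq_intros)
      then have "(s has_real_derivative deriv step ((t - t0) / \<delta> + 1) * (1 / \<delta>)) (at t)"
        unfolding s_def[abs_def] by (rule DERIV_chain2[OF has_real_derivative_step])
      then show ?thesis
        unfolding \<tau>_def[abs_def] \<tau>'_def by (auto intro!: derivative_eq_intros)
    qed
    show "\<tau> t = poly p t" "\<tau>' t = poly (pderiv p) t" if "t \<ge> t0" for t
      using s1[OF that] that \<delta> by (simp_all add: \<tau>_def \<tau>'_def)
  qed
qed

text \<open>The Gaussian density is written with its normalizing factor inside the exponential as a
  logarithm, because \<open>smooth2\<close> contains \<open>exp\<close> and \<open>ln\<close> but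
  has no rule for square roots. The last claim is the heat equation with the variance as
  clock.\<close>

lemma heat_kernel_derivatives:
  fixes x :: real
  assumes "(\<lambda>z. \<tau> (fst z)) \<in> smooth2" and pos: "\<And>t. \<tau> t > 0"
    and \<tau>': "\<And>t. (\<tau> has_real_derivative \<tau>' t) (at t)"
    and H_def: "H = (\<lambda>z. exp (- (snd z - x)\<^sup>2 / (2 * \<tau> (fst z)) - ln (2 * pi * \<tau> (fst z)) / 2))"
  shows "H \<in> smooth2" and "H (t, y) = normal_density x (sqrt (\<tau> t)) y"
    and "partial_x H (t, y) = - ((y - x) / \<tau> t) * H (t, y)"
    and "partial_t H (t, y) = \<tau>' t / 2 * partial_x (partial_x H) (t, y)"
proof -
  have nz: "\<tau> t \<noteq> 0" for t using pos[of t] by simp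
  have pp: "2 * pi * \<tau> t > 0" for t using pos[of t] by simp
  show "H \<in> smooth2"
    unfolding H_def using pp nz by (intro smooth2_intros assms(1)) (auto simp: nz)
  show H: "H (t, y) = normal_density x (sqrt (\<tau> t)) y"
  proof -
    have "exp (ln (2 * pi * \<tau> t) / 2) = sqrt (2 * pi * \<tau> t)"
      using pp[of t] by (simp add: ln_sqrt[symmetric] del: ln_sqrt)
    then show ?thesis
      using pos[of t] by (simp add: H_def normal_density_def exp_diff)
  qed
  have px: "((\<lambda>y. H (t, y)) has_real_derivative - ((y - x) / \<tau> t) * H (t, y)) (at y)" for t y
    unfolding H_def using nz[of t]
    by (auto intro!: derivative_eq_intros simp: field_simps power2_eq_square)
  then have px': "partial_x H = (\<lambda>z. - ((snd z - x) / \<tau> (fst z)) * H z)"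
    by (auto simp: partial_x_def fun_eq_iff intro!: DERIV_imp_deriv)
  then show "partial_x H (t, y) = - ((y - x) / \<tau> t) * H (t, y)" by simp
  have "((\<lambda>y. partial_x H (t, y)) has_real_derivative
      (- (1 / \<tau> t)) * H (t, y) + (- ((y - x) / \<tau> t) * H (t, y)) * (- ((y - x) / \<tau> t))) (at y)"
    unfolding px' fst_conv snd_conv
    by (rule DERIV_mult[OF _ px]) (use nz[of t] in \<open>auto intro!: derivative_eq_intros\<close>)
  then have "partial_x (partial_x H) (t, y) =
      (- (1 / \<tau> t)) * H (t, y) + (- ((y - x) / \<tau> t) * H (t, y)) * (- ((y - x) / \<tau> t))"
    unfolding partial_x_def[of "partial_x H"] prod.case by (rule DERIV_imp_deriv)
  moreover have "(- b) * h + (- a * h) * (- a) = (a\<^sup>2 - b) * h" for a b h :: real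
    by (simp add: power2_eq_square algebra_simps)
  ultimately have pxx: "partial_x (partial_x H) (t, y) = (((y - x) / \<tau> t)\<^sup>2 - 1 / \<tau> t) * H (t, y)"
    by (simp only:)
  let ?a = "(y - x) / \<tau> t"
  have "((\<lambda>s. - (y - x)\<^sup>2 / (2 * \<tau> s) - ln (2 * pi * \<tau> s) / 2) has_real_derivative
      \<tau>' t / 2 * (?a\<^sup>2 - 1 / \<tau> t)) (at t)"
  proof -
    have eq: "- (y - x)\<^sup>2 / (2 * \<tau> s) - ln (2 * pi * \<tau> s) / 2 =
        (- (y - x)\<^sup>2 / 2) * inverse (\<tau> s) - (ln (2 * pi) + ln (\<tau> s)) / 2" for s
    proof -
      have l: "ln (2 * pi * \<tau> s) = ln (2 * pi) + ln (\<tau> s)"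
        by (rule ln_mult_pos) (use pos[of s] in auto)
      have "a / (2 * b) - c / 2 = (a / 2) * inverse b - c / 2" for a b c :: real
        by (simp add: inverse_eq_divide)
      then show ?thesis unfolding l .
    qed
    have d1: "((\<lambda>s. inverse (\<tau> s)) has_real_derivative - (inverse (\<tau> t) * \<tau>' t * inverse (\<tau> t))) (at t)"
      by (rule DERIV_inverse'[OF \<tau>' nz])
    have d2: "((\<lambda>s. ln (\<tau> s)) has_real_derivative \<tau>' t * inverse (\<tau> t)) (at t)"
      using DERIV_chain2[OF DERIV_ln[OF pos[of t]] \<tau>'] by (simp add: mult.commute)
    have "((\<lambda>s. (- (y - x)\<^sup>2 / 2) * inverse (\<tau> s) - (ln (2 * pi) + ln (\<tau> s)) / 2) has_real_derivative
        (- (y - x)\<^sup>2 / 2) * (- (inverse (\<tau> t) * \<tau>' t * inverse (\<tau> t))) - (0 + \<tau>' t * inverse (\<tau> t)) / 2) (at t)"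
      by (rule DERIV_diff[OF DERIV_cmult[OF d1] DERIV_cdivide[OF DERIV_add[OF DERIV_const d2]]])
    moreover have "(- a\<^sup>2 / 2) * (- (inverse b * c * inverse b)) - (0 + c * inverse b) / 2
        = c / 2 * ((a / b)\<^sup>2 - 1 / b)" for a b c :: real
    proof -
      define i where "i = inverse b"
      have "a / b = a * i" "1 / b = i" by (simp_all add: i_def divide_inverse)
      then show ?thesis
        unfolding i_def[symmetric] by (simp only:) (simp add: power2_eq_square right_diff_distrib)
    qed
    ultimately show ?thesis unfolding eq by (simp only:)
  qed
  from DERIV_fun_exp[OF this]
  have "((\<lambda>s. H (s, y)) has_real_derivative H (t, y) * (\<tau>' t / 2 * (?a\<^sup>2 - 1 / \<tau> t))) (at t)"
    unfolding H_def fst_conv snd_conv .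
  then show "partial_t H (t, y) = \<tau>' t / 2 * partial_x (partial_x H) (t, y)"
    unfolding pxx by (simp add: partial_t_def DERIV_imp_deriv mult_ac)
qed

text \<open>Both weights are at most a constant times 1 + |y - x|, so absolute moments up to order
  two suffice.\<close>

lemma integrable_weighted_normal_density:
  assumes "\<sigma> > 0"
  shows "integrable lborel (\<lambda>y. (1 + \<bar>y\<bar>) * (C * (1 + \<bar>y - x\<bar> / e) * normal_density x \<sigma> y))"
proof -
  note i = integrable_normal_moment_abs[OF assms, of x]
  have "integrable lborel (\<lambda>y. \<bar>C\<bar> * (1 + \<bar>x\<bar>) * (1 + 1 / \<bar>e\<bar>) *
      (normal_density x \<sigma> y * \<bar>y - x\<bar> ^ 0 + 2 * (normal_density x \<sigma> y * \<bar>y - x\<bar> ^ 1) +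
       normal_density x \<sigma> y * \<bar>y - x\<bar> ^ 2))"
    by (intro integrable_mult_right Bochner_Integration.integrable_add i)
  then show ?thesis
  proof (rule Bochner_Integration.integrable_bound)
    show "AE y in lborel. norm ((1 + \<bar>y\<bar>) * (C * (1 + \<bar>y - x\<bar> / e) * normal_density x \<sigma> y)) \<le>
      norm (\<bar>C\<bar> * (1 + \<bar>x\<bar>) * (1 + 1 / \<bar>e\<bar>) *
      (normal_density x \<sigma> y * \<bar>y - x\<bar> ^ 0 + 2 * (normal_density x \<sigma> y * \<bar>y - x\<bar> ^ 1) +
       normal_density x \<sigma> y * \<bar>y - x\<bar> ^ 2))"
    proof (rule AE_I2)
      fix y :: real
      let ?r = "\<bar>y - x\<bar>" and ?N = "normal_density x \<sigma> y"
      have gen: "((1 + a) * (1 + r)) * ((1 + b) * (1 + r)) * (c * N) =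
          c * (1 + a) * (1 + b) * (N * r ^ 0 + 2 * (N * r ^ 1) + N * r ^ 2)" for a b c r N :: real
        by (simp add: algebra_simps power2_eq_square)
      have "1 + \<bar>y\<bar> \<le> (1 + \<bar>x\<bar>) * (1 + ?r)"
      proof -
        have "0 \<le> \<bar>x\<bar> * ?r" by simp
        then have "1 + \<bar>y\<bar> \<le> 1 + \<bar>x\<bar> + ?r + \<bar>x\<bar> * ?r" by linarith
        also have "\<dots> = (1 + \<bar>x\<bar>) * (1 + ?r)" by (simp add: algebra_simps)
        finally show ?thesis .
      qed
      moreover have "\<bar>1 + ?r / e\<bar> \<le> (1 + 1 / \<bar>e\<bar>) * (1 + ?r)"
      proof -
        have "\<bar>?r / e\<bar> = ?r * (1 / \<bar>e\<bar>)" by (simp add: abs_divide)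
        then have "\<bar>1 + ?r / e\<bar> \<le> 1 + ?r * (1 / \<bar>e\<bar>)" by linarith
        also have "\<dots> \<le> 1 + ?r * (1 / \<bar>e\<bar>) + ?r + 1 / \<bar>e\<bar>" by simp
        finally show ?thesis by (simp add: algebra_simps)
      qed
      ultimately have "(1 + \<bar>y\<bar>) * \<bar>1 + ?r / e\<bar> \<le> ((1 + \<bar>x\<bar>) * (1 + ?r)) * ((1 + 1 / \<bar>e\<bar>) * (1 + ?r))"
        by (intro mult_mono) auto
      then have "(1 + \<bar>y\<bar>) * \<bar>1 + ?r / e\<bar> * (\<bar>C\<bar> * ?N) \<le>
          (((1 + \<bar>x\<bar>) * (1 + ?r)) * ((1 + 1 / \<bar>e\<bar>) * (1 + ?r))) * (\<bar>C\<bar> * ?N)"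
        by (intro mult_right_mono) auto
      also have "\<dots> = \<bar>C\<bar> * (1 + \<bar>x\<bar>) * (1 + 1 / \<bar>e\<bar>) * (?N * ?r ^ 0 + 2 * (?N * ?r ^ 1) + ?N * ?r ^ 2)"
        by (rule gen)
      also have "\<dots> = norm \<dots>" by simp
      finally show "norm ((1 + \<bar>y\<bar>) * (C * (1 + \<bar>y - x\<bar> / e) * ?N)) \<le>
         norm (\<bar>C\<bar> * (1 + \<bar>x\<bar>) * (1 + 1 / \<bar>e\<bar>) * (?N * ?r ^ 0 + 2 * (?N * ?r ^ 1) + ?N * ?r ^ 2))"
        by (simp add: abs_mult mult_ac)
    qed
  qed simp
qed

text \<open>A kernel of variance in [e, T] is dominated by the widest one up to the ratio of
  normalizing factors. This yields a majorant uniform in time.\<close>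

lemma normal_density_le_scaled:
  assumes "0 < e" "e \<le> \<tau>" "\<tau> \<le> T"
  shows "normal_density x (sqrt \<tau>) y \<le> sqrt (T / e) * normal_density x (sqrt T) y"
proof -
  have "- (y - x)\<^sup>2 / (2 * \<tau>) \<le> - (y - x)\<^sup>2 / (2 * T)"
    using assms by (simp add: frac_le)
  then have "exp (- (y - x)\<^sup>2 / (2 * \<tau>)) / sqrt (2 * pi * \<tau>) \<le> exp (- (y - x)\<^sup>2 / (2 * T)) / sqrt (2 * pi * e)"
    using assms by (intro frac_le) auto
  also have "\<dots> = sqrt (T / e) * normal_density x (sqrt T) y"
    using assms by (simp add: normal_density_def real_sqrt_divide real_sqrt_mult)
  finally show ?thesis using assms by (simp add: normal_density_def)
qed

section \<open>The mild formula with a regularized Gaussian kernel\<close>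

context heat_source
begin

text \<open>The variance at time t of the kernel that has variance e at time t0. Its derivative in t
  is 2q; a positive e removes the singularity at t0.\<close>

definition \<tau> :: "real \<Rightarrow> real \<Rightarrow> real \<Rightarrow> real" where
  "\<tau> e t0 t = poly P t - poly P t0 + e"

lemma P_le: "0 \<le> s \<Longrightarrow> s \<le> t \<Longrightarrow> poly P s \<le> poly P t"
  by (rule DERIV_nonneg_imp_nondecreasing) (auto intro!: exI poly_DERIV P_mono)

text \<open>Duhamel's formula, tested against a Gaussian of variance e instead of evaluated at x.
  The kernel with variance \<open>\<tau> e t0 t\<close> is the test function.\<close>

lemma mild:
  assumes t: "0 < t0" "t0 < 1" and e: "e > 0"
  shows "(LINT y|lborel. w (t0, y) * normal_density x (sqrt e) y) =
    (LINT z:{t0..1} \<times> UNIV|lborel. q (fst z) * (F z * normal_density x (sqrt (\<tau> e t0 (fst z))) (snd z)))"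
proof -
  define p where "p = P - [:poly P t0 - e:]"
  have p: "poly p t = \<tau> e t0 t" for t by (simp add: p_def \<tau>_def)
  have p': "pderiv p = pderiv P" by (simp add: p_def pderiv_diff pderiv_pCons)
  have pos: "poly p t > 0" if "t \<ge> t0" for t
    using P_le[of t0 t] that t e by (simp add: p \<tau>_def)
  obtain \<theta> \<theta>' where \<theta>: "(\<lambda>z. \<theta> (fst z)) \<in> smooth2" "\<And>t. \<theta> t > 0"
      "\<And>t. (\<theta> has_real_derivative \<theta>' t) (at t)"
      "\<And>t. t \<ge> t0 \<Longrightarrow> \<theta> t = poly p t" "\<And>t. t \<ge> t0 \<Longrightarrow> \<theta>' t = poly (pderiv p) t"
    by (rule smooth_positive_extension[of t0 p], erule pos) (rule that)
  define H where "H = (\<lambda>z. exp (- (snd z - x)\<^sup>2 / (2 * \<theta> (fst z)) - ln (2 * pi * \<theta> (fst z)) / 2))"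
  note hk = heat_kernel_derivatives[OF \<theta>(1-3) H_def]
  define T where "T = \<tau> e t0 1"
  have T: "e \<le> T" using P_le[of t0 1] t by (simp add: T_def \<tau>_def)
  have \<tau>b: "e \<le> \<theta> t" "\<theta> t \<le> T" "\<theta> t = \<tau> e t0 t" if "t \<in> {t0..1}" for t
    using P_le[of t0 t] P_le[of t 1] that t \<theta>(4)[of t] by (auto simp: T_def p \<tau>_def)
  \<comment> \<open>The term |y - x| / e accounts for the x-derivative of the kernel, whose extra
    factor is |y - x| over a variance of at least e.\<close>
  define D where "D y = sqrt (T / e) * (1 + \<bar>y - x\<bar> / e) * normal_density x (sqrt T) y" for y
  have HD: "\<bar>H (t, y)\<bar> \<le> D y" "\<bar>partial_x H (t, y)\<bar> \<le> D y" if tt: "t \<in> {t0..1}" for t y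
  proof -
    let ?M = "sqrt (T / e) * normal_density x (sqrt T) y"
    have HM: "\<bar>H (t, y)\<bar> \<le> ?M"
      unfolding hk(2) using normal_density_le_scaled[OF e \<tau>b(1,2)[OF tt]] by simp
    have DM: "D y = ?M + (\<bar>y - x\<bar> / e) * ?M" by (simp add: D_def algebra_simps)
    have M0: "?M \<ge> 0" using e T by simp
    then have M1: "(\<bar>y - x\<bar> / e) * ?M \<ge> 0" using e by (intro mult_nonneg_nonneg[of "\<bar>y - x\<bar> / e" ?M]) auto
    show "\<bar>H (t, y)\<bar> \<le> D y" using HM M1 DM by linarith
    have "\<bar>y - x\<bar> / \<theta> t \<le> \<bar>y - x\<bar> / e" using \<tau>b(1)[OF tt] e by (intro divide_left_mono) auto
    then have "\<bar>partial_x H (t, y)\<bar> \<le> (\<bar>y - x\<bar> / e) * ?M"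
      unfolding hk(3) abs_mult abs_minus_cancel abs_divide using \<theta>(2)[of t] HM e
      by (intro mult_mono) auto
    then show "\<bar>partial_x H (t, y)\<bar> \<le> D y" using M0 DM by linarith
  qed
  have "(LINT y|lborel. w (t0, y) * H (t0, y)) =
    (LINT z:{t0..1} \<times> UNIV|lborel. q (fst z) * (F z * H z))"
  proof (rule weak_global[OF hk(1) _ HD _ t])
    show "partial_t H (t, y) = q t * partial_x (partial_x H) (t, y)" if "t \<in> {t0..1}" for t y
      using hk(4)[of t y] \<theta>(5)[of t] that by (simp add: q_def p')
    show "integrable lborel (\<lambda>y. (1 + \<bar>y\<bar>) * D y)"
      unfolding D_def by (rule integrable_weighted_normal_density) (use e T in auto)
  qed
  moreover have "H (t0, y) = normal_density x (sqrt e) y" for y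
    using \<tau>b(3)[of t0] t by (simp add: hk(2) \<tau>_def)
  moreover have "(LINT z:{t0..1} \<times> UNIV|lborel. q (fst z) * (F z * H z)) =
    (LINT z:{t0..1} \<times> UNIV|lborel. q (fst z) * (F z * normal_density x (sqrt (\<tau> e t0 (fst z))) (snd z)))"
    unfolding set_lebesgue_integral_def
    by (intro Bochner_Integration.integral_cong refl) (auto simp: indicator_def hk(2) \<tau>b(3))
  ultimately show ?thesis by simp
qed

end

text \<open>The difference is the integral of the derivative in the mean. The L1 norm of that
  derivative is E|Y - s| / \<sigma>^2 = sqrt(2/pi) / \<sigma>, the source of the weak singularity in
  time.\<close>

lemma nn_integral_normal_density_diff_le:
  assumes \<sigma>: "\<sigma> > 0" and xx: "x \<le> x'"
  shows "(\<integral>\<^sup>+y. ennreal \<bar>normal_density x \<sigma> y - normal_density x' \<sigma> y\<bar> \<partial>lborel)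
    \<le> ennreal (\<bar>x' - x\<bar> * (sqrt (2 / pi) / \<sigma>))"
proof -
  define d where "d s y = (y - s) / \<sigma>\<^sup>2 * normal_density s \<sigma> y" for s y :: real
  have der: "((\<lambda>s. normal_density s \<sigma> y) has_real_derivative d s y) (at s)" for s y
  proof -
    have "((\<lambda>s. - (y - s)\<^sup>2 / (2 * \<sigma>\<^sup>2)) has_real_derivative (y - s) / \<sigma>\<^sup>2) (at s)"
      using \<sigma> by (auto intro!: derivative_eq_intros simp: field_simps power2_eq_square power4_eq_xxxx)
    from DERIV_cmult[OF DERIV_fun_exp[OF this], of "1 / sqrt (2 * pi * \<sigma>\<^sup>2)"]
    show ?thesis
      unfolding normal_density_def d_def by (simp add: mult_ac)
  qed
  have dc: "isCont (\<lambda>s. d s y) s" for s y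
    unfolding d_def normal_density_def using \<sigma> by (intro continuous_intros) auto
  have [measurable]: "(\<lambda>p. d (fst p) (snd p)) \<in> borel_measurable (lborel \<Otimes>\<^sub>M lborel)"
    unfolding d_def normal_density_def by measurable
  have pt: "ennreal \<bar>normal_density x \<sigma> y - normal_density x' \<sigma> y\<bar> \<le>
      (\<integral>\<^sup>+s. ennreal \<bar>d s y\<bar> * indicator {x..x'} s \<partial>lborel)" for y
  proof -
    have i: "integrable lborel (\<lambda>s. d s y * indicator {x..x'} s)"
      using has_bochner_integral_FTC_Icc_real[OF xx, of "\<lambda>s. normal_density s \<sigma> y" "\<lambda>s. d s y"] der dc
      by (auto intro: integrable.intros)
    have "normal_density x' \<sigma> y - normal_density x \<sigma> y = (\<integral>s. d s y * indicator {x..x'} s \<partial>lborel)"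
      using integral_FTC_Icc_real[OF xx, of "\<lambda>s. normal_density s \<sigma> y" "\<lambda>s. d s y"] der dc by auto
    then have "ennreal \<bar>normal_density x \<sigma> y - normal_density x' \<sigma> y\<bar> =
        ennreal (norm (\<integral>s. d s y * indicator {x..x'} s \<partial>lborel))"
      by (simp add: abs_minus_commute)
    also have "\<dots> \<le> (\<integral>\<^sup>+s. norm (d s y * indicator {x..x'} s) \<partial>lborel)"
      by (rule integral_norm_bound_ennreal[OF i])
    also have "\<dots> = (\<integral>\<^sup>+s. ennreal \<bar>d s y\<bar> * indicator {x..x'} s \<partial>lborel)"
      by (intro nn_integral_cong) (auto simp: indicator_def)
    finally show ?thesis .
  qed
  have inner: "(\<integral>\<^sup>+y. ennreal \<bar>d s y\<bar> \<partial>lborel) = ennreal (sqrt (2 / pi) / \<sigma>)" for s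
  proof -
    have "(\<integral>\<^sup>+y. ennreal \<bar>d s y\<bar> \<partial>lborel) =
        (\<integral>\<^sup>+y. ennreal (1 / \<sigma>\<^sup>2 * (normal_density s \<sigma> y * \<bar>y - s\<bar> ^ (2 * 0 + 1))) \<partial>lborel)"
      by (intro nn_integral_cong) (simp add: d_def abs_mult abs_divide mult.commute)
    also have "\<dots> = ennreal (\<integral>y. 1 / \<sigma>\<^sup>2 * (normal_density s \<sigma> y * \<bar>y - s\<bar> ^ (2 * 0 + 1)) \<partial>lborel)"
      by (intro nn_integral_eq_integral integrable_mult_right integrable_normal_moment_abs[OF \<sigma>])
         (auto intro!: AE_I2 mult_nonneg_nonneg)
    also have "(\<integral>y. 1 / \<sigma>\<^sup>2 * (normal_density s \<sigma> y * \<bar>y - s\<bar> ^ (2 * 0 + 1)) \<partial>lborel) =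
        1 / \<sigma>\<^sup>2 * (2 ^ 0 * \<sigma> ^ (2 * 0 + 1) * fact 0 * sqrt (2 / pi))"
      using integral_normal_moment_abs_odd[OF \<sigma>, of s 0] by simp
    also have "\<dots> = sqrt (2 / pi) / \<sigma>"
      using \<sigma> by (simp add: power2_eq_square)
    finally show ?thesis .
  qed
  have "(\<integral>\<^sup>+y. ennreal \<bar>normal_density x \<sigma> y - normal_density x' \<sigma> y\<bar> \<partial>lborel) \<le>
      (\<integral>\<^sup>+y. (\<integral>\<^sup>+s. ennreal \<bar>d s y\<bar> * indicator {x..x'} s \<partial>lborel) \<partial>lborel)"
    by (intro nn_integral_mono pt)
  also have "\<dots> = (\<integral>\<^sup>+s. (\<integral>\<^sup>+y. ennreal \<bar>d s y\<bar> * indicator {x..x'} s \<partial>lborel) \<partial>lborel)"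
    by (rule lborel_pair.Fubini') (simp add: case_prod_unfold)
  also have "\<dots> = (\<integral>\<^sup>+s. ennreal (sqrt (2 / pi) / \<sigma>) * indicator {x..x'} s \<partial>lborel)"
  proof (intro nn_integral_cong)
    fix s
    have "d s \<in> borel_measurable borel"
      unfolding d_def normal_density_def by measurable
    then show "(\<integral>\<^sup>+y. ennreal \<bar>d s y\<bar> * indicator {x..x'} s \<partial>lborel) = ennreal (sqrt (2 / pi) / \<sigma>) * indicator {x..x'} s"
      by (subst nn_integral_multc) (auto simp: inner)
  qed
  also have "\<dots> = ennreal (sqrt (2 / pi) / \<sigma>) * ennreal (x' - x)"
    using xx by (simp add: nn_integral_cmult_indicator)
  also have "\<dots> = ennreal (\<bar>x' - x\<bar> * (sqrt (2 / pi) / \<sigma>))"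
    using \<sigma> xx by (simp add: mult.commute flip: ennreal_mult)
  finally show ?thesis .
qed

lemma nn_integral_normal_density_diff:
  assumes \<sigma>: "\<sigma> > 0"
  shows "(\<integral>\<^sup>+y. ennreal \<bar>normal_density x \<sigma> y - normal_density x' \<sigma> y\<bar> \<partial>lborel)
    \<le> ennreal (\<bar>x' - x\<bar> * (sqrt (2 / pi) / \<sigma>))"
  using nn_integral_normal_density_diff_le[OF \<sigma>, of x x'] nn_integral_normal_density_diff_le[OF \<sigma>, of x' x]
  by (cases "x \<le> x'") (simp_all add: abs_minus_commute)

lemma integral_normal_density_affine:
  fixes f :: "real \<Rightarrow> real"
  assumes "\<sigma> > 0"
  shows "(LINT y|lborel. f y * normal_density x \<sigma> y) = (LINT z|lborel. f (x + \<sigma> * z) * std_normal_density z)"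
proof -
  have *: "normal_density x \<sigma> (x + \<sigma> * z) * \<sigma> = std_normal_density z" for z
    using assms by (simp add: normal_density_def real_sqrt_mult power_mult_distrib)
  have "(LINT y|lborel. f y * normal_density x \<sigma> y) =
      (LINT z|lborel. f (x + \<sigma> * z) * (normal_density x \<sigma> (x + \<sigma> * z) * \<sigma>))"
    using assms by (subst lborel_integral_real_affine[where c = \<sigma> and t = x])
      (simp_all add: mult_ac flip: integral_mult_right_zero)
  then show ?thesis unfolding * .
qed

text \<open>After the substitution y = x + s_n z the density is independent of n; linear growth and
  s_n < 1 give a majorant with finite first moment.\<close>

lemma gaussian_approximation:
  fixes f :: "real \<Rightarrow> real"
  assumes f: "continuous_on UNIV f" and g: "\<And>y. \<bar>f y\<bar> \<le> A * (1 + \<bar>y\<bar>)"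
    and s: "\<And>n. 0 < s n" "\<And>n. s n < 1" "s \<longlonglongrightarrow> 0"
  shows "(\<lambda>n. LINT y|lborel. f y * normal_density x (s n) y) \<longlonglongrightarrow> f x"
proof -
  have [measurable]: "f \<in> borel_measurable borel" by (rule borel_measurable_continuous_onI[OF f])
  have A: "A \<ge> 0" using g[of 0] by simp
  note i = integrable_normal_moment_abs[of 1 0]
  have "(\<lambda>n. LINT z|lborel. f (x + s n * z) * std_normal_density z) \<longlonglongrightarrow>
      (LINT z|lborel. f x * std_normal_density z)"
  proof (rule integral_dominated_convergence[where
        w = "\<lambda>z. A * (1 + \<bar>x\<bar>) * (std_normal_density z * \<bar>z - 0\<bar> ^ 0) + A * (std_normal_density z * \<bar>z - 0\<bar> ^ 1)"])
    show "integrable lborel (\<lambda>z. A * (1 + \<bar>x\<bar>) * (std_normal_density z * \<bar>z - 0\<bar> ^ 0) + A * (std_normal_density z * \<bar>z - 0\<bar> ^ 1))"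
      by (intro Bochner_Integration.integrable_add integrable_mult_right i) auto
    show "AE z in lborel. (\<lambda>n. f (x + s n * z) * std_normal_density z) \<longlonglongrightarrow> f x * std_normal_density z"
    proof (intro AE_I2 tendsto_mult tendsto_const)
      fix z
      have "(\<lambda>n. x + s n * z) \<longlonglongrightarrow> x + 0 * z" by (intro tendsto_intros s)
      then show "(\<lambda>n. f (x + s n * z)) \<longlonglongrightarrow> f x"
        using continuous_on_tendsto_compose[OF f, of "\<lambda>n. x + s n * z" x] by simp
    qed
    show "AE z in lborel. norm (f (x + s n * z) * std_normal_density z) \<le>
        A * (1 + \<bar>x\<bar>) * (std_normal_density z * \<bar>z - 0\<bar> ^ 0) + A * (std_normal_density z * \<bar>z - 0\<bar> ^ 1)" for n
    proof (rule AE_I2)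
      fix z
      have "\<bar>s n * z\<bar> \<le> \<bar>z\<bar>" using s(1)[of n] s(2)[of n] by (simp add: abs_mult mult_left_le_one_le)
      then have "1 + \<bar>x + s n * z\<bar> \<le> (1 + \<bar>x\<bar>) + \<bar>z\<bar>" by linarith
      then have "A * (1 + \<bar>x + s n * z\<bar>) \<le> A * ((1 + \<bar>x\<bar>) + \<bar>z\<bar>)" using A by (rule mult_left_mono)
      then have "\<bar>f (x + s n * z)\<bar> \<le> A * ((1 + \<bar>x\<bar>) + \<bar>z\<bar>)" using g[of "x + s n * z"] by linarith
      then have "\<bar>f (x + s n * z)\<bar> * std_normal_density z \<le> A * ((1 + \<bar>x\<bar>) + \<bar>z\<bar>) * std_normal_density z"
        by (intro mult_right_mono) auto
      then show "norm (f (x + s n * z) * std_normal_density z) \<le>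
        A * (1 + \<bar>x\<bar>) * (std_normal_density z * \<bar>z - 0\<bar> ^ 0) + A * (std_normal_density z * \<bar>z - 0\<bar> ^ 1)"
        by (simp add: abs_mult algebra_simps)
    qed
  qed measurable
  then show ?thesis
    using integral_normal_density_affine[OF s(1)] by simp
qed

section \<open>Consequences of the mild formula as the variance e tends to 0\<close>

context heat_source
begin

text \<open>Every Gaussian average of w vanishes by the mild formula, and the averages converge to
  w.\<close>

lemma w_eq_0_if_F_eq_0:
  assumes F: "AE z in lborel. F z = 0" and t: "0 < t0" "t0 < 1"
  shows "w (t0, x) = 0"
proof -
  obtain s :: "nat \<Rightarrow> real" where s: "\<And>n. 0 < s n" "\<And>n. s n < 1" "s \<longlonglongrightarrow> 0"
    using null_sequence_less_1 by blast
  have "(LINT y|lborel. w (t0, y) * normal_density x (s n) y) = 0" for n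
  proof -
    have "(LINT y|lborel. w (t0, y) * normal_density x (sqrt ((s n)\<^sup>2)) y) = 0"
      unfolding mild[OF t zero_less_power[OF s(1)]] set_lebesgue_integral_def
      by (rule integral_eq_zero_AE) (use F in \<open>auto elim!: AE_mp\<close>)
    then show ?thesis using s(1)[of n] by simp
  qed
  moreover have "(\<lambda>n. LINT y|lborel. w (t0, y) * normal_density x (s n) y) \<longlonglongrightarrow> w (t0, x)"
    using w_growth[of t0] t
    by (intro gaussian_approximation[of "\<lambda>y. w (t0, y)" A] s continuous_on_compose2[OF w_cont])
       (auto intro!: continuous_intros)
  ultimately show ?thesis using LIMSEQ_unique[of "\<lambda>_. 0" 0] by simp
qed

text \<open>The exponential weight equals exp(-l P(t0)) exp(l e) exp(-l \<tau>), and 2q dt =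
  d\<tau>. Replacing exp(-l \<tau>) by the larger 1 / (1 + l \<tau>) gives the elementary
  antiderivative arctan(sqrt(l \<tau>)) / sqrt l, bounded by (pi/2) / sqrt l.\<close>

lemma time_integral_bound:
  assumes t: "0 < t0" "t0 < 1" and e: "e > 0" and l: "l > 0"
  shows "(\<integral>\<^sup>+t. ennreal (q t * exp (- l * poly P t) / sqrt (\<tau> e t0 t)) * indicator {t0..1} t \<partial>lborel)
    \<le> ennreal (exp (- l * poly P t0) * exp (l * e) * (pi / 2) / sqrt l)"
proof -
  let ?\<tau> = "\<tau> e t0"
  have pos: "?\<tau> t > 0" if "t0 \<le> t" for t
    using P_le[of t0 t] that t e by (simp add: \<tau>_def)
  define f where "f t = q t / ((1 + l * ?\<tau> t) * sqrt (?\<tau> t))" for t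
  define G where "G t = arctan (sqrt (l * ?\<tau> t)) / sqrt l" for t
  let ?c = "exp (- l * poly P t0) * exp (l * e)"
  have G: "(G has_real_derivative f t) (at t)" if "t0 \<le> t" for t
  proof -
    have "(?\<tau> has_real_derivative 2 * q t) (at t)"
      unfolding \<tau>_def[abs_def] q_def by (auto intro!: derivative_eq_intros poly_DERIV)
    then have d: "((\<lambda>t. l * ?\<tau> t) has_real_derivative l * (2 * q t)) (at t)"
      by (rule DERIV_cmult)
    have lt: "l * ?\<tau> t > 0" using pos[OF that] l by simp
    have "((\<lambda>t. arctan (sqrt (l * ?\<tau> t)) / sqrt l) has_real_derivative
        inverse (1 + (sqrt (l * ?\<tau> t))\<^sup>2) * (inverse (sqrt (l * ?\<tau> t)) / 2 * (l * (2 * q t))) / sqrt l) (at t)"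
      by (intro DERIV_cdivide DERIV_chain2[OF DERIV_arctan]
          DERIV_chain2[where g = "\<lambda>t. l * ?\<tau> t", OF DERIV_real_sqrt[OF lt] d])
    moreover have "inverse (1 + (sqrt (l * ?\<tau> t))\<^sup>2) * (inverse (sqrt (l * ?\<tau> t)) / 2 * (l * (2 * q t))) / sqrt l = f t"
    proof -
      have "(sqrt (l * ?\<tau> t))\<^sup>2 = l * ?\<tau> t" using lt by simp
      moreover have "inverse a * (inverse (b * c) / 2 * ((b * b) * (2 * d))) / b = d / (a * c)"
        if "a \<noteq> 0" "b \<noteq> 0" "c \<noteq> 0" for a b c d :: real
        using that by (simp add: field_simps)
      from this[of "1 + l * ?\<tau> t" "sqrt l" "sqrt (?\<tau> t)" "q t"]
      have "inverse (1 + l * ?\<tau> t) * (inverse (sqrt (l * ?\<tau> t)) / 2 * (l * (2 * q t))) / sqrt l = f t"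
        using l lt pos[OF that] by (simp add: f_def real_sqrt_mult)
      ultimately show ?thesis by simp
    qed
    ultimately show ?thesis unfolding G_def[abs_def] by (simp only:)
  qed
  have [measurable]: "poly p \<in> borel_measurable borel" for p :: "real poly"
    by (intro borel_measurable_continuous_onI continuous_at_imp_continuous_on) (simp add: poly_isCont)
  have fm: "f \<in> borel_measurable borel"
    unfolding f_def \<tau>_def[abs_def] q_def[abs_def] by measurable
  have le: "q t * exp (- l * poly P t) / sqrt (?\<tau> t) \<le> ?c * f t" if "t0 \<le> t" for t
  proof -
    have "1 + l * ?\<tau> t \<le> exp (l * ?\<tau> t)" by (rule exp_ge_add_one_self)
    then have "exp (- (l * ?\<tau> t)) \<le> inverse (1 + l * ?\<tau> t)"
      unfolding exp_minus using pos[OF that] l by (intro le_imp_inverse_le) (auto intro: add_pos_pos)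
    moreover have "exp (- l * poly P t) = ?c * exp (- (l * ?\<tau> t))"
      unfolding exp_add[symmetric] by (simp add: \<tau>_def algebra_simps)
    ultimately have "exp (- l * poly P t) \<le> ?c * inverse (1 + l * ?\<tau> t)"
      by (simp add: mult_left_mono)
    then have "(q t / sqrt (?\<tau> t)) * exp (- l * poly P t) \<le> (q t / sqrt (?\<tau> t)) * (?c * inverse (1 + l * ?\<tau> t))"
      using q_nonneg[of t] that t pos[OF that] by (intro mult_left_mono divide_nonneg_nonneg) auto
    then show ?thesis
      by (simp add: f_def divide_inverse inverse_mult_distrib mult_ac)
  qed
  have fnn: "0 \<le> f t" if "t0 \<le> t" for t
    unfolding f_def using q_nonneg[of t] pos[OF that] that t l
    by (intro divide_nonneg_nonneg mult_nonneg_nonneg add_nonneg_nonneg) auto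
  have "(\<integral>\<^sup>+t. ennreal (q t * exp (- l * poly P t) / sqrt (?\<tau> t)) * indicator {t0..1} t \<partial>lborel) \<le>
      (\<integral>\<^sup>+t. ennreal ?c * (ennreal (f t) * indicator {t0..1} t) \<partial>lborel)"
    by (intro nn_integral_mono)
       (auto simp: indicator_def le[simplified] fnn simp flip: ennreal_mult)
  also have "\<dots> = ennreal ?c * (\<integral>\<^sup>+t. ennreal (f t) * indicator {t0..1} t \<partial>lborel)"
  proof (rule nn_integral_cmult)
    note [measurable] = fm
    show "(\<lambda>t. ennreal (f t) * indicator {t0..1} t) \<in> borel_measurable lborel" by measurable
  qed
  also have "(\<integral>\<^sup>+t. ennreal (f t) * indicator {t0..1} t \<partial>lborel) = ennreal (G 1 - G t0)"
    using t G fnn by (intro nn_integral_FTC_Icc[OF fm]) auto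
  also have "ennreal ?c * \<dots> \<le> ennreal ?c * ennreal ((pi / 2) / sqrt l)"
  proof (intro mult_left_mono ennreal_leI)
    have "G 1 \<le> (pi / 2) / sqrt l"
      unfolding G_def using arctan_ubound[of "sqrt (l * ?\<tau> 1)"] l by (intro divide_right_mono) auto
    moreover have "G t0 \<ge> 0"
      unfolding G_def using l pos[of t0] by (intro divide_nonneg_nonneg) auto
    ultimately show "G 1 - G t0 \<le> (pi / 2) / sqrt l" by linarith
  qed simp
  also have "\<dots> = ennreal (?c * (pi / 2) / sqrt l)"
    using l by (simp flip: ennreal_mult)
  finally show ?thesis .
qed

text \<open>Two mild formulas are subtracted. The L1 distance of the shifted kernels gives |x - x'|
  / sqrt \<tau>, the weight on F is integrated in time, and then e tends to 0. The factor 1 / sqrt l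
  is what makes the iteration contract.\<close>

lemma lipschitz_estimate:
  assumes t: "0 < t0" "t0 < 1" and l: "l > 0" and M: "M \<ge> 0"
    and FM: "AE z in lborel. \<bar>F z\<bar> \<le> M * exp (- l * poly P (fst z))"
  shows "\<bar>w (t0, x) - w (t0, x')\<bar> \<le> 2 * M / sqrt l * exp (- l * poly P t0) * \<bar>x - x'\<bar>"
proof -
  note [measurable] = F_meas
  have [measurable]: "poly p \<in> borel_measurable borel" for p :: "real poly"
    by (intro borel_measurable_continuous_onI continuous_at_imp_continuous_on) (simp add: poly_isCont)
  have [measurable]: "q \<in> borel_measurable borel" unfolding q_def[abs_def] by measurable
  let ?S = "{t0..1} \<times> (UNIV :: real set)"
  let ?N = "\<lambda>e x z. normal_density x (sqrt (\<tau> e t0 (fst z))) (snd z)"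
  let ?c = "sqrt (2 / pi)"
  \<comment> \<open>Gaussian averages of w, to be estimated uniformly in e before passing to w
    itself.\<close>
  define \<Phi> where "\<Phi> e x = (LINT y|lborel. w (t0, y) * normal_density x (sqrt e) y)" for e x
  have [measurable]: "?S \<in> sets borel" by (intro borel_closed closed_Times) auto
  have Nm: "?N e x \<in> borel_measurable borel" for e x
    unfolding \<tau>_def normal_density_def borel_prod[symmetric] by measurable
  \<comment> \<open>The bound \<open>B\<close> comes without a sign, while the majorant below
    multiplies by it.\<close>
  define B' where "B' = \<bar>B\<bar>"
  have F_bound': "AE z in lborel. \<bar>F z\<bar> \<le> B'"
    using F_bound by eventually_elim (simp add: B'_def)
  have B: "B' \<ge> 0" by (simp add: B'_def)
  obtain Q where Q: "Q > 0" "\<And>t. t \<in> {t0..1} \<Longrightarrow> \<bar>q t\<bar> \<le> Q"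
  proof -
    have "compact (q ` {t0..1})" by (intro compact_continuous_image continuous_q) auto
    then show ?thesis using that by (metis bounded_pos compact_imp_bounded imageI real_norm_def)
  qed
  have bound: "\<bar>\<Phi> e x - \<Phi> e x'\<bar> \<le> M * exp (- l * poly P t0) * exp (l * e) * (?c * (pi / 2)) / sqrt l * \<bar>x - x'\<bar>"
    if e: "e > 0" for e
  proof -
    note [measurable] = Nm
    define T where "T = \<tau> e t0 1"
    have T: "e \<le> T" using P_le[of t0 1] t by (simp add: T_def \<tau>_def)
    have \<tau>b: "e \<le> \<tau> e t0 t" "\<tau> e t0 t \<le> T" if "t \<in> {t0..1}" for t
      using P_le[of t0 t] P_le[of t 1] that t by (auto simp: T_def \<tau>_def)
    have qm: "(\<lambda>z::real\<times>real. q (fst z)) \<in> borel_measurable borel"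
      by (rule borel_measurable_continuous_onI[OF continuous_q_fst])
    note [measurable] = qm
    have int: "integrable lborel (\<lambda>z. indicator ?S z *\<^sub>R (q (fst z) * (F z * ?N e x z)))" for x
    proof (rule Bochner_Integration.integrable_bound)
      show "integrable lborel (\<lambda>z::real\<times>real. (Q * B' * sqrt (T / e) * indicator {t0..1} (fst z)) * normal_density x (sqrt T) (snd z))"
        using e T by (intro integrable_mult_fst_snd integrable_mult_right integrable_real_indicator) (use t in auto)
      show "AE z in lborel. norm (indicator ?S z *\<^sub>R (q (fst z) * (F z * ?N e x z))) \<le>
          norm ((Q * B' * sqrt (T / e) * indicator {t0..1} (fst z)) * normal_density x (sqrt T) (snd z))"
        using F_bound'
      proof eventually_elim
        case (elim z)
        show ?case
        proof (cases "fst z \<in> {t0..1}")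
          case True
          have h: "\<bar>F z\<bar> * ?N e x z \<le> B' * (sqrt (T / e) * normal_density x (sqrt T) (snd z))"
            using elim B normal_density_le_scaled[OF e \<tau>b[OF True]] by (intro mult_mono) auto
          have "\<bar>q (fst z)\<bar> * (\<bar>F z\<bar> * ?N e x z) \<le> Q * (B' * (sqrt (T / e) * normal_density x (sqrt T) (snd z)))"
            by (rule mult_mono[OF Q(2)[OF True] h]) (use Q(1) in auto)
          also have "\<dots> = \<bar>\<dots>\<bar>" using Q(1) B e T by simp
          finally show ?thesis using True by (cases z) (simp add: abs_mult mult.assoc)
        qed (cases z; simp)
      qed
    qed measurable
    let ?G = "\<lambda>z. indicator ?S z *\<^sub>R (q (fst z) * (F z * ?N e x z)) - indicator ?S z *\<^sub>R (q (fst z) * (F z * ?N e x' z))"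
    have "\<Phi> e x - \<Phi> e x' = (LINT z|lborel. ?G z)"
      unfolding \<Phi>_def mild[OF t e] set_lebesgue_integral_def by (simp only: Bochner_Integration.integral_diff[OF int int])
    then have "ennreal \<bar>\<Phi> e x - \<Phi> e x'\<bar> \<le> (\<integral>\<^sup>+z. norm (?G z) \<partial>lborel)"
      using integral_norm_bound_ennreal[OF Bochner_Integration.integrable_diff[OF int int]] by simp
    also have "\<dots> \<le> (\<integral>\<^sup>+z. (ennreal (M * (q (fst z) * exp (- l * poly P (fst z)))) * indicator {t0..1} (fst z)) *
        ennreal \<bar>?N e x z - ?N e x' z\<bar> \<partial>lborel)"
    proof (rule nn_integral_mono_AE)
      show "AE z in lborel. ennreal (norm (?G z)) \<le>
        (ennreal (M * (q (fst z) * exp (- l * poly P (fst z)))) * indicator {t0..1} (fst z)) * ennreal \<bar>?N e x z - ?N e x' z\<bar>"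
        using FM
      proof eventually_elim
        case (elim z)
        show ?case
        proof (cases "fst z \<in> {t0..1}")
          case True
          have q0: "q (fst z) \<ge> 0" using True t by (intro q_nonneg) auto
          have "?G z = (q (fst z) * F z) * (?N e x z - ?N e x' z)"
            using True by (cases z) (simp add: algebra_simps)
          then have "norm (?G z) = (q (fst z) * \<bar>F z\<bar>) * \<bar>?N e x z - ?N e x' z\<bar>"
            using q0 by (simp only: real_norm_def abs_mult abs_of_nonneg)
          also have "\<dots> \<le> (q (fst z) * (M * exp (- l * poly P (fst z)))) * \<bar>?N e x z - ?N e x' z\<bar>"
            using elim q0 by (intro mult_right_mono mult_left_mono) auto
          finally show ?thesis
            using True q0 M by (simp add: ennreal_leI mult.left_commute flip: ennreal_mult)
        qed (cases z; simp)
      qed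
    qed
    also have "\<dots> = (\<integral>\<^sup>+t. (\<integral>\<^sup>+y. (ennreal (M * (q t * exp (- l * poly P t))) * indicator {t0..1} t) *
        ennreal \<bar>?N e x (t, y) - ?N e x' (t, y)\<bar> \<partial>lborel) \<partial>lborel)"
    proof -
      have "(\<lambda>z. (ennreal (M * (q (fst z) * exp (- l * poly P (fst z)))) * indicator {t0..1} (fst z)) *
        ennreal \<bar>?N e x z - ?N e x' z\<bar>) \<in> borel_measurable (lborel \<Otimes>\<^sub>M lborel)"
        unfolding \<tau>_def normal_density_def by measurable
      from lborel.nn_integral_fst[OF this] show ?thesis
        by (simp add: lborel_prod)
    qed
    also have "\<dots> \<le> (\<integral>\<^sup>+t. ennreal (M * (?c * \<bar>x - x'\<bar>)) *
        (ennreal (q t * exp (- l * poly P t) / sqrt (\<tau> e t0 t)) * indicator {t0..1} t) \<partial>lborel)"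
    proof (rule nn_integral_mono)
      fix t :: real
      show "(\<integral>\<^sup>+y. (ennreal (M * (q t * exp (- l * poly P t))) * indicator {t0..1} t) *
        ennreal \<bar>?N e x (t, y) - ?N e x' (t, y)\<bar> \<partial>lborel) \<le> ennreal (M * (?c * \<bar>x - x'\<bar>)) *
        (ennreal (q t * exp (- l * poly P t) / sqrt (\<tau> e t0 t)) * indicator {t0..1} t)"
      proof (cases "t \<in> {t0..1}")
        case True
        have q0: "q t \<ge> 0" using True t by (intro q_nonneg) auto
        have s: "sqrt (\<tau> e t0 t) > 0" using \<tau>b(1)[OF True] e by simp
        have "(\<integral>\<^sup>+y. (ennreal (M * (q t * exp (- l * poly P t))) * indicator {t0..1} t) *
          ennreal \<bar>?N e x (t, y) - ?N e x' (t, y)\<bar> \<partial>lborel) =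
          ennreal (M * (q t * exp (- l * poly P t))) *
          (\<integral>\<^sup>+y. ennreal \<bar>normal_density x (sqrt (\<tau> e t0 t)) y - normal_density x' (sqrt (\<tau> e t0 t)) y\<bar> \<partial>lborel)"
          using True by (subst nn_integral_cmult) auto
        also have "\<dots> \<le> ennreal (M * (q t * exp (- l * poly P t))) * ennreal (\<bar>x' - x\<bar> * (?c / sqrt (\<tau> e t0 t)))"
          by (intro mult_left_mono nn_integral_normal_density_diff s) simp
        also have "\<dots> = ennreal (M * (?c * \<bar>x - x'\<bar>)) * ennreal (q t * exp (- l * poly P t) / sqrt (\<tau> e t0 t))"
          using q0 M s by (simp add: abs_minus_commute[of x x'] mult_ac flip: ennreal_mult)
        finally show ?thesis using True by simp
      qed simp
    qed
    also have "\<dots> = ennreal (M * (?c * \<bar>x - x'\<bar>)) *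
        (\<integral>\<^sup>+t. ennreal (q t * exp (- l * poly P t) / sqrt (\<tau> e t0 t)) * indicator {t0..1} t \<partial>lborel)"
      unfolding \<tau>_def by (rule nn_integral_cmult) measurable
    also have "\<dots> \<le> ennreal (M * (?c * \<bar>x - x'\<bar>)) * ennreal (exp (- l * poly P t0) * exp (l * e) * (pi / 2) / sqrt l)"
      by (intro mult_left_mono time_integral_bound t e l) simp
    also have "\<dots> = ennreal (M * exp (- l * poly P t0) * exp (l * e) * (?c * (pi / 2)) / sqrt l * \<bar>x - x'\<bar>)"
      using M l by (simp add: mult_ac flip: ennreal_mult)
    finally show ?thesis
      using M l by (subst (asm) ennreal_le_iff) auto
  qed
  obtain s :: "nat \<Rightarrow> real" where s: "\<And>n. 0 < s n" "\<And>n. s n < 1" "s \<longlonglongrightarrow> 0"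
    using null_sequence_less_1 by blast
  have \<Phi>lim: "(\<lambda>n. \<Phi> ((s n)\<^sup>2) x) \<longlonglongrightarrow> w (t0, x)" for x
  proof -
    have "(\<lambda>n. LINT y|lborel. w (t0, y) * normal_density x (s n) y) \<longlonglongrightarrow> w (t0, x)"
      using w_growth[of t0] t
      by (intro gaussian_approximation[of "\<lambda>y. w (t0, y)" A] s continuous_on_compose2[OF w_cont])
         (auto intro!: continuous_intros)
    then show ?thesis using s(1) by (simp add: \<Phi>_def less_imp_le)
  qed
  have "\<bar>w (t0, x) - w (t0, x')\<bar> \<le> M * exp (- l * poly P t0) * exp (l * 0\<^sup>2) * (?c * (pi / 2)) / sqrt l * \<bar>x - x'\<bar>"
  proof (rule LIMSEQ_le)
    show "(\<lambda>n. \<bar>\<Phi> ((s n)\<^sup>2) x - \<Phi> ((s n)\<^sup>2) x'\<bar>) \<longlonglongrightarrow> \<bar>w (t0, x) - w (t0, x')\<bar>"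
      by (intro tendsto_intros \<Phi>lim)
    show "(\<lambda>n. M * exp (- l * poly P t0) * exp (l * (s n)\<^sup>2) * (?c * (pi / 2)) / sqrt l * \<bar>x - x'\<bar>) \<longlonglongrightarrow>
        M * exp (- l * poly P t0) * exp (l * 0\<^sup>2) * (?c * (pi / 2)) / sqrt l * \<bar>x - x'\<bar>"
      using l by (intro tendsto_intros s) auto
    show "\<exists>N. \<forall>n\<ge>N. \<bar>\<Phi> ((s n)\<^sup>2) x - \<Phi> ((s n)\<^sup>2) x'\<bar> \<le>
        M * exp (- l * poly P t0) * exp (l * (s n)\<^sup>2) * (?c * (pi / 2)) / sqrt l * \<bar>x - x'\<bar>"
      by (intro exI allI impI bound zero_less_power s)
  qed
  also have "\<dots> = (M * exp (- l * poly P t0) / sqrt l * \<bar>x - x'\<bar>) * (?c * (pi / 2))"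
    by (simp add: mult_ac)
  \<comment> \<open>The exact constant sqrt(2/pi) * pi/2 is rounded up to 2.\<close>
  also have "\<dots> \<le> (M * exp (- l * poly P t0) / sqrt l * \<bar>x - x'\<bar>) * 2"
  proof (rule mult_left_mono)
    have "?c \<le> 1" using pi_ge_two by simp
    then have "?c * (pi / 2) \<le> 1 * 2" using pi_less_4 pi_ge_two by (intro mult_mono) auto
    then show "?c * (pi / 2) \<le> 2" by simp
  qed (use M l in auto)
  finally show ?thesis by (simp add: mult_ac)
qed

end

section \<open>Uniqueness of the weak solution\<close>

lemma poly_nonneg:
  fixes p :: "real poly"
  assumes "\<And>i. coeff p i \<ge> 0" "x \<ge> 0"
  shows "poly p x \<ge> 0"
  using assms by (simp add: poly_altdef sum_nonneg)

lemma test_function_vanishes: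
  assumes "compact K" "\<And>z. z \<notin> K \<Longrightarrow> \<phi> z = 0" "z \<notin> K"
  shows "partial_t \<phi> z = 0" "partial_x \<phi> z = 0"
proof -
  obtain t x where z: "z = (t, x)" by (cases z)
  have op: "open (- K)" using assms(1) by (simp add: compact_imp_closed open_Compl)
  have "open ((\<lambda>s. (s, x)) -` (- K))" "open ((\<lambda>y. (t, y)) -` (- K))"
    by (intro open_vimage op continuous_intros)+
  then have "((\<lambda>s. \<phi> (s, x)) has_real_derivative 0) (at t)" "((\<lambda>y. \<phi> (t, y)) has_real_derivative 0) (at x)"
    using has_field_derivative_transform_within_open[OF DERIV_const[of 0 "at t"], of "(\<lambda>s. (s, x)) -` (- K)" "\<lambda>s. \<phi> (s, x)"]
      has_field_derivative_transform_within_open[OF DERIV_const[of 0 "at x"], of "(\<lambda>y. (t, y)) -` (- K)" "\<lambda>y. \<phi> (t, y)"]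
      assms(2,3) z by auto
  then show "partial_t \<phi> z = 0" "partial_x \<phi> z = 0"
    by (simp_all add: z partial_t_def partial_x_def DERIV_imp_deriv)
qed

text \<open>These test functions are arbitrary and need not lie in \<open>smooth2\<close>: a
  subtraction or a verification of weak equations has to cover all of them.\<close>

lemma test_functions_partial:
  assumes "\<phi> \<in> test_functions \<Omega>"
  shows "partial_t \<phi> \<in> test_functions \<Omega>" "partial_x \<phi> \<in> test_functions \<Omega>"
proof -
  obtain K where K: "compact K" "K \<subseteq> \<Omega>" "\<And>z. z \<notin> K \<Longrightarrow> \<phi> z = 0" and C: "\<And>k. C_k k \<phi>"
    using assms by (auto simp: test_functions_def)
  have "C_k k (partial_t \<phi>)" "C_k k (partial_x \<phi>)" for k
    using C[of "Suc k"] by simp_all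
  then show "partial_t \<phi> \<in> test_functions \<Omega>" "partial_x \<phi> \<in> test_functions \<Omega>"
    using K test_function_vanishes[OF K(1,3)] by (auto simp: test_functions_def)
qed

lemma test_functions_continuous:
  assumes "\<phi> \<in> test_functions \<Omega>"
  shows "continuous_on A \<phi>"
proof -
  have "C_k 0 \<phi>" using assms by (auto simp: test_functions_def)
  then show ?thesis by (auto intro: continuous_on_subset)
qed

lemma test_functions_has_derivative:
  assumes "\<phi> \<in> test_functions \<Omega>"
  shows "((\<lambda>s. \<phi> (s, x)) has_real_derivative partial_t \<phi> (t, x)) (at t)"
    and "((\<lambda>y. \<phi> (t, y)) has_real_derivative partial_x \<phi> (t, x)) (at x)"
proof -
  have "C_k (Suc 0) \<phi>" using assms by (auto simp: test_functions_def)
  then show "((\<lambda>s. \<phi> (s, x)) has_real_derivative partial_t \<phi> (t, x)) (at t)"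
    "((\<lambda>y. \<phi> (t, y)) has_real_derivative partial_x \<phi> (t, x)) (at x)"
    by (simp_all add: partial_t_def partial_x_def DERIV_deriv_iff_real_differentiable)
qed

lemma test_function_mult_integrable:
  assumes \<phi>: "\<phi> \<in> test_functions pde_domain" and u: "continuous_on ({0..1} \<times> UNIV) u"
  shows "set_integrable lborel pde_domain (\<lambda>z. u z * \<phi> z)"
proof -
  obtain K where K: "compact K" "K \<subseteq> pde_domain" "\<And>z. z \<notin> K \<Longrightarrow> \<phi> z = 0"
    using \<phi> by (auto simp: test_functions_def)
  have "K \<subseteq> {0..1} \<times> UNIV" using K(2) by (auto simp: pde_domain_def)
  then have "set_integrable lborel K (\<lambda>z. u z * \<phi> z)"
    by (intro set_integrable_continuous_compact K continuous_on_mult continuous_on_subset[OF u]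
         test_functions_continuous[OF \<phi>])
  moreover have "(\<lambda>z. indicator pde_domain z *\<^sub>R (u z * \<phi> z)) = (\<lambda>z. indicator K z *\<^sub>R (u z * \<phi> z))"
    using K(2,3) by (force simp: indicator_def)
  ultimately show ?thesis by (simp add: set_integrable_def)
qed

lemma test_function_mult_integrable_bounded:
  assumes \<phi>: "\<phi> \<in> test_functions pde_domain" and gm: "g \<in> borel_measurable borel"
    and B: "AE z in lborel. z \<in> pde_domain \<longrightarrow> \<bar>g z\<bar> \<le> B"
  shows "set_integrable lborel pde_domain (\<lambda>z. g z * \<phi> z)"
proof -
  note [measurable] = gm borel_measurable_continuous_onI[OF test_functions_continuous[OF \<phi>]]
  have "set_integrable lborel pde_domain (\<lambda>z. 1 * \<phi> z)"
    by (rule test_function_mult_integrable[OF \<phi>]) simp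
  then have "integrable lborel (\<lambda>z. \<bar>B\<bar> * \<bar>indicator pde_domain z * \<phi> z\<bar>)"
    by (simp add: set_integrable_def)
  then show ?thesis
    unfolding set_integrable_def
  proof (rule Bochner_Integration.integrable_bound)
    show "AE z in lborel. norm (indicator pde_domain z *\<^sub>R (g z * \<phi> z)) \<le> norm (\<bar>B\<bar> * \<bar>indicator pde_domain z * \<phi> z\<bar>)"
      using B
    proof eventually_elim
      case (elim z)
      then show ?case
        by (auto simp: indicator_def abs_mult intro!: mult_right_mono)
    qed
  qed simp
qed

text \<open>The function m is a Borel version of t \<mapsto> \<mu>([0,t]) with values in [0,1] at
  all real times; it may be chosen explicitly for each measure and has to agree with \<mu> at
  interior times.\<close>

lemma parisi_weak_solution_unique:
  assumes \<xi>: "\<And>i. coeff \<xi> i \<ge> 0"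
    and m: "m \<in> borel_measurable borel" "\<And>t. 0 \<le> m t" "\<And>t. m t \<le> 1"
      "\<And>t. t \<in> {0<..<1} \<Longrightarrow> measure \<mu> {0..t} = m t"
    and u: "parisi_weak_solution \<xi> \<mu> u" and v: "parisi_weak_solution \<xi> \<mu> v"
    and tx: "t \<in> {0..1}"
  shows "u (t, x) = v (t, x)"
proof -
  let ?q = "\<lambda>t. poly (pderiv (pderiv \<xi>)) t / 2"
  obtain gu where gu: "bounded_weak_partial_x u gu"
      and wu: "\<And>\<phi>. \<phi> \<in> test_functions pde_domain \<Longrightarrow> (LINT z:pde_domain|lborel. - u z * partial_t \<phi> z
         + ?q (fst z) * (u z * partial_x (partial_x \<phi>) z + measure \<mu> {0..fst z} * (gu z)\<^sup>2 * \<phi> z)) = 0"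
    using u unfolding parisi_weak_solution_def by auto
  obtain gv where gv: "bounded_weak_partial_x v gv"
      and wv: "\<And>\<phi>. \<phi> \<in> test_functions pde_domain \<Longrightarrow> (LINT z:pde_domain|lborel. - v z * partial_t \<phi> z
         + ?q (fst z) * (v z * partial_x (partial_x \<phi>) z + measure \<mu> {0..fst z} * (gv z)\<^sup>2 * \<phi> z)) = 0"
    using v unfolding parisi_weak_solution_def by auto
  have uc: "continuous_on ({0..1} \<times> UNIV) u" and vc: "continuous_on ({0..1} \<times> UNIV) v"
    and u1: "\<And>x. u (1, x) = ln (cosh x)" and v1: "\<And>x. v (1, x) = ln (cosh x)"
    using u v by (auto simp: parisi_weak_solution_def)
  obtain Cu where gum[measurable]: "gu \<in> borel_measurable borel"
      and Cu: "AE z in lborel. z \<in> pde_domain \<longrightarrow> \<bar>gu z\<bar> \<le> Cu"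
    using gu by (auto simp: bounded_weak_partial_x_def)
  obtain Cv where gvm[measurable]: "gv \<in> borel_measurable borel"
      and Cv: "AE z in lborel. z \<in> pde_domain \<longrightarrow> \<bar>gv z\<bar> \<le> Cv"
    using gv by (auto simp: bounded_weak_partial_x_def)
  define L where "L = 1 + \<bar>Cu\<bar> + \<bar>Cv\<bar>"
  have L: "L \<ge> 1" by (simp add: L_def)
  have Lu: "AE z in lborel. z \<in> pde_domain \<longrightarrow> \<bar>gu z\<bar> \<le> L"
    using Cu by eventually_elim (auto simp: L_def)
  have Lv: "AE z in lborel. z \<in> pde_domain \<longrightarrow> \<bar>gv z\<bar> \<le> L"
    using Cv by eventually_elim (auto simp: L_def)
  define w where "w z = u z - v z" for z
  define g where "g z = gu z - gv z" for z
  note [measurable] = m(1)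
  have mf[measurable]: "(\<lambda>z::real\<times>real. m (fst z)) \<in> borel_measurable borel"
    by (rule measurable_compose[of fst borel borel]) (auto intro!: borel_measurable_continuous_onI continuous_intros)
  \<comment> \<open>The source is cut off outside the domain, so that its bound holds almost
    everywhere in the plane as \<open>heat_source\<close> demands.\<close>
  define F where "F z = indicator pde_domain z * (m (fst z) * ((gu z)\<^sup>2 - (gv z)\<^sup>2))" for z
  have Fm: "F \<in> borel_measurable borel" unfolding F_def by measurable
  have Fg: "AE z in lborel. \<bar>F z\<bar> \<le> indicator pde_domain z * (2 * L * \<bar>g z\<bar>)"
    using Lu Lv
  proof eventually_elim
    case (elim z)
    show ?case
    proof (cases "z \<in> pde_domain")
      case True
      have "(gu z)\<^sup>2 - (gv z)\<^sup>2 = (gu z + gv z) * g z"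
        by (simp add: g_def power2_eq_square algebra_simps)
      then have "\<bar>F z\<bar> = m (fst z) * (\<bar>gu z + gv z\<bar> * \<bar>g z\<bar>)"
        using True m(2)[of "fst z"] by (simp add: F_def abs_mult)
      also have "\<dots> \<le> 1 * ((2 * L) * \<bar>g z\<bar>)"
        using elim True L m(2,3)[of "fst z"] by (intro mult_mono mult_nonneg_nonneg) auto
      finally show ?thesis using True by simp
    qed (simp add: F_def)
  qed
  have gL: "AE z in lborel. z \<in> pde_domain \<longrightarrow> \<bar>g z\<bar> \<le> 2 * L"
    using Lu Lv by eventually_elim (auto simp: g_def)
  have gw: "bounded_weak_partial_x w g"
    unfolding bounded_weak_partial_x_def
  proof (intro conjI ballI exI)
    show "g \<in> borel_measurable borel" unfolding g_def by measurable
    show "AE z in lborel. z \<in> pde_domain \<longrightarrow> \<bar>g z\<bar> \<le> 2 * L" by (rule gL)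
    fix \<phi> assume \<phi>: "\<phi> \<in> test_functions pde_domain"
    note px = test_functions_partial(2)[OF \<phi>]
    have "(LINT z:pde_domain|lborel. w z * partial_x \<phi> z) =
        (LINT z:pde_domain|lborel. u z * partial_x \<phi> z) - (LINT z:pde_domain|lborel. v z * partial_x \<phi> z)"
      unfolding w_def left_diff_distrib
      by (rule set_integral_diff(2)[OF test_function_mult_integrable[OF px uc] test_function_mult_integrable[OF px vc]])
    also have "\<dots> = - ((LINT z:pde_domain|lborel. gu z * \<phi> z) - (LINT z:pde_domain|lborel. gv z * \<phi> z))"
      using gu gv \<phi> by (simp add: bounded_weak_partial_x_def)
    also have "\<dots> = - (LINT z:pde_domain|lborel. g z * \<phi> z)"
      unfolding g_def left_diff_distrib
      by (subst set_integral_diff(2)[OF test_function_mult_integrable_bounded[OF \<phi> gum Lu]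
            test_function_mult_integrable_bounded[OF \<phi> gvm Lv]]) simp
    finally show "(LINT z:pde_domain|lborel. w z * partial_x \<phi> z) = - (LINT z:pde_domain|lborel. g z * \<phi> z)" .
  qed
  have wc: "continuous_on ({0..1} \<times> UNIV) w"
    unfolding w_def by (intro continuous_intros uc vc)
  have qi: "set_integrable lborel pde_domain (\<lambda>z. - f z * partial_t \<phi> z
         + ?q (fst z) * (f z * partial_x (partial_x \<phi>) z + m (fst z) * (h z)\<^sup>2 * \<phi> z))"
    if \<phi>: "\<phi> \<in> test_functions pde_domain" and f: "continuous_on ({0..1} \<times> UNIV) f"
      and h: "h \<in> borel_measurable borel" "AE z in lborel. z \<in> pde_domain \<longrightarrow> \<bar>h z\<bar> \<le> L" for \<phi> f h
  proof -
    note pt = test_functions_partial(1)[OF \<phi>] and px = test_functions_partial(2)[OF \<phi>]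
    note pxx = test_functions_partial(2)[OF px]
    note [measurable] = h(1)
    obtain Q where Q: "\<And>t. t \<in> {0..1} \<Longrightarrow> \<bar>?q t\<bar> \<le> Q"
    proof -
      have "compact (?q ` {0..1})" by (intro compact_continuous_image continuous_intros) auto
      then show ?thesis using that by (metis bounded_pos compact_imp_bounded imageI real_norm_def)
    qed
    have 1: "set_integrable lborel pde_domain (\<lambda>z. (- f z) * partial_t \<phi> z)"
      by (intro test_function_mult_integrable[OF pt] continuous_intros f)
    have 2: "set_integrable lborel pde_domain (\<lambda>z. (?q (fst z) * f z) * partial_x (partial_x \<phi>) z)"
      by (intro test_function_mult_integrable[OF pxx] continuous_intros f) simp
    have [measurable]: "(\<lambda>z::real\<times>real. ?q (fst z)) \<in> borel_measurable borel"
      by (intro borel_measurable_continuous_onI continuous_intros) simp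
    have 3: "set_integrable lborel pde_domain (\<lambda>z. (?q (fst z) * (m (fst z) * (h z)\<^sup>2)) * \<phi> z)"
    proof (rule test_function_mult_integrable_bounded[OF \<phi>])
      show "AE z in lborel. z \<in> pde_domain \<longrightarrow> \<bar>?q (fst z) * (m (fst z) * (h z)\<^sup>2)\<bar> \<le> Q * (1 * L\<^sup>2)"
        using h(2)
      proof (rule AE_mp, intro AE_I2 impI)
        fix z :: "real \<times> real" assume z: "z \<in> pde_domain \<longrightarrow> \<bar>h z\<bar> \<le> L" "z \<in> pde_domain"
        then have "(h z)\<^sup>2 \<le> L\<^sup>2" using power_mono[of "\<bar>h z\<bar>" L 2] by simp
        moreover have "\<bar>?q (fst z)\<bar> \<le> Q" using z(2) by (intro Q) (auto simp: pde_domain_def)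
        moreover have "\<bar>m (fst z)\<bar> \<le> 1" using m(2,3)[of "fst z"] by simp
        ultimately show "\<bar>?q (fst z) * (m (fst z) * (h z)\<^sup>2)\<bar> \<le> Q * (1 * L\<^sup>2)"
          unfolding abs_mult[of "?q (fst z)"] abs_mult[of "m (fst z)"] by (intro mult_mono) auto
      qed
    qed measurable
    show ?thesis
      using set_integral_add(1)[OF set_integral_add(1)[OF 1 2] 3] by (simp add: algebra_simps)
  qed
  have meas: "(LINT z:pde_domain|lborel. - f z * partial_t \<phi> z
         + ?q (fst z) * (f z * partial_x (partial_x \<phi>) z + measure \<mu> {0..fst z} * (h z)\<^sup>2 * \<phi> z)) =
      (LINT z:pde_domain|lborel. - f z * partial_t \<phi> z
         + ?q (fst z) * (f z * partial_x (partial_x \<phi>) z + m (fst z) * (h z)\<^sup>2 * \<phi> z))" for \<phi> f h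
    using pde_domain_sets by (intro set_lebesgue_integral_cong) (auto simp: pde_domain_def m(4))
  have weak: "(LINT z:pde_domain|lborel. - w z * partial_t \<phi> z
         + ?q (fst z) * (w z * partial_x (partial_x \<phi>) z + F z * \<phi> z)) = 0"
    if \<phi>: "\<phi> \<in> test_functions pde_domain" for \<phi>
  proof -
    have "(LINT z:pde_domain|lborel. - w z * partial_t \<phi> z
         + ?q (fst z) * (w z * partial_x (partial_x \<phi>) z + F z * \<phi> z)) =
      (LINT z:pde_domain|lborel. (- u z * partial_t \<phi> z
         + ?q (fst z) * (u z * partial_x (partial_x \<phi>) z + m (fst z) * (gu z)\<^sup>2 * \<phi> z)) -
        (- v z * partial_t \<phi> z
         + ?q (fst z) * (v z * partial_x (partial_x \<phi>) z + m (fst z) * (gv z)\<^sup>2 * \<phi> z)))"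
      using pde_domain_sets by (intro set_lebesgue_integral_cong) (auto simp: F_def w_def algebra_simps)
    also have "\<dots> = 0"
      using set_integral_diff(2)[OF qi[OF \<phi> uc gum Lu] qi[OF \<phi> vc gvm Lv]] wu[OF \<phi>] wv[OF \<phi>]
      unfolding meas by simp
    finally show ?thesis .
  qed
  obtain W where W: "\<And>t. t \<in> {0..1} \<Longrightarrow> \<bar>w (t, 0)\<bar> \<le> W"
  proof -
    have "compact ((\<lambda>t. w (t, 0)) ` {0..1})"
      by (intro compact_continuous_image continuous_on_compose2[OF wc] continuous_intros) auto
    then show ?thesis using that by (metis bounded_pos compact_imp_bounded imageI real_norm_def)
  qed
  \<comment> \<open>A Lipschitz bound in y together with boundedness of w on the line y = 0.\<close>
  have growth: "\<bar>w (t, y)\<bar> \<le> (\<bar>W\<bar> + 2 * L) * (1 + \<bar>y\<bar>)" if t: "t \<in> {0..1}" for t y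
  proof -
    have "\<bar>w (t, y) - w (t, 0)\<bar> \<le> 2 * L * \<bar>y\<bar>"
      using weak_partial_x_lipschitz[OF wc gw gL t, of y 0] by simp
    then have "\<bar>w (t, y)\<bar> \<le> \<bar>W\<bar> + 2 * L * \<bar>y\<bar>" using W[OF t] by linarith
    also have "\<dots> \<le> \<bar>W\<bar> + 2 * L * \<bar>y\<bar> + (\<bar>W\<bar> * \<bar>y\<bar> + 2 * L)" using L by simp
    finally show ?thesis by (simp add: algebra_simps)
  qed
  have Pnn: "poly (pderiv (pderiv \<xi>)) t \<ge> 0" if "t \<ge> 0" for t
    using that \<xi> by (intro poly_nonneg) (auto simp: coeff_pderiv)
  interpret heat_source "pderiv \<xi>" w F "\<bar>W\<bar> + 2 * L" "4 * L\<^sup>2"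
  proof unfold_locales
    show "AE z in lborel. \<bar>F z\<bar> \<le> 4 * L\<^sup>2"
      using Fg gL
    proof eventually_elim
      case (elim z)
      have "indicator pde_domain z * (2 * L * \<bar>g z\<bar>) \<le> 2 * L * (2 * L)"
        using elim(2) L by (cases "z \<in> pde_domain") auto
      from order_trans[OF elim(1) this] show ?case by (simp add: power2_eq_square)
    qed
    show "w (1, x) = 0" for x by (simp add: w_def u1 v1)
  qed (use Pnn wc growth Fm weak in auto)
  define P where "P = pderiv \<xi>"
  \<comment> \<open>Chosen to halve the bound: the source carries a factor 2L and the Lipschitz
    estimate 2 / sqrt l, in total 4L / (8L) = 1/2.\<close>
  define l where "l = 64 * L\<^sup>2"
  have l: "l > 0" "sqrt l = 8 * L"
    using L by (simp_all add: l_def real_sqrt_mult)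
  \<comment> \<open>Makes the weighted bound at n = 0 weaker than |g| <= 2L, because \<xi>' is at
    most \<xi>'(1) on (0,1).\<close>
  define M where "M = 2 * L * exp (l * poly P 1)"
  have M: "M > 0" using L by (simp add: M_def)
  \<comment> \<open>One round of the iteration: a bound on g bounds F, hence the Lipschitz constant
    of w, hence g again with half the constant.\<close>
  have contr: "AE z in lborel. z \<in> pde_domain \<longrightarrow> \<bar>g z\<bar> \<le> M * (1 / 2) ^ n * exp (- l * poly P (fst z))" for n
  proof (induction n)
    case 0
    show ?case
      using gL
    proof (rule AE_mp, intro AE_I2 impI)
      fix z :: "real \<times> real" assume z: "z \<in> pde_domain \<longrightarrow> \<bar>g z\<bar> \<le> 2 * L" "z \<in> pde_domain"
      have "poly P (fst z) \<le> poly P 1"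
        unfolding P_def using z(2) by (intro P_le) (auto simp: pde_domain_def)
      then have "1 \<le> exp (l * poly P 1 - l * poly P (fst z))" using l by simp
      also have "\<dots> = exp (l * poly P 1) * exp (- l * poly P (fst z))" by (simp flip: exp_add)
      finally have "2 * L * 1 \<le> 2 * L * (exp (l * poly P 1) * exp (- l * poly P (fst z)))"
        using L by (intro mult_left_mono) auto
      with z show "\<bar>g z\<bar> \<le> M * (1 / 2) ^ 0 * exp (- l * poly P (fst z))" by (simp add: M_def)
    qed
  next
    case (Suc n)
    let ?M = "2 * L * (M * (1 / 2) ^ n)"
    have "AE z in lborel. \<bar>F z\<bar> \<le> ?M * exp (- l * poly (pderiv \<xi>) (fst z))"
      using Fg Suc
    proof eventually_elim
      case (elim z)
      have "indicator pde_domain z * (2 * L * \<bar>g z\<bar>) \<le> 2 * L * (M * (1 / 2) ^ n * exp (- l * poly P (fst z)))"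
      proof (cases "z \<in> pde_domain")
        case True
        then have "2 * L * \<bar>g z\<bar> \<le> 2 * L * (M * (1 / 2) ^ n * exp (- l * poly P (fst z)))"
          using elim(2) L by (intro mult_left_mono) auto
        then show ?thesis using True by simp
      qed (use L M in simp)
      with elim(1) show ?case by (simp add: P_def mult.assoc)
    qed
    from lipschitz_estimate[OF _ _ l(1) _ this]
    have lip: "\<bar>w (t, y) - w (t, x)\<bar> \<le> 2 * ?M / sqrt l * exp (- l * poly P t) * \<bar>y - x\<bar>" if "t \<in> {0<..<1}" for t x y
      using that L M by (simp add: P_def)
    have eq: "2 * ?M / sqrt l = M * (1 / 2) ^ Suc n"
      using L by (simp add: l(2))
    show ?case
    proof (rule lipschitz_weak_partial_x[OF wc gw, of "\<lambda>t. M * (1 / 2) ^ Suc n * exp (- l * poly P t)"])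
      show "continuous_on {0<..<1} (\<lambda>t. M * (1 / 2) ^ Suc n * exp (- l * poly P t))"
        by (intro continuous_intros)
      show "\<bar>w (t, y) - w (t, x)\<bar> \<le> M * (1 / 2) ^ Suc n * exp (- l * poly P t) * \<bar>y - x\<bar>" if "t \<in> {0<..<1}" for t x y
        using lip[OF that] unfolding eq .
    qed
  qed
  have F0: "AE z in lborel. F z = 0"
  proof -
    have "AE z in lborel. \<forall>n. z \<in> pde_domain \<longrightarrow> \<bar>g z\<bar> \<le> M * (1 / 2) ^ n * exp (- l * poly P (fst z))"
      unfolding AE_all_countable by (intro allI contr)
    with Fg show ?thesis
    proof eventually_elim
      case (elim z)
      have "indicator pde_domain z * (2 * L * \<bar>g z\<bar>) = 0"
      proof (cases "z \<in> pde_domain")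
        case True
        have "(\<lambda>n. M * (1 / 2) ^ n * exp (- l * poly P (fst z))) \<longlonglongrightarrow> M * 0 * exp (- l * poly P (fst z))"
          by (intro tendsto_intros LIMSEQ_power_zero) simp
        then have "\<bar>g z\<bar> \<le> M * 0 * exp (- l * poly P (fst z))"
          by (rule LIMSEQ_le_const) (use elim(2) True in blast)
        then have "\<bar>g z\<bar> \<le> 0" by simp
        then show ?thesis by simp
      qed simp
      with elim(1) show ?case by simp
    qed
  qed
  \<comment> \<open>A source that vanishes almost everywhere leaves w = 0 at interior times; the two
    end times follow by continuity.\<close>
  have "w (s, x) = 0" if "s \<in> {0<..<1}" for s
    using w_eq_0_if_F_eq_0[OF F0] that by simp
  then have "\<bar>w (t, x)\<bar> \<le> 0"
    using continuous_le_on_closure[of "{0<..<1}" "\<lambda>t. \<bar>w (t, x)\<bar>" t 0] tx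
      continuous_on_compose2[OF wc, of "{0..1}" "\<lambda>t. (t, x)"]
    by (simp add: continuous_intros image_subset_iff)
  then show ?thesis by (simp add: w_def)
qed

section \<open>Heat flow and classical solutions\<close>

text \<open>Completing the square turns the integrand into exp(a^2/2) times the normal density with
  mean a.\<close>

lemma integral_exp_std_normal:
  "integrable lborel (\<lambda>z. exp (a * z) * std_normal_density z)"
  "(LINT z|lborel. exp (a * z) * std_normal_density z) = exp (a\<^sup>2 / 2)"
proof -
  have "exp (a * z) * std_normal_density z = exp (a\<^sup>2 / 2) * normal_density a 1 z" for z
  proof -
    have "a * z - z\<^sup>2 / 2 = a\<^sup>2 / 2 - (z - a)\<^sup>2 / 2" by (simp add: power2_eq_square field_simps)
    then have "exp (a * z) * exp (- z\<^sup>2 / 2) = exp (a\<^sup>2 / 2) * exp (- (z - a)\<^sup>2 / 2)"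
      by (simp flip: exp_add)
    then show ?thesis by (simp add: normal_density_def)
  qed
  then show "integrable lborel (\<lambda>z. exp (a * z) * std_normal_density z)"
    "(LINT z|lborel. exp (a * z) * std_normal_density z) = exp (a\<^sup>2 / 2)"
    by simp_all
qed

lemma integrable_exp_abs_std_normal:
  "integrable lborel (\<lambda>z. exp (a * \<bar>z\<bar>) * std_normal_density z)"
proof (rule Bochner_Integration.integrable_bound)
  show "integrable lborel (\<lambda>z. exp (a * z) * std_normal_density z + exp (- a * z) * std_normal_density z)"
    by (intro Bochner_Integration.integrable_add integral_exp_std_normal)
  show "AE z in lborel. norm (exp (a * \<bar>z\<bar>) * std_normal_density z) \<le>
      norm (exp (a * z) * std_normal_density z + exp (- a * z) * std_normal_density z)"
  proof (rule AE_I2)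
    fix z :: real
    have "exp (a * \<bar>z\<bar>) \<le> exp (a * z) + exp (- a * z)" by (cases "z \<ge> 0") auto
    then have "exp (a * \<bar>z\<bar>) * std_normal_density z \<le> (exp (a * z) + exp (- a * z)) * std_normal_density z"
      by (intro mult_right_mono) auto
    then show "norm (exp (a * \<bar>z\<bar>) * std_normal_density z) \<le>
      norm (exp (a * z) * std_normal_density z + exp (- a * z) * std_normal_density z)"
      by (simp add: distrib_right abs_mult)
  qed
qed measurable

text \<open>The expectation of f(x + sqrt s Z), so s is a variance. This form remains meaningful at
  s = 0, where it returns f; a normal density of variance 0 would not.\<close>

definition heat :: "(real \<Rightarrow> real) \<Rightarrow> real \<Rightarrow> real \<Rightarrow> real" where
  "heat f s x = (LINT z|lborel. f (x + sqrt s * z) * std_normal_density z)"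

text \<open>Growth at most exp |y| covers ln cosh, sqrt cosh and the derivatives used below, and is
  integrable against a Gaussian of any variance.\<close>

definition exp_bounded :: "(real \<Rightarrow> real) \<Rightarrow> bool" where
  "exp_bounded f \<longleftrightarrow> continuous_on UNIV f \<and> (\<exists>C\<ge>0. \<forall>y. \<bar>f y\<bar> \<le> C * exp \<bar>y\<bar>)"

lemma heat_0 [simp]: "heat f 0 x = f x"
  by (simp add: heat_def)

lemma exp_bounded_measurable: "exp_bounded f \<Longrightarrow> f \<in> borel_measurable borel"
  by (simp add: exp_bounded_def borel_measurable_continuous_onI)

lemma heat_integrand_bound:
  fixes f :: "real \<Rightarrow> real"
  assumes "\<And>y. \<bar>f y\<bar> \<le> C * exp \<bar>y\<bar>" "C \<ge> 0" "\<bar>x\<bar> \<le> R" "\<bar>r\<bar> \<le> b"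
  shows "\<bar>f (x + r * z)\<bar> \<le> C * exp R * exp (b * \<bar>z\<bar>)"
proof -
  have "\<bar>r * z\<bar> \<le> b * \<bar>z\<bar>" unfolding abs_mult using assms(4) by (intro mult_right_mono) auto
  then have "\<bar>x + r * z\<bar> \<le> R + b * \<bar>z\<bar>" using assms(3) by linarith
  then have "exp \<bar>x + r * z\<bar> \<le> exp (R + b * \<bar>z\<bar>)" by simp
  then have "C * exp \<bar>x + r * z\<bar> \<le> C * exp (R + b * \<bar>z\<bar>)" using assms(2) by (rule mult_left_mono)
  then show ?thesis using assms(1)[of "x + r * z"] by (simp add: exp_add mult.assoc)
qed

lemma heat_integrable:
  assumes f: "exp_bounded f"
  shows "integrable lborel (\<lambda>z. f (x + r * z) * std_normal_density z)"
proof -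
  note [measurable] = exp_bounded_measurable[OF f]
  obtain C where C: "C \<ge> 0" "\<And>y. \<bar>f y\<bar> \<le> C * exp \<bar>y\<bar>" using f by (auto simp: exp_bounded_def)
  have "integrable lborel (\<lambda>z. C * exp \<bar>x\<bar> * (exp (\<bar>r\<bar> * \<bar>z\<bar>) * std_normal_density z))"
    by (intro integrable_mult_right integrable_exp_abs_std_normal)
  then show ?thesis
  proof (rule Bochner_Integration.integrable_bound)
    show "AE z in lborel. norm (f (x + r * z) * std_normal_density z) \<le>
        norm (C * exp \<bar>x\<bar> * (exp (\<bar>r\<bar> * \<bar>z\<bar>) * std_normal_density z))"
      using mult_right_mono[OF heat_integrand_bound[OF C(2,1) order_refl order_refl] normal_density_nonneg] C(1)
      by (intro AE_I2) (simp add: abs_mult mult.assoc)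
  qed measurable
qed

lemma continuous_on_heat:
  assumes f: "exp_bounded f"
  shows "continuous_on ({0..} \<times> UNIV) (\<lambda>z. heat f (fst z) (snd z))"
proof (rule continuous_on_sequentiallyI)
  fix u :: "nat \<Rightarrow> real \<times> real" and a
  assume u: "\<forall>n. u n \<in> {0..} \<times> UNIV" "a \<in> {0..} \<times> UNIV" "u \<longlonglongrightarrow> a"
  note [measurable] = exp_bounded_measurable[OF f]
  obtain C where C: "C \<ge> 0" "\<And>y. \<bar>f y\<bar> \<le> C * exp \<bar>y\<bar>" using f by (auto simp: exp_bounded_def)
  have fc: "continuous_on UNIV f" using f by (simp add: exp_bounded_def)
  have l: "(\<lambda>n. snd (u n)) \<longlonglongrightarrow> snd a" "(\<lambda>n. sqrt (fst (u n))) \<longlonglongrightarrow> sqrt (fst a)"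
    by (intro tendsto_intros u)+
  obtain R where R: "\<And>n. \<bar>snd (u n)\<bar> \<le> R"
    using convergent_imp_Bseq[OF convergentI[OF l(1)]] by (auto simp: Bseq_def)
  obtain b where b: "\<And>n. \<bar>sqrt (fst (u n))\<bar> \<le> b"
    using convergent_imp_Bseq[OF convergentI[OF l(2)]] by (auto simp: Bseq_def)
  show "(\<lambda>n. heat f (fst (u n)) (snd (u n))) \<longlonglongrightarrow> heat f (fst a) (snd a)"
    unfolding heat_def
  proof (rule integral_dominated_convergence[where w = "\<lambda>z. C * exp R * (exp (b * \<bar>z\<bar>) * std_normal_density z)"])
    show "integrable lborel (\<lambda>z. C * exp R * (exp (b * \<bar>z\<bar>) * std_normal_density z))"
      by (intro integrable_mult_right integrable_exp_abs_std_normal)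
    show "AE z in lborel. (\<lambda>n. f (snd (u n) + sqrt (fst (u n)) * z) * std_normal_density z)
        \<longlonglongrightarrow> f (snd a + sqrt (fst a) * z) * std_normal_density z"
      by (intro AE_I2 tendsto_mult tendsto_const continuous_on_tendsto_compose[OF fc] tendsto_add l) auto
    show "AE z in lborel. norm (f (snd (u n) + sqrt (fst (u n)) * z) * std_normal_density z)
        \<le> C * exp R * (exp (b * \<bar>z\<bar>) * std_normal_density z)" for n
      using mult_right_mono[OF heat_integrand_bound[OF C(2,1) R b] normal_density_nonneg]
      by (intro AE_I2) (simp add: abs_mult mult.assoc)
  qed measurable
qed

text \<open>The mean value inequality turns the bound on f' into a majorant of the difference
  quotients, after which dominated convergence applies along sequences.\<close>

lemma DERIV_integral_param:
  fixes f f' :: "real \<Rightarrow> real \<Rightarrow> real"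
  assumes r: "r > 0"
    and d: "\<And>s z. \<bar>s - x\<bar> < r \<Longrightarrow> ((\<lambda>s. f s z) has_real_derivative f' s z) (at s)"
    and i: "\<And>s. integrable lborel (f s)"
    and b: "\<And>s z. \<bar>s - x\<bar> < r \<Longrightarrow> \<bar>f' s z\<bar> \<le> w z" and w: "integrable lborel w"
  shows "((\<lambda>s. LINT z|lborel. f s z) has_real_derivative (LINT z|lborel. f' x z)) (at x)"
  unfolding DERIV_def tendsto_at_iff_sequentially comp_def
proof (intro allI impI)
  fix X :: "nat \<Rightarrow> real" assume X: "\<forall>n. X n \<in> UNIV - {0}" "X \<longlonglongrightarrow> 0"
  have "eventually (\<lambda>n. dist (X n) 0 < r) sequentially" by (rule tendstoD[OF X(2) r])
  then obtain N where N: "\<And>n. n \<ge> N \<Longrightarrow> \<bar>X n\<bar> < r" by (auto simp: eventually_sequentially)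
  define Y where "Y n = X (n + N)" for n
  have Y: "Y n \<noteq> 0" "\<bar>Y n\<bar> < r" for n using X(1) N[of "n + N"] by (auto simp: Y_def)
  have Yl: "Y \<longlonglongrightarrow> 0" unfolding Y_def by (rule LIMSEQ_ignore_initial_segment[OF X(2)])
  have lim: "(\<lambda>n. (f (x + Y n) z - f x z) / Y n) \<longlonglongrightarrow> f' x z" for z
  proof -
    have "((\<lambda>h. (f (x + h) z - f x z) / h) \<longlongrightarrow> f' x z) (at 0)"
      using d[of x z] r by (simp add: DERIV_def)
    then show ?thesis
      using Yl Y(1) by (auto simp: tendsto_at_iff_sequentially comp_def)
  qed
  have fm: "f s \<in> borel_measurable lborel" for s using i by blast
  have f'm: "f' x \<in> borel_measurable lborel"
    by (rule borel_measurable_LIMSEQ_real[OF lim])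
       (intro borel_measurable_divide borel_measurable_diff fm borel_measurable_const)
  have "(\<lambda>n. LINT z|lborel. (f (x + Y n) z - f x z) / Y n) \<longlonglongrightarrow> (LINT z|lborel. f' x z)"
  proof (rule integral_dominated_convergence[OF f'm _ w])
    show "(\<lambda>z. (f (x + Y n) z - f x z) / Y n) \<in> borel_measurable lborel" for n
      by (intro borel_measurable_divide borel_measurable_diff fm borel_measurable_const)
    show "AE z in lborel. norm ((f (x + Y n) z - f x z) / Y n) \<le> w z" for n
    proof (rule AE_I2)
      fix z
      have "\<bar>f (x + Y n) z - f x z\<bar> \<le> w z * \<bar>(x + Y n) - x\<bar>"
      proof -
        let ?S = "{y. \<bar>y - x\<bar> < r}"
        have "?S = ball x r" by (auto simp: dist_real_def)
        then have "convex ?S" by simp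
        then have "norm (f (x + Y n) z - f x z) \<le> w z * norm ((x + Y n) - x)"
          by (rule field_differentiable_bound[where f = "\<lambda>s. f s z" and f' = "\<lambda>s. f' s z"])
             (use d b Y r in \<open>auto intro: has_field_derivative_at_within\<close>)
        then show ?thesis by simp
      qed
      then show "norm ((f (x + Y n) z - f x z) / Y n) \<le> w z"
        using Y(1)[of n] by (simp add: abs_divide divide_le_eq)
    qed
  qed (use lim in auto)
  moreover have "(LINT z|lborel. (f (x + Y n) z - f x z) / Y n) =
      ((LINT z|lborel. f (x + Y n) z) - (LINT z|lborel. f x z)) / Y n" for n
    using i by simp
  ultimately have "(\<lambda>n. ((LINT z|lborel. f (x + X (n + N)) z) - (LINT z|lborel. f x z)) / X (n + N))
      \<longlonglongrightarrow> (LINT z|lborel. f' x z)"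
    by (simp only: Y_def)
  then show "(\<lambda>n. ((LINT z|lborel. f (x + X n) z) - (LINT z|lborel. f x z)) / X n) \<longlonglongrightarrow> (LINT z|lborel. f' x z)"
    by (rule LIMSEQ_offset)
qed

lemma has_real_derivative_heat_x:
  assumes f: "exp_bounded f" and f': "exp_bounded f'"
    and d: "\<And>y. (f has_real_derivative f' y) (at y)"
  shows "((\<lambda>x. heat f s x) has_real_derivative heat f' s x) (at x)"
proof -
  obtain C where C: "C \<ge> 0" "\<And>y. \<bar>f' y\<bar> \<le> C * exp \<bar>y\<bar>" using f' by (auto simp: exp_bounded_def)
  show ?thesis
    unfolding heat_def
  proof (rule DERIV_integral_param[of 1 x _ _ "\<lambda>z. C * exp (\<bar>x\<bar> + 1) * (exp (\<bar>sqrt s\<bar> * \<bar>z\<bar>) * std_normal_density z)"])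
    show "((\<lambda>x. f (x + sqrt s * z) * std_normal_density z) has_real_derivative
        f' (y + sqrt s * z) * std_normal_density z) (at y)" for y z
    proof -
      have "((\<lambda>x. x + sqrt s * z) has_real_derivative 1) (at y)" by (auto intro!: derivative_eq_intros)
      from DERIV_cmult_right[OF DERIV_chain2[OF d this]] show ?thesis by simp
    qed
    show "\<bar>f' (y + sqrt s * z) * std_normal_density z\<bar> \<le>
        C * exp (\<bar>x\<bar> + 1) * (exp (\<bar>sqrt s\<bar> * \<bar>z\<bar>) * std_normal_density z)" if "\<bar>y - x\<bar> < 1" for y z
    proof -
      have "\<bar>y\<bar> \<le> \<bar>x\<bar> + 1" using that by linarith
      from mult_right_mono[OF heat_integrand_bound[OF C(2,1) this order_refl] normal_density_nonneg]
      show ?thesis by (simp add: abs_mult mult.assoc)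
    qed
    show "integrable lborel (\<lambda>z. C * exp (\<bar>x\<bar> + 1) * (exp (\<bar>sqrt s\<bar> * \<bar>z\<bar>) * std_normal_density z))"
      by (intro integrable_mult_right integrable_exp_abs_std_normal)
  qed (use heat_integrable[OF f] in auto)
qed

lemma exp_abs_std_normal_tendsto_0:
  "((\<lambda>z. exp (a * \<bar>z\<bar>) * std_normal_density z) \<longlongrightarrow> 0) at_infinity"
proof -
  have "((\<lambda>z::real. exp ((a + 1)\<^sup>2 / 2) * exp (- \<bar>z\<bar>)) \<longlongrightarrow> exp ((a + 1)\<^sup>2 / 2) * 0) at_infinity"
    by (intro tendsto_mult tendsto_const filterlim_compose[OF exp_at_bot]
        filterlim_uminus_at_bot_at_top[THEN filterlim_compose])
       (use filterlim_norm_at_top[where 'a = real] in \<open>simp add: real_norm_def[abs_def]\<close>)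
  then have "((\<lambda>z::real. exp ((a + 1)\<^sup>2 / 2) * exp (- \<bar>z\<bar>)) \<longlongrightarrow> 0) at_infinity" by simp
  then show ?thesis
  proof (rule tendsto_sandwich[OF _ _ tendsto_const, rotated -1])
    show "eventually (\<lambda>z. exp (a * \<bar>z\<bar>) * std_normal_density z \<le> exp ((a + 1)\<^sup>2 / 2) * exp (- \<bar>z\<bar>)) at_infinity"
    proof (rule always_eventually, rule allI)
      fix z :: real
      \<comment> \<open>This square gives (a + 1) |z| - z^2/2 <= (a + 1)^2/2, which leaves exp(-|z|)
        to spare.\<close>
      have "0 \<le> (\<bar>z\<bar> - (a + 1))\<^sup>2" by simp
      then have "a * \<bar>z\<bar> + - z\<^sup>2 / 2 \<le> (a + 1)\<^sup>2 / 2 + - \<bar>z\<bar>"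
        by (simp add: power2_eq_square field_simps)
      then have "exp (a * \<bar>z\<bar>) * exp (- z\<^sup>2 / 2) \<le> exp ((a + 1)\<^sup>2 / 2) * exp (- \<bar>z\<bar>)"
        unfolding exp_add[symmetric] by simp
      moreover have "std_normal_density z \<le> exp (- z\<^sup>2 / 2)"
        using pi_ge_two by (simp add: normal_density_def field_simps)
      then have "exp (a * \<bar>z\<bar>) * std_normal_density z \<le> exp (a * \<bar>z\<bar>) * exp (- z\<^sup>2 / 2)"
        by (rule mult_left_mono) simp
      ultimately show "exp (a * \<bar>z\<bar>) * std_normal_density z \<le> exp ((a + 1)\<^sup>2 / 2) * exp (- \<bar>z\<bar>)" by linarith
    qed
  qed (auto intro: always_eventually)
qed

text \<open>Stein's identity. The function f(x + r z) times the density vanishes at both infinities,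
  so the integral of its derivative over the line is 0.\<close>

lemma gaussian_integration_by_parts:
  assumes f: "exp_bounded f" and f': "exp_bounded f'"
    and d: "\<And>y. (f has_real_derivative f' y) (at y)"
  shows "integrable lborel (\<lambda>z. f (x + r * z) * z * std_normal_density z)"
    and "(LINT z|lborel. f (x + r * z) * z * std_normal_density z) =
      r * (LINT z|lborel. f' (x + r * z) * std_normal_density z)"
proof -
  note [measurable] = exp_bounded_measurable[OF f] exp_bounded_measurable[OF f']
  obtain C where C: "C \<ge> 0" "\<And>y. \<bar>f y\<bar> \<le> C * exp \<bar>y\<bar>" using f by (auto simp: exp_bounded_def)
  have exp_split: "exp ((b + 1) * c) = exp (b * c) * exp c" for b c :: real
    by (simp add: distrib_right exp_add)
  note fb = heat_integrand_bound[of f, OF C(2,1) order_refl order_refl, of x r]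
  have fc: "continuous_on UNIV f" "continuous_on UNIV f'" using f f' by (auto simp: exp_bounded_def)
  show i1: "integrable lborel (\<lambda>z. f (x + r * z) * z * std_normal_density z)"
  proof (rule Bochner_Integration.integrable_bound)
    show "integrable lborel (\<lambda>z. C * exp \<bar>x\<bar> * (exp ((\<bar>r\<bar> + 1) * \<bar>z\<bar>) * std_normal_density z))"
      by (intro integrable_mult_right integrable_exp_abs_std_normal)
    show "AE z in lborel. norm (f (x + r * z) * z * std_normal_density z) \<le>
      norm (C * exp \<bar>x\<bar> * (exp ((\<bar>r\<bar> + 1) * \<bar>z\<bar>) * std_normal_density z))"
    proof (rule AE_I2)
      fix z :: real
      have "\<bar>z\<bar> \<le> exp \<bar>z\<bar>" using exp_ge_add_one_self[of "\<bar>z\<bar>"] by linarith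
      then have "\<bar>f (x + r * z)\<bar> * \<bar>z\<bar> \<le> (C * exp \<bar>x\<bar> * exp (\<bar>r\<bar> * \<bar>z\<bar>)) * exp \<bar>z\<bar>"
        using fb C by (intro mult_mono) auto
      from mult_right_mono[OF this normal_density_nonneg[of 0 1 z]]
      show "norm (f (x + r * z) * z * std_normal_density z) \<le>
        norm (C * exp \<bar>x\<bar> * (exp ((\<bar>r\<bar> + 1) * \<bar>z\<bar>) * std_normal_density z))"
        using C unfolding exp_split by (simp add: abs_mult mult_ac)
    qed
  qed measurable
  let ?h = "\<lambda>z. f (x + r * z) * std_normal_density z"
  let ?h' = "\<lambda>z. r * (f' (x + r * z) * std_normal_density z) - f (x + r * z) * z * std_normal_density z"
  have h'i: "integrable lborel ?h'"
    by (intro Bochner_Integration.integrable_diff i1 integrable_mult_right heat_integrable[OF f'])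
  have der: "(?h has_real_derivative ?h' z) (at z)" for z
  proof -
    have "((\<lambda>z. x + r * z) has_real_derivative r) (at z)" by (auto intro!: derivative_eq_intros)
    from DERIV_chain2[OF d this]
    have 1: "((\<lambda>z. f (x + r * z)) has_real_derivative f' (x + r * z) * r) (at z)" .
    have "((\<lambda>z. - z\<^sup>2 / 2) has_real_derivative - z) (at z)"
      by (auto intro!: derivative_eq_intros)
    from DERIV_cmult[OF DERIV_fun_exp[OF this], of "1 / sqrt (2 * pi)"]
    have 2: "(std_normal_density has_real_derivative - z * std_normal_density z) (at z)"
      unfolding std_normal_density_def[abs_def] by (simp add: mult_ac)
    show ?thesis using DERIV_mult[OF 1 2] by (simp add: mult_ac)
  qed
  have lim: "(?h \<longlongrightarrow> 0) at_infinity"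
  proof (rule Lim_null_comparison)
    show "eventually (\<lambda>z. norm (?h z) \<le> C * exp \<bar>x\<bar> * (exp (\<bar>r\<bar> * \<bar>z\<bar>) * std_normal_density z)) at_infinity"
      using mult_right_mono[OF fb normal_density_nonneg]
      by (intro always_eventually allI) (simp add: abs_mult mult.assoc)
    show "((\<lambda>z. C * exp \<bar>x\<bar> * (exp (\<bar>r\<bar> * \<bar>z\<bar>) * std_normal_density z)) \<longlongrightarrow> 0) at_infinity"
      by (rule tendsto_mult_right_zero[OF exp_abs_std_normal_tendsto_0])
  qed
  have "(LBINT z=-\<infinity>..\<infinity>. ?h' z) = 0 - 0"
  proof (rule interval_integral_FTC_integrable[where F = ?h])
    show "(?h has_vector_derivative ?h' z) (at z)" for z
      using der has_real_derivative_iff_has_vector_derivative by blast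
    show "isCont ?h' z" for z
    proof -
      have "continuous_on UNIV ?h'"
        unfolding std_normal_density_def
        by (intro continuous_intros continuous_on_compose2[OF fc(1)] continuous_on_compose2[OF fc(2)]) auto
      then show ?thesis by (simp add: continuous_on_eq_continuous_at)
    qed
    show "set_integrable lborel (einterval (- \<infinity>) \<infinity>) ?h'"
      using h'i by (simp add: set_integrable_def)
    show "((?h \<circ> real_of_ereal) \<longlongrightarrow> 0) (at_right (- \<infinity>))" "((?h \<circ> real_of_ereal) \<longlongrightarrow> 0) (at_left \<infinity>)"
      using tendsto_mono[OF at_bot_le_at_infinity lim] tendsto_mono[OF at_top_le_at_infinity lim]
      by (simp_all add: ereal_tendsto_simps1)
  qed simp
  then have "(LINT z|lborel. ?h' z) = 0"
    by (simp add: interval_lebesgue_integral_def set_lebesgue_integral_def)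
  then show "(LINT z|lborel. f (x + r * z) * z * std_normal_density z) =
      r * (LINT z|lborel. f' (x + r * z) * std_normal_density z)"
    using i1 heat_integrable[OF f'] by (simp add: Bochner_Integration.integral_diff)
qed

text \<open>Differentiating under the integral yields f'(x + sqrt s z) z / (2 sqrt s). Stein's
  identity trades z for sqrt s and one more derivative, which cancels the singular factor.\<close>

lemma has_real_derivative_heat_time:
  assumes f: "exp_bounded f" and f': "exp_bounded f'" and f'': "exp_bounded f''"
    and d: "\<And>y. (f has_real_derivative f' y) (at y)" "\<And>y. (f' has_real_derivative f'' y) (at y)"
    and s: "s > 0"
  shows "((\<lambda>s. heat f s x) has_real_derivative heat f'' s x / 2) (at s)"
proof -
  obtain C where C: "C \<ge> 0" "\<And>y. \<bar>f' y\<bar> \<le> C * exp \<bar>y\<bar>" using f' by (auto simp: exp_bounded_def)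
  have exp_split: "exp ((b + 1) * c) = exp (b * c) * exp c" for b c :: real
    by (simp add: distrib_right exp_add)
  let ?b = "sqrt (2 * s)" and ?a = "sqrt (s / 2)"
  \<comment> \<open>On this neighbourhood r lies between s/2 and 2s, so both sqrt r and its inverse
    are bounded and one majorant serves all r.\<close>
  have near: "0 < r" "sqrt r \<le> ?b" "?a \<le> sqrt r" if "\<bar>r - s\<bar> < s / 2" for r
  proof -
    have "s / 2 < r" "r < 3 * s / 2" using that unfolding abs_less_iff by linarith+
    then show "0 < r" "sqrt r \<le> ?b" "?a \<le> sqrt r" using s by auto
  qed
  have "((\<lambda>s. heat f s x) has_real_derivative
      (LINT z|lborel. f' (x + sqrt s * z) * (inverse (sqrt s) / 2 * z) * std_normal_density z)) (at s)"
    unfolding heat_def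
  proof (rule DERIV_integral_param[of "s / 2" s _ _ "\<lambda>z. (C * exp \<bar>x\<bar> * (inverse ?a / 2)) * (exp ((?b + 1) * \<bar>z\<bar>) * std_normal_density z)"])
    show "((\<lambda>s. f (x + sqrt s * z) * std_normal_density z) has_real_derivative
        f' (x + sqrt r * z) * (inverse (sqrt r) / 2 * z) * std_normal_density z) (at r)" if "\<bar>r - s\<bar> < s / 2" for r z
    proof -
      have "((\<lambda>s. x + sqrt s * z) has_real_derivative inverse (sqrt r) / 2 * z) (at r)"
        using DERIV_add[OF DERIV_const DERIV_cmult_right[OF DERIV_real_sqrt[OF near(1)[OF that]]], of x z] by simp
      from DERIV_cmult_right[OF DERIV_chain2[OF d(1) this]] show ?thesis by simp
    qed
    show "\<bar>f' (x + sqrt r * z) * (inverse (sqrt r) / 2 * z) * std_normal_density z\<bar> \<le>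
        (C * exp \<bar>x\<bar> * (inverse ?a / 2)) * (exp ((?b + 1) * \<bar>z\<bar>) * std_normal_density z)" if r: "\<bar>r - s\<bar> < s / 2" for r z
    proof -
      have "\<bar>sqrt r\<bar> \<le> ?b" using near[OF r] by simp
      note 1 = heat_integrand_bound[of f', OF C(2,1) order_refl this, of x z]
      have "inverse (sqrt r) \<le> inverse ?a" using near[OF r] s by (intro le_imp_inverse_le) auto
      moreover have "\<bar>z\<bar> \<le> exp \<bar>z\<bar>" using exp_ge_add_one_self[of "\<bar>z\<bar>"] by linarith
      ultimately have 2: "\<bar>inverse (sqrt r) / 2 * z\<bar> \<le> (inverse ?a / 2) * exp \<bar>z\<bar>"
        unfolding abs_mult using near(1)[OF r] s by (intro mult_mono) auto
      have "\<bar>f' (x + sqrt r * z)\<bar> * \<bar>inverse (sqrt r) / 2 * z\<bar> \<le>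
          (C * exp \<bar>x\<bar> * exp (?b * \<bar>z\<bar>)) * ((inverse ?a / 2) * exp \<bar>z\<bar>)"
        by (rule mult_mono[OF 1 2]) (use C in auto)
      from mult_right_mono[OF this normal_density_nonneg[of 0 1 z]]
      show ?thesis unfolding exp_split by (simp add: abs_mult mult_ac)
    qed
    show "integrable lborel (\<lambda>z. (C * exp \<bar>x\<bar> * (inverse ?a / 2)) * (exp ((?b + 1) * \<bar>z\<bar>) * std_normal_density z))"
      by (intro integrable_mult_right integrable_exp_abs_std_normal)
  qed (use s heat_integrable[OF f] in auto)
  moreover have "(LINT z|lborel. f' (x + sqrt s * z) * (inverse (sqrt s) / 2 * z) * std_normal_density z) = heat f'' s x / 2"
  proof -
    have "(LINT z|lborel. f' (x + sqrt s * z) * (inverse (sqrt s) / 2 * z) * std_normal_density z) =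
       (LINT z|lborel. (inverse (sqrt s) / 2) * (f' (x + sqrt s * z) * z * std_normal_density z))"
      by (intro Bochner_Integration.integral_cong) (auto simp: mult_ac)
    also have "\<dots> = inverse (sqrt s) / 2 * (sqrt s * heat f'' s x)"
      using gaussian_integration_by_parts(2)[OF f' f'' d(2), of x "sqrt s"] by (simp add: heat_def)
    also have "\<dots> = heat f'' s x / 2" using s by simp
    finally show ?thesis .
  qed
  ultimately show ?thesis by simp
qed

section \<open>From classical to weak solutions\<close>

lemma box_integral_zero:
  fixes h :: "real \<times> real \<Rightarrow> real"
  assumes "set_integrable lborel ({0..1} \<times> {a..b}) h"
    and "\<And>t. t \<in> {0<..<1} \<Longrightarrow> (LINT y:{a..b}|lborel. h (t, y)) = 0"
  shows "(LINT z:{0..1} \<times> {a..b}|lborel. h z) = 0"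
proof -
  have "(LINT z:{0..1} \<times> {a..b}|lborel. h z) =
      (LINT t|lborel. LINT y|lborel. indicator ({0..1} \<times> {a..b}) (t, y) *\<^sub>R h (t, y))"
    unfolding set_lebesgue_integral_def
    by (rule lborel2_fubini(1)) (use assms(1) in \<open>simp add: set_integrable_def\<close>)
  also have "\<dots> = 0"
  proof (rule integral_eq_zero_AE)
    have "AE t in lborel. t \<notin> {0, 1 :: real}" by (intro AE_not_in countable_imp_null_set_lborel) auto
    then show "AE t in lborel. (LINT y|lborel. indicator ({0..1} \<times> {a..b}) (t, y) *\<^sub>R h (t, y)) = 0"
    proof eventually_elim
      case (elim t)
      show ?case
      proof (cases "t \<in> {0..1}")
        case True
        then have "t \<in> {0<..<1}" using elim by auto
        from assms(2)[OF this] show ?thesis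
          using True by (simp add: set_lebesgue_integral_def indicator_times)
      qed (simp add: indicator_times)
    qed
  qed
  finally show ?thesis .
qed

lemma box_integral_zero':
  fixes h :: "real \<times> real \<Rightarrow> real"
  assumes "set_integrable lborel ({0..1} \<times> {a..b}) h"
    and "\<And>y. (LINT t:{0..1}|lborel. h (t, y)) = 0"
  shows "(LINT z:{0..1} \<times> {a..b}|lborel. h z) = 0"
proof -
  have "(LINT z:{0..1} \<times> {a..b}|lborel. h z) =
      (LINT y|lborel. LINT t|lborel. indicator ({0..1} \<times> {a..b}) (t, y) *\<^sub>R h (t, y))"
    unfolding set_lebesgue_integral_def
    by (rule lborel2_fubini(2)) (use assms(1) in \<open>simp add: set_integrable_def\<close>)
  also have "\<dots> = (LINT y|lborel. indicator {a..b} y * (LINT t:{0..1}|lborel. h (t, y)))"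
    unfolding set_lebesgue_integral_def
    by (intro Bochner_Integration.integral_cong refl)
       (simp add: indicator_times mult_ac flip: integral_mult_right_zero)
  also have "\<dots> = 0" by (simp add: assms(2))
  finally show ?thesis .
qed

lemma integral_derivative_zero:
  fixes f f' :: "real \<Rightarrow> real"
  assumes d: "\<And>y. (f has_real_derivative f' y) (at y)" and c: "continuous_on UNIV f'"
    and "a \<le> b" "f a = 0" "f b = 0"
  shows "(LINT y:{a..b}|lborel. f' y) = 0"
  using integral_FTC_Icc_real[of a b f f'] assms
  by (simp add: set_lebesgue_integral_def mult.commute continuous_on_eq_continuous_at)

text \<open>The time q is where \<mu>([0,t]) may jump and the time derivative may fail to exist. The
  weak equation then splits into an integration by parts in x on each time slice and one in t on
  each line of constant x.\<close>

lemma classical_weak_solution: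
  assumes uc: "continuous_on ({0..1} \<times> UNIV) u" and uxc: "continuous_on ({0..1} \<times> UNIV) ux"
    and uxxc: "continuous_on ({0..1} \<times> UNIV) uxx"
    and dx: "\<And>t x. t \<in> {0<..<1} \<Longrightarrow> ((\<lambda>y. u (t, y)) has_real_derivative ux (t, x)) (at x)"
    and dxx: "\<And>t x. t \<in> {0<..<1} \<Longrightarrow> ((\<lambda>y. ux (t, y)) has_real_derivative uxx (t, x)) (at x)"
    and dt: "\<And>t x. t \<in> {0<..<1} - {q} \<Longrightarrow> ((\<lambda>s. u (s, x)) has_real_derivative
        - (poly (pderiv (pderiv \<xi>)) t / 2 * (uxx (t, x) + m t * (ux (t, x))\<^sup>2))) (at t)"
    and bd: "\<And>t x. t \<in> {0<..<1} \<Longrightarrow> \<bar>ux (t, x)\<bar> \<le> C"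
    and m: "m \<in> borel_measurable borel" "\<And>t. 0 \<le> m t" "\<And>t. m t \<le> 1"
      "\<And>t. t \<in> {0<..<1} \<Longrightarrow> measure \<mu> {0..t} = m t"
    and u1: "\<And>x. u (1, x) = ln (cosh x)"
  shows "parisi_weak_solution \<xi> \<mu> u"
proof -
  let ?q = "\<lambda>t. poly (pderiv (pderiv \<xi>)) t / 2"
  \<comment> \<open>The indicator makes the derivative Borel on the whole plane, as a weak
    derivative has to be.\<close>
  define g where "g z = indicator pde_domain z * ux z" for z
  have dsub: "pde_domain \<subseteq> {0..1} \<times> UNIV" by (auto simp: pde_domain_def)
  have gm: "g \<in> borel_measurable borel"
    using borel_measurable_continuous_on_indicator[OF pde_domain_sets continuous_on_subset[OF uxc dsub]]
    by (simp add: g_def[abs_def])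
  have gb: "AE z in lborel. z \<in> pde_domain \<longrightarrow> \<bar>g z\<bar> \<le> C"
    using bd by (intro AE_I2) (auto simp: g_def pde_domain_def)
  have main: "(LINT z:pde_domain|lborel. u z * partial_x \<phi> z) = - (LINT z:pde_domain|lborel. ux z * \<phi> z) \<and>
      (LINT z:pde_domain|lborel. - u z * partial_t \<phi> z
         + ?q (fst z) * (u z * partial_x (partial_x \<phi>) z + m (fst z) * (ux z)\<^sup>2 * \<phi> z)) = 0"
    if \<phi>: "\<phi> \<in> test_functions pde_domain" for \<phi>
  proof -
    note pt = test_functions_partial(1)[OF \<phi>] and px = test_functions_partial(2)[OF \<phi>]
    note pxx = test_functions_partial(2)[OF px]
    note cont = test_functions_continuous
    obtain K where K: "compact K" "K \<subseteq> pde_domain" "\<And>z. z \<notin> K \<Longrightarrow> \<phi> z = 0"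
      using \<phi> by (auto simp: test_functions_def)
    obtain R where R: "R > 0" "\<And>z. z \<in> K \<Longrightarrow> \<bar>snd z\<bar> < R"
    proof -
      obtain B where B: "\<And>z. z \<in> K \<Longrightarrow> norm z \<le> B"
        using compact_imp_bounded[OF K(1)] by (auto simp: bounded_iff)
      have "\<bar>snd z\<bar> < \<bar>B\<bar> + 1" if "z \<in> K" for z
        using B[OF that] norm_snd_le[of "snd z" "fst z"] by (simp add: real_norm_def)
      then show ?thesis by (intro that[of "\<bar>B\<bar> + 1"]) auto
    qed
    let ?K = "{0..1} \<times> {- R..R}"
    have \<phi>0: "\<phi> z = 0" "partial_t \<phi> z = 0" "partial_x \<phi> z = 0" "partial_x (partial_x \<phi>) z = 0" if "z \<notin> K" for z
      using K(3) test_function_vanishes[OF K(1,3)] test_function_vanishes[OF K(1) test_function_vanishes(2)[OF K(1,3)]] that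
      by auto
    have edge: "(t, R) \<notin> K" "(t, - R) \<notin> K" "(0, y) \<notin> K" "(1, y) \<notin> K" for t y
      using R(2)[of "(t, R)"] R(2)[of "(t, -R)"] K(2) R(1) by (auto simp: pde_domain_def)
    have KK: "K \<subseteq> ?K"
    proof
      fix z assume z: "z \<in> K"
      then have "\<bar>snd z\<bar> < R" "z \<in> pde_domain" using R(2) K(2) by auto
      then show "z \<in> ?K" by (cases z) (auto simp: pde_domain_def)
    qed
    have toK: "(LINT z:pde_domain|lborel. f z) = (LINT z:?K|lborel. f z)" if "\<And>z. z \<notin> K \<Longrightarrow> f z = 0" for f
      unfolding set_lebesgue_integral_def
      using that K(2) KK by (intro Bochner_Integration.integral_cong refl) (auto simp: indicator_def)
    have cK: "continuous_on ?K u" "continuous_on ?K ux" "continuous_on ?K uxx"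
      by (rule continuous_on_subset[OF uc] continuous_on_subset[OF uxc] continuous_on_subset[OF uxxc]; auto)+
    have qK: "continuous_on A (\<lambda>z::real\<times>real. ?q (fst z))" for A
      by (intro continuous_intros) simp
    have ci: "set_integrable lborel ?K f" if "continuous_on ?K f" for f :: "real \<times> real \<Rightarrow> real"
      by (intro set_integrable_continuous_compact compact_Times that) auto
    have sl: "continuous_on UNIV (\<lambda>y. f (t, y))" if "continuous_on ({0..1} \<times> UNIV) f" "t \<in> {0<..<1}"
      for f :: "real \<times> real \<Rightarrow> real" and t
      by (rule continuous_on_compose2[OF that(1)]) (use that(2) in \<open>auto intro!: continuous_intros\<close>)
    have w1: "(LINT z:?K|lborel. u z * partial_x \<phi> z + ux z * \<phi> z) = 0"
    proof (rule box_integral_zero)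
      show "set_integrable lborel ?K (\<lambda>z. u z * partial_x \<phi> z + ux z * \<phi> z)"
        by (intro ci continuous_intros cK cont[OF \<phi>] cont[OF px])
      fix t :: real assume t: "t \<in> {0<..<1}"
      show "(LINT y:{- R..R}|lborel. u (t, y) * partial_x \<phi> (t, y) + ux (t, y) * \<phi> (t, y)) = 0"
      proof (rule integral_derivative_zero[where f = "\<lambda>y. u (t, y) * \<phi> (t, y)"])
        show "((\<lambda>y. u (t, y) * \<phi> (t, y)) has_real_derivative
            u (t, y) * partial_x \<phi> (t, y) + ux (t, y) * \<phi> (t, y)) (at y)" for y
          using DERIV_mult[OF dx[OF t] test_functions_has_derivative(2)[OF \<phi>, of t y]] by (simp add: algebra_simps)
        show "continuous_on UNIV (\<lambda>y. u (t, y) * partial_x \<phi> (t, y) + ux (t, y) * \<phi> (t, y))"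
          by (intro continuous_intros sl[OF _ t] uc uxc cont[OF \<phi>] cont[OF px])
      qed (use R edge \<phi>0(1) in auto)
    qed
    \<comment> \<open>Two integrations by parts in x at once: the integrand in y is the derivative
      of u \<phi>_x - u_x \<phi>.\<close>
    have w2: "(LINT z:?K|lborel. ?q (fst z) * (u z * partial_x (partial_x \<phi>) z - uxx z * \<phi> z)) = 0"
    proof (rule box_integral_zero)
      show "set_integrable lborel ?K (\<lambda>z. ?q (fst z) * (u z * partial_x (partial_x \<phi>) z - uxx z * \<phi> z))"
        by (intro ci continuous_on_mult[OF qK] continuous_intros cK cont[OF \<phi>] cont[OF pxx])
      fix t :: real assume t: "t \<in> {0<..<1}"
      have "(LINT y:{- R..R}|lborel. u (t, y) * partial_x (partial_x \<phi>) (t, y) - uxx (t, y) * \<phi> (t, y)) = 0"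
      proof (rule integral_derivative_zero[where f = "\<lambda>y. u (t, y) * partial_x \<phi> (t, y) - ux (t, y) * \<phi> (t, y)"])
        show "((\<lambda>y. u (t, y) * partial_x \<phi> (t, y) - ux (t, y) * \<phi> (t, y)) has_real_derivative
            u (t, y) * partial_x (partial_x \<phi>) (t, y) - uxx (t, y) * \<phi> (t, y)) (at y)" for y
          using DERIV_diff[OF DERIV_mult[OF dx[OF t] test_functions_has_derivative(2)[OF px, of t y]]
            DERIV_mult[OF dxx[OF t] test_functions_has_derivative(2)[OF \<phi>, of t y]]] by (simp add: algebra_simps)
        show "continuous_on UNIV (\<lambda>y. u (t, y) * partial_x (partial_x \<phi>) (t, y) - uxx (t, y) * \<phi> (t, y))"
          by (intro continuous_intros sl[OF _ t] uc uxxc cont[OF \<phi>] cont[OF pxx])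
      qed (use R edge \<phi>0 in auto)
      then show "(LINT y:{- R..R}|lborel. ?q (fst (t, y)) * (u (t, y) * partial_x (partial_x \<phi>) (t, y) - uxx (t, y) * \<phi> (t, y))) = 0"
        by (simp add: set_integral_mult_right)
    qed
    note [measurable] = m(1)
    have mi: "set_integrable lborel ?K (\<lambda>z. m (fst z) * f z)" if f: "continuous_on ?K f" for f :: "real \<times> real \<Rightarrow> real"
    proof (rule set_integrable_bound[OF ci[OF f]])
      have [measurable]: "(\<lambda>z. indicator ?K z * f z) \<in> borel_measurable borel"
        using borel_measurable_continuous_on_indicator[OF box_sets f] by simp
      have [measurable]: "(\<lambda>z::real\<times>real. m (fst z)) \<in> borel_measurable borel"
        by (rule measurable_compose[of fst borel borel]) (auto intro!: borel_measurable_continuous_onI continuous_intros)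
      have "(\<lambda>z. m (fst z) * (indicator ?K z * f z)) \<in> borel_measurable lborel" by measurable
      then show "set_borel_measurable lborel ?K (\<lambda>z. m (fst z) * f z)"
        by (simp add: set_borel_measurable_def mult.left_commute)
      show "AE z\<in>?K in lborel. norm (m (fst z) * f z) \<le> norm (f z)"
        using m(2,3) by (intro AE_I2) (simp add: abs_mult mult_left_le_one_le)
    qed
    \<comment> \<open>By the equation this is the time derivative of u \<phi>, so its integral over
      each line of constant x is a boundary term, and \<phi> vanishes at both ends.\<close>
    let ?D = "\<lambda>z. u z * partial_t \<phi> z - ?q (fst z) * (uxx z + m (fst z) * (ux z)\<^sup>2) * \<phi> z"
    have Di: "set_integrable lborel ?K ?D"
    proof -
      have 1: "set_integrable lborel ?K (\<lambda>z. u z * partial_t \<phi> z - ?q (fst z) * (uxx z * \<phi> z))"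
        by (intro ci continuous_on_diff continuous_on_mult[OF qK] continuous_on_mult cK cont[OF \<phi>] cont[OF pt])
      have 2: "set_integrable lborel ?K (\<lambda>z. m (fst z) * (?q (fst z) * ((ux z)\<^sup>2 * \<phi> z)))"
        by (intro mi continuous_on_mult[OF qK] continuous_on_mult continuous_on_power cK cont[OF \<phi>])
      show ?thesis using set_integral_diff(1)[OF 1 2] by (simp add: algebra_simps)
    qed
    have w3: "(LINT z:?K|lborel. ?D z) = 0"
    proof (rule box_integral_zero'[OF Di])
      fix y
      have st: "continuous_on {0..1} (\<lambda>t. f (t, y))" if "continuous_on ({0..1} \<times> UNIV) f" for f :: "real \<times> real \<Rightarrow> real"
        by (rule continuous_on_compose2[OF that]) (auto intro!: continuous_intros)
      have "((\<lambda>t. ?D (t, y)) has_integral (u (1, y) * \<phi> (1, y) - u (0, y) * \<phi> (0, y))) {0..1}"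
      \<comment> \<open>This version of the fundamental theorem tolerates the exceptional time
        q.\<close>
      proof (rule fundamental_theorem_of_calculus_interior_strong[of "{q}"])
        show "continuous_on {0..1} (\<lambda>t. u (t, y) * \<phi> (t, y))"
          by (intro continuous_intros st uc cont[OF \<phi>])
        show "((\<lambda>t. u (t, y) * \<phi> (t, y)) has_vector_derivative ?D (t, y)) (at t)" if "t \<in> {0<..<1} - {q}" for t
          using DERIV_mult[OF dt[OF that, of y] test_functions_has_derivative(1)[OF \<phi>, of y t]]
          by (simp add: has_real_derivative_iff_has_vector_derivative[symmetric] algebra_simps)
      qed auto
      then have "integral {0..1} (\<lambda>t. ?D (t, y)) = 0"
        using \<phi>0(1)[OF edge(3)] \<phi>0(1)[OF edge(4)] by (simp add: integral_unique)
      moreover have "set_integrable lborel {0..1} (\<lambda>t. ?D (t, y))"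
      proof -
        have 1: "set_integrable lborel {0..1} (\<lambda>t. u (t, y) * partial_t \<phi> (t, y) - ?q t * (uxx (t, y) * \<phi> (t, y)))"
          by (intro set_integrable_continuous_compact continuous_intros st uc uxxc cont[OF \<phi>] cont[OF pt]) auto
        have c2: "continuous_on {0..1} (\<lambda>t. ?q t * ((ux (t, y))\<^sup>2 * \<phi> (t, y)))"
          by (intro continuous_intros st uxc cont[OF \<phi>]) auto
        have 2: "set_integrable lborel {0..1} (\<lambda>t. m t * (?q t * ((ux (t, y))\<^sup>2 * \<phi> (t, y))))"
        proof (rule set_integrable_bound[OF set_integrable_continuous_compact[OF compact_Icc c2]])
          have [measurable]: "(\<lambda>t. indicator {0..1} t * (?q t * ((ux (t, y))\<^sup>2 * \<phi> (t, y)))) \<in> borel_measurable borel"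
            using borel_measurable_continuous_on_indicator[OF _ c2] by simp
          have "(\<lambda>t. m t * (indicator {0..1} t * (?q t * ((ux (t, y))\<^sup>2 * \<phi> (t, y))))) \<in> borel_measurable lborel"
            by measurable
          then show "set_borel_measurable lborel {0..1} (\<lambda>t. m t * (?q t * ((ux (t, y))\<^sup>2 * \<phi> (t, y))))"
            by (simp add: set_borel_measurable_def mult.left_commute)
          show "AE t\<in>{0..1} in lborel. norm (m t * (?q t * ((ux (t, y))\<^sup>2 * \<phi> (t, y)))) \<le> norm (?q t * ((ux (t, y))\<^sup>2 * \<phi> (t, y)))"
            using m(2,3) by (intro AE_I2 impI) (simp only: norm_mult, intro mult_left_le_one_le, auto)
        qed
        show ?thesis using set_integral_diff(1)[OF 1 2] by (simp add: algebra_simps)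
      qed
      ultimately show "(LINT t:{0..1}|lborel. ?D (t, y)) = 0"
        by (simp add: set_borel_integral_eq_integral(2))
    qed
    have "(LINT z:?K|lborel. u z * partial_x \<phi> z) = - (LINT z:?K|lborel. ux z * \<phi> z)"
    proof -
      have "set_integrable lborel ?K (\<lambda>z. u z * partial_x \<phi> z)" "set_integrable lborel ?K (\<lambda>z. ux z * \<phi> z)"
        by (intro ci continuous_intros cK cont[OF \<phi>] cont[OF px])+
      from set_integral_add(2)[OF this] show ?thesis using w1 by simp
    qed
    moreover have "(LINT z:?K|lborel. - u z * partial_t \<phi> z
         + ?q (fst z) * (u z * partial_x (partial_x \<phi>) z + m (fst z) * (ux z)\<^sup>2 * \<phi> z)) = 0"
    proof -
      have 1: "set_integrable lborel ?K (\<lambda>z. ?q (fst z) * (u z * partial_x (partial_x \<phi>) z - uxx z * \<phi> z))"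
        by (intro ci continuous_on_mult[OF qK] continuous_intros cK cont[OF \<phi>] cont[OF pxx])
      have "- u z * partial_t \<phi> z + ?q (fst z) * (u z * partial_x (partial_x \<phi>) z + m (fst z) * (ux z)\<^sup>2 * \<phi> z) =
         ?q (fst z) * (u z * partial_x (partial_x \<phi>) z - uxx z * \<phi> z) - ?D z" for z
        by (simp add: algebra_simps)
      then show ?thesis
        using set_integral_diff(2)[OF 1 Di] w2 w3 by (simp only:)
    qed
    ultimately show ?thesis
      using \<phi>0 by (subst (1 2 3) toK) auto
  qed
  have cong: "(LINT z:pde_domain|lborel. f z) = (LINT z:pde_domain|lborel. f' z)"
    if "\<And>z. z \<in> pde_domain \<Longrightarrow> f z = f' z" for f f' :: "real \<times> real \<Rightarrow> real"
    using that pde_domain_sets by (intro set_lebesgue_integral_cong) auto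
  have gux: "g z = ux z" "measure \<mu> {0..fst z} = m (fst z)" if "z \<in> pde_domain" for z
    using that m(4)[of "fst z"] by (auto simp: g_def pde_domain_def)
  show ?thesis
    unfolding parisi_weak_solution_def
  proof (intro conjI exI[of _ g] allI ballI)
    show "bounded_weak_partial_x u g"
      unfolding bounded_weak_partial_x_def
    proof (intro conjI exI[of _ C] ballI gm gb)
      fix \<phi> assume \<phi>: "\<phi> \<in> test_functions pde_domain"
      show "(LINT z:pde_domain|lborel. u z * partial_x \<phi> z) = - (LINT z:pde_domain|lborel. g z * \<phi> z)"
        using main[OF \<phi>] cong[of "\<lambda>z. g z * \<phi> z" "\<lambda>z. ux z * \<phi> z"] gux by simp
    qed
    fix \<phi> assume \<phi>: "\<phi> \<in> test_functions pde_domain"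
    have "(LINT z:pde_domain|lborel. - u z * partial_t \<phi> z
         + ?q (fst z) * (u z * partial_x (partial_x \<phi>) z + measure \<mu> {0..fst z} * (g z)\<^sup>2 * \<phi> z)) =
      (LINT z:pde_domain|lborel. - u z * partial_t \<phi> z
         + ?q (fst z) * (u z * partial_x (partial_x \<phi>) z + m (fst z) * (ux z)\<^sup>2 * \<phi> z))"
      by (rule cong) (simp only: gux)
    then show "(LINT z:pde_domain|lborel. - u z * partial_t \<phi> z
         + ?q (fst z) * (u z * partial_x (partial_x \<phi>) z + measure \<mu> {0..fst z} * (g z)\<^sup>2 * \<phi> z)) = 0"
      using main[OF \<phi>] by simp
  qed (use uc u1 in auto)
qed

text \<open>Only values on [0,1] \<times> R enter the definition. This permits replacing a solution
  by its \<open>extensional\<close> restriction.\<close>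

lemma parisi_weak_solution_cong:
  assumes u: "parisi_weak_solution \<xi> \<mu> u" and eq: "\<And>z. z \<in> {0..1} \<times> UNIV \<Longrightarrow> v z = u z"
  shows "parisi_weak_solution \<xi> \<mu> v"
proof -
  have c: "(LINT z:pde_domain|lborel. f (v z) z) = (LINT z:pde_domain|lborel. f (u z) z)" for f :: "real \<Rightarrow> real \<times> real \<Rightarrow> real"
    using pde_domain_sets eq by (intro set_lebesgue_integral_cong) (auto simp: pde_domain_def)
  have "continuous_on ({0..1} \<times> UNIV) v = continuous_on ({0..1} \<times> UNIV) u"
    using eq by (intro continuous_on_cong) auto
  moreover have "v (1, x) = u (1, x)" for x using eq[of "(1, x)"] by simp
  ultimately show ?thesis
    using u unfolding parisi_weak_solution_def bounded_weak_partial_x_def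
      c[of "\<lambda>a z. a * partial_x \<phi> z" for \<phi>]
      c[of "\<lambda>a z. - a * partial_t \<phi> z + poly (pderiv (pderiv \<xi>)) (fst z) / 2 *
               (a * partial_x (partial_x \<phi>) z + measure \<mu> {0..fst z} * (g z)\<^sup>2 * \<phi> z)" for g \<phi>]
    by (simp only: simp_thms)
qed

text \<open>Uniqueness discharges the definite description: any exhibited weak solution is the one
  that the functional uses.\<close>

lemma parisi_solution_eq:
  assumes \<xi>: "\<And>i. coeff \<xi> i \<ge> 0"
    and m: "m \<in> borel_measurable borel" "\<And>t. 0 \<le> m t" "\<And>t. m t \<le> 1"
      "\<And>t. t \<in> {0<..<1} \<Longrightarrow> measure \<mu> {0..t} = m t"
    and u: "parisi_weak_solution \<xi> \<mu> u" and t: "t \<in> {0..1}"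
  shows "parisi_solution \<xi> \<mu> (t, x) = u (t, x)"
proof -
  let ?D = "{0..1} \<times> (UNIV :: real set)"
  have "parisi_solution \<xi> \<mu> = restrict u ?D"
    unfolding parisi_solution_def
  proof (rule the_equality)
    show "parisi_weak_solution \<xi> \<mu> (restrict u ?D) \<and> restrict u ?D \<in> extensional ?D"
      using parisi_weak_solution_cong[OF u, of "restrict u ?D"] by simp
    fix v assume v: "parisi_weak_solution \<xi> \<mu> v \<and> v \<in> extensional ?D"
    show "v = restrict u ?D"
    proof
      fix z :: "real \<times> real"
      show "v z = restrict u ?D z"
      proof (cases "z \<in> ?D")
        case True
        then show ?thesis
          using parisi_weak_solution_unique[OF \<xi> m conjunct1[OF v] u, of "fst z" "snd z"] by (cases z) auto
      next
        case False
        then have "v z = undefined" using v by (intro extensional_arb[of v]) auto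
        then show ?thesis using False by (simp only: restrict_apply if_False)
      qed
    qed
  qed
  then show ?thesis using t by simp
qed

section \<open>The value of the functional at Dirac measures\<close>

lemma ln_cosh_bounds: "0 \<le> ln (cosh (y::real))" "ln (cosh y) \<le> \<bar>y\<bar>" "\<bar>y\<bar> - ln 2 \<le> ln (cosh y)"
proof -
  show "0 \<le> ln (cosh y)" using cosh_real_ge_1[of y] by simp
  have "cosh y \<le> exp \<bar>y\<bar>" by (cases "y \<ge> 0") (auto simp: cosh_field_def)
  then show "ln (cosh y) \<le> \<bar>y\<bar>" by (metis cosh_real_pos ln_exp ln_le_cancel_iff exp_gt_zero)
  have "exp \<bar>y\<bar> / 2 \<le> cosh y" by (cases "y \<ge> 0") (auto simp: cosh_field_def)
  then have "ln (exp \<bar>y\<bar> / 2) \<le> ln (cosh y)" by (subst ln_le_cancel_iff) auto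
  then show "\<bar>y\<bar> - ln 2 \<le> ln (cosh y)" by (simp add: ln_div)
qed

lemma has_real_derivative_ln_cosh: "((\<lambda>y. ln (cosh y)) has_real_derivative tanh y) (at (y::real))"
  using DERIV_chain2[OF DERIV_ln[OF cosh_real_pos[of y]] has_field_derivative_cosh[OF DERIV_ident]]
  by (simp add: tanh_def divide_inverse mult.commute)

lemma has_real_derivative_tanh: "(tanh has_real_derivative 1 - (tanh y)\<^sup>2) (at (y::real))"
  using has_field_derivative_tanh[OF _ DERIV_ident, of y UNIV] by simp

lemma exp_boundedI:
  assumes "continuous_on UNIV f" "\<And>y. \<bar>f y\<bar> \<le> exp \<bar>y\<bar>"
  shows "exp_bounded f"
  using assms unfolding exp_bounded_def by (auto intro!: exI[of _ 1])

lemma exp_bounded_ln_cosh: "exp_bounded (\<lambda>y. ln (cosh y))"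
proof (rule exp_boundedI)
  show "continuous_on UNIV (\<lambda>y::real. ln (cosh y))"
    by (intro continuous_intros) (use cosh_real_pos in \<open>auto simp: less_imp_neq[symmetric]\<close>)
  show "\<bar>ln (cosh y)\<bar> \<le> exp \<bar>y\<bar>" for y :: real
    using ln_cosh_bounds[of y] exp_ge_add_one_self[of "\<bar>y\<bar>"] by linarith
qed

lemma continuous_tanh: "continuous_on A (tanh :: real \<Rightarrow> real)"
  by (intro continuous_at_imp_continuous_on ballI isCont_tanh continuous_ident) auto

lemma abs_tanh_le_1: "\<bar>tanh (y::real)\<bar> \<le> 1"
  using tanh_real_bounds[of y] by (simp add: abs_le_iff)

lemma tanh_square_le_1: "(tanh (y::real))\<^sup>2 \<le> 1"
  using abs_tanh_le_1[of y] by (simp add: abs_square_le_1)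

lemma exp_bounded_tanh: "exp_bounded tanh" "exp_bounded (\<lambda>y. 1 - (tanh y)\<^sup>2)"
proof -
  have 1: "(1::real) \<le> exp \<bar>y\<bar>" for y :: real by simp
  show "exp_bounded tanh"
    by (intro exp_boundedI continuous_tanh order_trans[OF abs_tanh_le_1 1])
  have "\<bar>1 - (tanh y)\<^sup>2\<bar> \<le> 1" for y :: real using tanh_square_le_1[of y] by simp
  then show "exp_bounded (\<lambda>y. 1 - (tanh y)\<^sup>2)"
    by (intro exp_boundedI continuous_intros continuous_tanh order_trans[OF _ 1]) auto
qed

lemma heat_abs_le:
  assumes f: "exp_bounded f" and g: "exp_bounded g" and le: "\<And>y. \<bar>f y\<bar> \<le> g y"
  shows "\<bar>heat f s x\<bar> \<le> heat g s x"
  unfolding heat_def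
proof (rule order_trans[OF integral_abs_bound])
  show "(LINT z|lborel. \<bar>f (x + sqrt s * z) * std_normal_density z\<bar>) \<le>
      (LINT z|lborel. g (x + sqrt s * z) * std_normal_density z)"
    using le by (intro integral_mono integrable_abs heat_integrable[OF f] heat_integrable[OF g])
      (auto simp: abs_mult intro: mult_right_mono)
qed

lemma exp_bounded_const: "exp_bounded (\<lambda>_. c)"
  unfolding exp_bounded_def
  by (auto intro!: exI[of _ "\<bar>c\<bar>"] simp: mult_le_cancel_left1)

lemma heat_const [simp]: "heat (\<lambda>_. c) s x = c"
  by (simp add: heat_def)

section \<open>The model and its Dirac values\<close>

lemma sets_unit_interval_Icc: "t \<in> {0..1} \<Longrightarrow> {0..t} \<in> sets unit_interval"
  by (subst sets_restrict_space_iff) auto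

text \<open>Strict positivity of \<xi>'' makes \<xi>' strictly increasing, so that the heat flow
  between distinct times has positive variance and can be differentiated in time.\<close>

locale parisi_model =
  fixes \<xi> :: "real poly"
  assumes coeff_nonneg: "\<And>i. coeff \<xi> i \<ge> 0"
    and convex: "\<And>t. t \<ge> 0 \<Longrightarrow> poly (pderiv (pderiv \<xi>)) t > 0"
    and deriv_0: "poly (pderiv \<xi>) 0 = 0" and \<xi>_0: "poly \<xi> 0 = 0"
begin

abbreviation P :: "real \<Rightarrow> real" where "P \<equiv> poly (pderiv \<xi>)"

lemma P_strict_mono: "0 \<le> s \<Longrightarrow> s < t \<Longrightarrow> P s < P t"
  by (rule DERIV_pos_imp_increasing) (auto intro!: exI poly_DERIV convex)

lemma P_mono: "0 \<le> s \<Longrightarrow> s \<le> t \<Longrightarrow> P s \<le> P t"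
  using P_strict_mono[of s t] by (cases "s = t") auto

lemma integral_second_derivative:
  assumes "0 \<le> a" "a \<le> 1"
  shows "(LINT s|lborel. (poly (pderiv (pderiv \<xi>)) s * s) * indicator {a..1} s) =
    P 1 - poly \<xi> 1 - (a * P a - poly \<xi> a)"
proof -
  have "((\<lambda>s. s * P s - poly \<xi> s) has_real_derivative poly (pderiv (pderiv \<xi>)) s * s) (at s)" for s
    by (auto intro!: derivative_eq_intros poly_DERIV)
  then show ?thesis
    using integral_FTC_Icc_real[of a 1 "\<lambda>s. s * P s - poly \<xi> s" "\<lambda>s. poly (pderiv (pderiv \<xi>)) s * s"] assms
    by (auto intro!: continuous_intros)
qed

text \<open>After q the coefficient \<mu>([0,t]) is 1, and Hopf-Cole with E cosh(x + sqrt s Z) =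
  exp(s/2) cosh x gives ln cosh x + (\<xi>'(1) - \<xi>'(t))/2. Before q the coefficient is 0 and
  that function is carried on by the linear heat flow. The maxima glue the two formulas.\<close>

definition dirac_u :: "real \<Rightarrow> real \<times> real \<Rightarrow> real" where
  "dirac_u q z = heat (\<lambda>y. ln (cosh y)) (max 0 (P q - P (fst z))) (snd z) + (P 1 - P (max (fst z) q)) / 2"

lemma measure_dirac:
  assumes "q \<in> {0..1}" "t \<in> {0..1}"
  shows "measure (return unit_interval q) {0..t} = indicator {q..} t"
  using measure_return[OF sets_unit_interval_Icc[OF assms(2)], of q] assms by (simp add: indicator_def)

lemma dirac_weak_solution:
  assumes q: "q \<in> {0..1}"
  shows "parisi_weak_solution \<xi> (return unit_interval q) (dirac_u q)"
proof -
  let ?f = "\<lambda>y::real. ln (cosh y)" and ?f'' = "\<lambda>y::real. 1 - (tanh y)\<^sup>2"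
  let ?r = "\<lambda>t. max 0 (P q - P t)"
  have hc: "continuous_on ({0..1} \<times> UNIV) (\<lambda>z. heat f (?r (fst z)) (snd z))" if "exp_bounded f" for f
    by (rule continuous_on_compose2[OF continuous_on_heat[OF that], of _ "\<lambda>z. (?r (fst z), snd z)", simplified])
       (auto intro!: continuous_intros)
  note e = exp_bounded_ln_cosh exp_bounded_tanh
  have r0: "?r t = 0" if "t \<ge> q" for t using P_mono[of q t] q that by simp
  show ?thesis
  proof (rule classical_weak_solution[where ux = "\<lambda>z. heat tanh (?r (fst z)) (snd z)" and
        uxx = "\<lambda>z. heat ?f'' (?r (fst z)) (snd z)" and m = "indicator {q..}" and C = 1 and q = q])
    show "continuous_on ({0..1} \<times> UNIV) (dirac_u q)"
      unfolding dirac_u_def by (intro continuous_intros hc e) auto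
    show "((\<lambda>y. dirac_u q (t, y)) has_real_derivative heat tanh (?r (fst (t, x))) (snd (t, x))) (at x)" for t x
      unfolding dirac_u_def fst_conv snd_conv
      using DERIV_add[OF has_real_derivative_heat_x[OF e(1,2) has_real_derivative_ln_cosh] DERIV_const] by simp
    show "((\<lambda>y. heat tanh (?r (fst (t, y))) (snd (t, y))) has_real_derivative heat ?f'' (?r (fst (t, x))) (snd (t, x))) (at x)" for t x
      unfolding fst_conv snd_conv by (rule has_real_derivative_heat_x[OF e(2,3) has_real_derivative_tanh])
    show "\<bar>heat tanh (?r (fst (t, x))) (snd (t, x))\<bar> \<le> 1" for t x
      using heat_abs_le[OF e(2) exp_bounded_const abs_tanh_le_1] by simp
    show "dirac_u q (1, x) = ln (cosh x)" for x
      using r0[of 1] q by (simp add: dirac_u_def)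
    show "measure (return unit_interval q) {0..t} = indicator {q..} t" if "t \<in> {0<..<1}" for t
      using measure_dirac[OF q, of t] that by auto
    fix t x assume t: "t \<in> {0<..<1} - {q}"
    show "((\<lambda>s. dirac_u q (s, x)) has_real_derivative
        - (poly (pderiv (pderiv \<xi>)) t / 2 * (heat ?f'' (?r (fst (t, x))) (snd (t, x)) +
            indicator {q..} t * (heat tanh (?r (fst (t, x))) (snd (t, x)))\<^sup>2))) (at t)"
    proof (cases "t < q")
      case True
      have rt: "P q - P t > 0" using P_strict_mono[of t q] True t by simp
      have "((\<lambda>s. P q - P s) has_real_derivative - poly (pderiv (pderiv \<xi>)) t) (at t)"
        by (auto intro!: derivative_eq_intros poly_DERIV)
      from DERIV_add[OF DERIV_chain2[OF has_real_derivative_heat_time[OF e has_real_derivative_ln_cosh has_real_derivative_tanh rt] this]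
         DERIV_const[of "(P 1 - P q) / 2"]]
      have "((\<lambda>s. heat ?f (P q - P s) x + (P 1 - P q) / 2) has_real_derivative
        heat ?f'' (P q - P t) x / 2 * - poly (pderiv (pderiv \<xi>)) t) (at t)" by simp
      then have "((\<lambda>s. dirac_u q (s, x)) has_real_derivative
        heat ?f'' (P q - P t) x / 2 * - poly (pderiv (pderiv \<xi>)) t) (at t)"
      proof (rule has_field_derivative_transform_within_open[of _ _ _ "{0<..<q}"])
        fix s assume "s \<in> {0<..<q}"
        then show "heat ?f (P q - P s) x + (P 1 - P q) / 2 = dirac_u q (s, x)"
          using P_mono[of s q] by (simp add: dirac_u_def max_def)
      qed (use t True in auto)
      then show ?thesis using True rt by (simp add: max_def mult.commute)
    next
      case False
      then have tq: "t > q" using t by auto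
      \<comment> \<open>After q the right-hand side is free of x because u_xx + u_x^2 = (1 - tanh^2)
        + tanh^2 = 1.\<close>
      have "((\<lambda>s. ?f x + (P 1 - P s) / 2) has_real_derivative - (poly (pderiv (pderiv \<xi>)) t / 2)) (at t)"
        by (auto intro!: derivative_eq_intros poly_DERIV)
      then have "((\<lambda>s. dirac_u q (s, x)) has_real_derivative - (poly (pderiv (pderiv \<xi>)) t / 2)) (at t)"
      proof (rule has_field_derivative_transform_within_open[of _ _ _ "{q<..}"])
        fix s assume "s \<in> {q<..}"
        then show "?f x + (P 1 - P s) / 2 = dirac_u q (s, x)"
          using r0[of s] by (simp add: dirac_u_def)
      qed (use tq in auto)
      then show ?thesis using tq r0[of t] by simp
    qed
  qed (auto intro!: hc e simp: indicator_def)
qed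

text \<open>The penalty integral runs over [q,1], where s \<xi>'(s) - \<xi>(s) is an antiderivative
  of s \<xi>''(s). The contributions of \<xi>'(1) cancel.\<close>

lemma parisi_functional_dirac:
  assumes q: "q \<in> {0..1}"
  shows "parisi_functional \<xi> 1 0 (return unit_interval q) =
    heat (\<lambda>y. ln (cosh y)) (P q) 0 + (poly \<xi> 1 - poly \<xi> q - (1 - q) * P q) / 2"
proof -
  have "parisi_solution \<xi> (return unit_interval q) (0, 0) = dirac_u q (0, 0)"
    by (rule parisi_solution_eq[where m = "indicator {q..}", OF coeff_nonneg _ _ _ _ dirac_weak_solution[OF q]])
       (use measure_dirac[OF q] in \<open>auto simp: indicator_def\<close>)
  also have "\<dots> = heat (\<lambda>y. ln (cosh y)) (P q) 0 + (P 1 - P q) / 2"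
    using P_mono[of 0 q] q deriv_0 by (simp add: dirac_u_def max_def)
  finally have 1: "parisi_solution \<xi> (return unit_interval q) (0, 0) = \<dots>" .
  have "(LINT s:{0..1}|lborel. poly (pderiv (pderiv \<xi>)) s * measure (return unit_interval q) {0..s} * s) =
      (LINT s|lborel. (poly (pderiv (pderiv \<xi>)) s * s) * indicator {q..1} s)"
    unfolding set_lebesgue_integral_def
  proof (intro Bochner_Integration.integral_cong refl)
    fix s :: real
    show "indicator {0..1} s *\<^sub>R (poly (pderiv (pderiv \<xi>)) s * measure (return unit_interval q) {0..s} * s) =
        (poly (pderiv (pderiv \<xi>)) s * s) * indicator {q..1} s"
      using measure_dirac[OF q, of s] q by (cases "s \<in> {0..1}") (auto simp: indicator_def)
  qed
  also have "\<dots> = P 1 - poly \<xi> 1 - (q * P q - poly \<xi> q)"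
    by (rule integral_second_derivative) (use q in auto)
  finally show ?thesis
    unfolding parisi_functional_def using 1 by (simp add: scaled_xi_def field_simps)
qed

end

section \<open>A competitor with two atoms\<close>

text \<open>The law (\<delta>_0 + \<delta>_1)/2, encoded as the image of a fair coin so that total
  mass and measurability are inherited.\<close>

definition two_atoms :: "real measure" where
  "two_atoms = distr (measure_pmf (bernoulli_pmf (1 / 2))) unit_interval (\<lambda>b. of_bool b)"

lemma measurable_of_bool_unit_interval [measurable]:
  "(\<lambda>b. of_bool b) \<in> measurable (measure_pmf p) unit_interval"
  by (auto simp: measurable_def space_restrict_space)

lemma two_atoms_prob: "two_atoms \<in> space (prob_algebra unit_interval)"
  unfolding two_atoms_def space_prob_algebra
  by (auto intro!: measure_pmf.prob_space_distr)

lemma measure_two_atoms: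
  assumes "t \<in> {0..<1}"
  shows "measure two_atoms {0..t} = 1 / 2"
proof -
  have "measure two_atoms {0..t} = measure_pmf.prob (bernoulli_pmf (1 / 2)) ((\<lambda>b. of_bool b) -` {0..t} \<inter> UNIV)"
    unfolding two_atoms_def using assms by (subst measure_distr) (auto intro: sets_unit_interval_Icc)
  also have "(\<lambda>b. of_bool b :: real) -` {0..t} \<inter> UNIV = {False}"
    using assms by (auto simp: of_bool_def split: if_splits)
  finally show ?thesis by (simp add: measure_pmf_single)
qed

text \<open>The terminal value of exp(u/2) for u = ln cosh.\<close>

definition sqrt_cosh :: "real \<Rightarrow> real" where "sqrt_cosh y = exp (ln (cosh y) / 2)"

lemma has_real_derivative_sqrt_cosh:
    "(sqrt_cosh has_real_derivative sqrt_cosh y * tanh y / 2) (at y)"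
  and has_real_derivative_sqrt_cosh':
    "((\<lambda>y. sqrt_cosh y * tanh y / 2) has_real_derivative sqrt_cosh y * (1 / 2 - (tanh y)\<^sup>2 / 4)) (at y)"
proof -
  show 1: "(sqrt_cosh has_real_derivative sqrt_cosh y * tanh y / 2) (at y)" for y
    using DERIV_fun_exp[OF DERIV_cdivide[OF has_real_derivative_ln_cosh[of y], of 2]]
    by (simp add: sqrt_cosh_def[abs_def])
  show "((\<lambda>y. sqrt_cosh y * tanh y / 2) has_real_derivative sqrt_cosh y * (1 / 2 - (tanh y)\<^sup>2 / 4)) (at y)"
    by (rule DERIV_cong[OF DERIV_cdivide[OF DERIV_mult[OF 1 has_real_derivative_tanh]]])
       (simp add: power2_eq_square field_simps)
qed

text \<open>The bound by two pure exponentials is the one whose Gaussian average is explicit; the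
  bound by exp |y| places the function in the growth class.\<close>

lemma sqrt_cosh_bounds: "1 \<le> sqrt_cosh y" "sqrt_cosh y \<le> exp (y / 2) + exp (- y / 2)" "sqrt_cosh y \<le> exp \<bar>y\<bar>"
proof -
  show "1 \<le> sqrt_cosh y" using ln_cosh_bounds(1)[of y] by (simp add: sqrt_cosh_def)
  have "sqrt_cosh y \<le> exp (\<bar>y\<bar> / 2)" using ln_cosh_bounds(2)[of y] by (simp add: sqrt_cosh_def)
  moreover have "exp (\<bar>y\<bar> / 2) \<le> exp (y / 2) + exp (- y / 2)" by (cases "y \<ge> 0") auto
  moreover have "exp (\<bar>y\<bar> / 2) \<le> exp \<bar>y\<bar>" by simp
  ultimately show "sqrt_cosh y \<le> exp (y / 2) + exp (- y / 2)" "sqrt_cosh y \<le> exp \<bar>y\<bar>" by linarith+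
qed

lemma continuous_sqrt_cosh: "continuous_on A sqrt_cosh"
  by (intro continuous_at_imp_continuous_on ballI DERIV_isCont[OF has_real_derivative_sqrt_cosh])

lemma exp_bounded_sqrt_cosh_mult:
  assumes "continuous_on UNIV c" "\<And>y. \<bar>c y\<bar> \<le> 1"
  shows "exp_bounded (\<lambda>y. sqrt_cosh y * c y)"
proof (rule exp_boundedI)
  show "continuous_on UNIV (\<lambda>y. sqrt_cosh y * c y)"
    by (intro continuous_intros continuous_sqrt_cosh assms)
  show "\<bar>sqrt_cosh y * c y\<bar> \<le> exp \<bar>y\<bar>" for y
  proof -
    have "\<bar>sqrt_cosh y\<bar> * \<bar>c y\<bar> \<le> exp \<bar>y\<bar> * 1"
      using sqrt_cosh_bounds[of y] by (intro mult_mono assms(2)) auto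
    then show ?thesis by (simp add: abs_mult)
  qed
qed

lemma exp_bounded_sqrt_cosh:
  "exp_bounded sqrt_cosh" "exp_bounded (\<lambda>y. sqrt_cosh y * tanh y / 2)"
  "exp_bounded (\<lambda>y. sqrt_cosh y * (1 / 2 - (tanh y)\<^sup>2 / 4))"
proof -
  show "exp_bounded sqrt_cosh"
    using exp_bounded_sqrt_cosh_mult[of "\<lambda>_. 1"] by simp
  have "\<bar>tanh y / 2\<bar> \<le> 1" for y :: real using abs_tanh_le_1[of y] by (simp add: abs_divide)
  then show "exp_bounded (\<lambda>y. sqrt_cosh y * tanh y / 2)"
    using exp_bounded_sqrt_cosh_mult[of "\<lambda>y. tanh y / 2"] by (simp add: continuous_intros continuous_tanh)
  have "\<bar>1 / 2 - (tanh y)\<^sup>2 / 4\<bar> \<le> 1" for y :: real using tanh_square_le_1[of y] zero_le_power2[of "tanh y"] by linarith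
  then show "exp_bounded (\<lambda>y. sqrt_cosh y * (1 / 2 - (tanh y)\<^sup>2 / 4))"
    by (intro exp_bounded_sqrt_cosh_mult continuous_intros continuous_tanh) auto
qed

lemma has_real_derivative_double_ln:
  fixes h :: "real \<Rightarrow> real"
  assumes "(h has_real_derivative h') (at x)" "h x > 0"
  shows "((\<lambda>y. 2 * ln (h y)) has_real_derivative 2 * (h' / h x)) (at x)"
  using DERIV_cmult[OF DERIV_chain2[OF DERIV_ln[OF assms(2)] assms(1)], of 2]
  by (simp add: divide_inverse mult.commute)

lemma has_real_derivative_double_log_derivative:
  fixes h h' :: "real \<Rightarrow> real"
  assumes "(h has_real_derivative h' x) (at x)" "(h' has_real_derivative h'') (at x)" "h x \<noteq> 0"
  shows "((\<lambda>y. 2 * (h' y / h y)) has_real_derivative 2 * (h'' / h x - (h' x / h x)\<^sup>2)) (at x)"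
proof -
  have "(h'' * h x - h' x * h' x) / (h x * h x) = h'' / h x - (h' x / h x)\<^sup>2"
    using assms(3) by (simp add: power2_eq_square field_simps)
  with DERIV_cmult[OF DERIV_divide[OF assms(2,1,3)], of 2] show ?thesis by (simp only:)
qed

context parisi_model
begin

text \<open>The Hopf--Cole transform linearizes the equation where \<open>\<mu>([0,t]) = 1/2\<close>:
  \<open>exp (u / 2)\<close> then solves the backward heat equation.\<close>

lemma two_atoms_weak_solution:
  "parisi_weak_solution \<xi> two_atoms (\<lambda>z. 2 * ln (heat sqrt_cosh (P 1 - P (fst z)) (snd z)))"
proof -
  let ?h = "\<lambda>z. heat sqrt_cosh (P 1 - P (fst z)) (snd z)"
  let ?hx = "\<lambda>z. heat (\<lambda>y. sqrt_cosh y * tanh y / 2) (P 1 - P (fst z)) (snd z)"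
  let ?hxx = "\<lambda>z. heat (\<lambda>y. sqrt_cosh y * (1 / 2 - (tanh y)\<^sup>2 / 4)) (P 1 - P (fst z)) (snd z)"
  note e = exp_bounded_sqrt_cosh and d = has_real_derivative_sqrt_cosh and d' = has_real_derivative_sqrt_cosh'
  have hc: "continuous_on ({0..1} \<times> UNIV) (\<lambda>z. heat f (P 1 - P (fst z)) (snd z))" if "exp_bounded f" for f
    by (rule continuous_on_compose2[OF continuous_on_heat[OF that], of _ "\<lambda>z. (P 1 - P (fst z), snd z)", simplified])
       (auto intro!: continuous_intros P_mono)
  have h1: "?h z \<ge> 1" for z
    using heat_abs_le[OF exp_bounded_const[of 1] e(1), of "P 1 - P (fst z)" "snd z"] sqrt_cosh_bounds(1) by simp
  then have hnz: "?h z \<noteq> 0" "?h z > 0" for z using h1[of z] by linarith+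
  \<comment> \<open>From |tanh| <= 1 under the Gaussian average; it becomes the bound 1 on the
    spatial derivative of the solution.\<close>
  have hxb: "\<bar>?hx z\<bar> \<le> ?h z / 2" for z
  proof -
    have eb: "exp_bounded (\<lambda>y. sqrt_cosh y * (1 / 2))" by (rule exp_bounded_sqrt_cosh_mult) auto
    have "\<bar>sqrt_cosh y * tanh y / 2\<bar> \<le> sqrt_cosh y * (1 / 2)" for y
      using sqrt_cosh_bounds(1)[of y] abs_tanh_le_1[of y] by (simp add: abs_mult mult_left_le)
    from heat_abs_le[OF e(2) eb this] show ?thesis by (simp add: heat_def)
  qed
  have dh: "((\<lambda>y. ?h (t, y)) has_real_derivative ?hx (t, x)) (at x)"
    "((\<lambda>y. ?hx (t, y)) has_real_derivative ?hxx (t, x)) (at x)" for t x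
    unfolding fst_conv snd_conv
    by (rule has_real_derivative_heat_x[OF e(1,2) d] has_real_derivative_heat_x[OF e(2,3) d'])+
  show ?thesis
  \<comment> \<open>Both atoms sit at end times, so \<mu>([0,t]) is 1/2 throughout (0,1). The choice
    q = 0 excludes no interior time.\<close>
  proof (rule classical_weak_solution[where ux = "\<lambda>z. 2 * (?hx z / ?h z)" and
        uxx = "\<lambda>z. 2 * (?hxx z / ?h z - (?hx z / ?h z)\<^sup>2)" and m = "\<lambda>_. 1 / 2" and C = 1 and q = 0])
    show "continuous_on ({0..1} \<times> UNIV) (\<lambda>z. 2 * ln (?h z))"
      by (intro continuous_on_mult continuous_on_const continuous_on_ln hc e) (use hnz in auto)
    show "continuous_on ({0..1} \<times> UNIV) (\<lambda>z. 2 * (?hx z / ?h z))"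
      by (intro continuous_on_mult continuous_on_const continuous_on_divide hc e) (use hnz in auto)
    show "continuous_on ({0..1} \<times> UNIV) (\<lambda>z. 2 * (?hxx z / ?h z - (?hx z / ?h z)\<^sup>2))"
      by (intro continuous_on_mult continuous_on_const continuous_on_diff continuous_on_power continuous_on_divide hc e)
         (use hnz in auto)
    show "((\<lambda>y. 2 * ln (?h (t, y))) has_real_derivative 2 * (?hx (t, x) / ?h (t, x))) (at x)" for t x
      by (rule has_real_derivative_double_ln[of "\<lambda>y. ?h (t, y)", OF dh(1) hnz(2)])
    show "((\<lambda>y. 2 * (?hx (t, y) / ?h (t, y))) has_real_derivative
        2 * (?hxx (t, x) / ?h (t, x) - (?hx (t, x) / ?h (t, x))\<^sup>2)) (at x)" for t x
      by (rule has_real_derivative_double_log_derivative[of "\<lambda>y. ?h (t, y)" "\<lambda>y. ?hx (t, y)", OF dh(1) dh(2) hnz(1)])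
    show "\<bar>2 * (?hx (t, x) / ?h (t, x))\<bar> \<le> 1" for t x
      using hxb[of "(t, x)"] hnz(2)[of "(t, x)"] by (simp add: abs_mult abs_divide divide_le_eq)
    show "2 * ln (?h (1, x)) = ln (cosh x)" for x by (simp add: sqrt_cosh_def)
    show "measure two_atoms {0..t} = 1 / 2" if "t \<in> {0<..<1}" for t
      by (rule measure_two_atoms) (use that in auto)
    fix t x assume t: "t \<in> {0<..<1} - {0 :: real}"
    have rt: "P 1 - P t > 0" using P_strict_mono[of t 1] t by simp
    have "((\<lambda>s. P 1 - P s) has_real_derivative - poly (pderiv (pderiv \<xi>)) t) (at t)"
      by (auto intro!: derivative_eq_intros poly_DERIV)
    from DERIV_chain2[OF has_real_derivative_heat_time[OF e d d' rt] this]
    have ht: "((\<lambda>s. ?h (s, x)) has_real_derivative ?hxx (t, x) / 2 * - poly (pderiv (pderiv \<xi>)) t) (at t)"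
      unfolding fst_conv snd_conv .
    \<comment> \<open>The Hopf-Cole cancellation, with k standing for h_x / h: the square from the
      second derivative of the logarithm is compensated by the nonlinearity with coefficient
      1/2.\<close>
    have "2 * (b / 2 * - p / c) = - (p / 2 * (2 * (b / c - k\<^sup>2) + 1 / 2 * (2 * k)\<^sup>2))" for b c k p :: real
      by (simp add: power2_eq_square algebra_simps)
    then show "((\<lambda>s. 2 * ln (?h (s, x))) has_real_derivative
        - (poly (pderiv (pderiv \<xi>)) t / 2 * (2 * (?hxx (t, x) / ?h (t, x) - (?hx (t, x) / ?h (t, x))\<^sup>2) +
            1 / 2 * (2 * (?hx (t, x) / ?h (t, x)))\<^sup>2))) (at t)"
      by (rule DERIV_cong[OF has_real_derivative_double_ln[of "\<lambda>s. ?h (s, x)", OF ht hnz(2)]])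
  qed auto
qed

text \<open>Averaging the two exponentials gives 2 exp(\<xi>'(1)/8), hence u(0,0) <= 2 ln 2 +
  \<xi>'(1)/4. The penalty is (\<xi>'(1) - \<xi>(1))/4, so the large quantity \<xi>'(1) drops
  out.\<close>

lemma parisi_functional_two_atoms_le:
  "parisi_functional \<xi> 1 0 two_atoms \<le> 2 * ln 2 + poly \<xi> 1 / 4"
proof -
  have "parisi_solution \<xi> two_atoms (0, 0) = 2 * ln (heat sqrt_cosh (P 1) 0)"
    using parisi_solution_eq[where m = "\<lambda>_. 1 / 2", OF coeff_nonneg _ _ _ _ two_atoms_weak_solution, of 0 0]
      measure_two_atoms deriv_0 by simp
  also have "heat sqrt_cosh (P 1) 0 \<le> 2 * exp (P 1 / 8)"
  proof -
    let ?r = "sqrt (P 1)"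
    have P1: "P 1 \<ge> 0" using P_mono[of 0 1] deriv_0 by simp
    have "heat sqrt_cosh (P 1) 0 \<le> (LINT z|lborel. exp (?r / 2 * z) * std_normal_density z + exp (- ?r / 2 * z) * std_normal_density z)"
      unfolding heat_def
    proof (intro integral_mono heat_integrable[OF exp_bounded_sqrt_cosh(1)] Bochner_Integration.integrable_add
        integral_exp_std_normal)
      fix z
      have "sqrt_cosh (0 + ?r * z) \<le> exp (?r / 2 * z) + exp (- ?r / 2 * z)"
        using sqrt_cosh_bounds(2)[of "?r * z"] by simp
      from mult_right_mono[OF this normal_density_nonneg[of 0 1 z]]
      show "sqrt_cosh (0 + ?r * z) * std_normal_density z \<le>
        exp (?r / 2 * z) * std_normal_density z + exp (- ?r / 2 * z) * std_normal_density z"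
        by (simp add: distrib_right)
    qed
    also have "\<dots> = exp ((?r / 2)\<^sup>2 / 2) + exp ((- ?r / 2)\<^sup>2 / 2)"
      by (subst Bochner_Integration.integral_add[OF integral_exp_std_normal(1) integral_exp_std_normal(1)])
         (simp only: integral_exp_std_normal(2))
    also have "\<dots> = 2 * exp (P 1 / 8)"
      using P1 by (simp add: power_divide)
    finally show ?thesis .
  qed
  then have "ln (heat sqrt_cosh (P 1) 0) \<le> ln (2 * exp (P 1 / 8))"
  proof (rule ln_mono[rotated 2])
    show "0 < heat sqrt_cosh (P 1) 0"
      using heat_abs_le[OF exp_bounded_const[of 1] exp_bounded_sqrt_cosh(1), of "P 1" 0] sqrt_cosh_bounds(1) by simp
  qed
  also have "\<dots> = ln 2 + P 1 / 8" by (simp add: ln_mult)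
  finally have 1: "parisi_solution \<xi> two_atoms (0, 0) \<le> 2 * ln 2 + P 1 / 4" by simp
  have "(LINT s:{0..1}|lborel. poly (pderiv (pderiv \<xi>)) s * measure two_atoms {0..s} * s) =
      (LINT s|lborel. 1 / 2 * ((poly (pderiv (pderiv \<xi>)) s * s) * indicator {0..1} s))"
    unfolding set_lebesgue_integral_def
  proof (rule integral_cong_AE)
    \<comment> \<open>At s = 1 the second atom is included and the mass is no longer 1/2, but a
      single point does not affect the integral.\<close>
    have "AE s in lborel. s \<noteq> (1 :: real)" by (rule AE_lborel_singleton)
    then show AE: "AE s in lborel. indicator {0..1} s *\<^sub>R (poly (pderiv (pderiv \<xi>)) s * measure two_atoms {0..s} * s) =
        1 / 2 * ((poly (pderiv (pderiv \<xi>)) s * s) * indicator {0..1} s)"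
      by eventually_elim (auto simp: indicator_def measure_two_atoms)
    have [measurable]: "poly p \<in> borel_measurable borel" for p :: "real poly"
      by (intro borel_measurable_continuous_onI continuous_at_imp_continuous_on) (simp add: poly_isCont)
    show "(\<lambda>s. 1 / 2 * ((poly (pderiv (pderiv \<xi>)) s * s) * indicator {0..1} s)) \<in> borel_measurable lborel"
      by measurable
    have eq: "(\<lambda>s. indicator {0..1} s *\<^sub>R (poly (pderiv (pderiv \<xi>)) s * measure two_atoms {0..s} * s)) =
        (\<lambda>s. (poly (pderiv (pderiv \<xi>)) s * s) * (1 / 2 * indicator {0..<1} s + measure two_atoms {0..1} * indicator {1} s))"
      by (auto simp: fun_eq_iff indicator_def measure_two_atoms)
    show "(\<lambda>s. indicator {0..1} s *\<^sub>R (poly (pderiv (pderiv \<xi>)) s * measure two_atoms {0..s} * s)) \<in> borel_measurable lborel"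
      unfolding eq by measurable
  qed
  also have "\<dots> = (P 1 - poly \<xi> 1 + poly \<xi> 0) / 2"
    using integral_second_derivative[of 0] by simp
  finally show ?thesis
    unfolding parisi_functional_def using 1 \<xi>_0 by (simp add: scaled_xi_def field_simps)
qed

text \<open>Two lower bounds for E ln cosh(sqrt(\<xi>'(q)) Z): ln cosh >= 0, for q where \<xi>'(q)
  gives little, and ln cosh y >= |y| - ln 2 with E|Z| = sqrt(2/pi) >= sqrt(1/2), for the remaining
  q.\<close>

lemma parisi_functional_dirac_ge:
  assumes q: "q \<in> {0..1}"
  shows "(poly \<xi> 1 - poly \<xi> q - (1 - q) * P q) / 2 \<le> parisi_functional \<xi> 1 0 (return unit_interval q)"
    and "sqrt (P q / 2) - ln 2 + (poly \<xi> 1 - poly \<xi> q - (1 - q) * P q) / 2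
      \<le> parisi_functional \<xi> 1 0 (return unit_interval q)"
proof -
  have P0: "P q \<ge> 0" using P_mono[of 0 q] q deriv_0 by simp
  have "0 \<le> heat (\<lambda>y. ln (cosh y)) (P q) 0"
    unfolding heat_def using ln_cosh_bounds(1) by (intro integral_nonneg_AE AE_I2 mult_nonneg_nonneg) auto
  then show "(poly \<xi> 1 - poly \<xi> q - (1 - q) * P q) / 2 \<le> parisi_functional \<xi> 1 0 (return unit_interval q)"
    unfolding parisi_functional_dirac[OF q] by simp
  let ?r = "sqrt (P q)"
  note ia = integrable_normal_moment_abs[of 1 0 1]
  have "sqrt (P q / 2) \<le> ?r * sqrt (2 / pi)"
  proof -
    have "1 / 2 \<le> 2 / pi" using pi_less_4 by (simp add: field_simps)
    from mult_left_mono[OF this P0] have "P q / 2 \<le> P q * (2 / pi)" by simp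
    then have "sqrt (P q / 2) \<le> sqrt (P q * (2 / pi))" by simp
    then show ?thesis by (simp only: real_sqrt_mult)
  qed
  also have "?r * sqrt (2 / pi) - ln 2 = (LINT z|lborel. ?r * (std_normal_density z * \<bar>z - 0\<bar> ^ 1) - ln 2 * std_normal_density z)"
    using integral_normal_moment_abs_odd[of 1 0 0] ia by (simp add: Bochner_Integration.integral_diff)
  moreover have "\<dots> \<le> heat (\<lambda>y. ln (cosh y)) (P q) 0"
    unfolding heat_def
  proof (intro integral_mono heat_integrable[OF exp_bounded_ln_cosh] Bochner_Integration.integrable_diff integrable_mult_right ia)
    fix z
    have "?r * \<bar>z\<bar> - ln 2 \<le> ln (cosh (0 + ?r * z))"
      using ln_cosh_bounds(3)[of "?r * z"] P0 by (simp add: abs_mult)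
    from mult_right_mono[OF this normal_density_nonneg[of 0 1 z]]
    show "?r * (std_normal_density z * \<bar>z - 0\<bar> ^ 1) - ln 2 * std_normal_density z \<le> ln (cosh (0 + ?r * z)) * std_normal_density z"
      by (simp add: algebra_simps)
  qed auto
  ultimately have "sqrt (P q / 2) - ln 2 \<le> heat (\<lambda>y. ln (cosh y)) (P q) 0" by linarith
  then show "sqrt (P q / 2) - ln 2 + (poly \<xi> 1 - poly \<xi> q - (1 - q) * P q) / 2
      \<le> parisi_functional \<xi> 1 0 (return unit_interval q)"
    unfolding parisi_functional_dirac[OF q] by simp
qed

end

section \<open>The counterexample\<close>

text \<open>The coefficient 1/2 gives \<xi>''(0) = 1. The other term is invisible to \<xi>' and
  \<xi>'' at 0 but raises \<xi>(1) to 33/2, so that already \<delta>_0 has value 33/4, above the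
  bound 2 ln 2 + 33/8 for the competitor. The high degree keeps \<xi> small until q is near 1 and
  makes \<xi>' large there; 1001 leaves the even power 1000 in \<xi>'.\<close>

definition xi_example :: "real poly" where
  "xi_example = monom (1 / 2) 2 + monom 16 1001"

lemma xi_example_eval:
  "poly xi_example x = x\<^sup>2 / 2 + 16 * x ^ 1001"
  "poly (pderiv xi_example) x = x + 16016 * x ^ 1000"
  "poly (pderiv (pderiv xi_example)) x = 1 + 16016000 * x ^ 999"
  by (simp_all add: xi_example_def poly_monom pderiv_add pderiv_monom)

lemma mixed_p_spin_xi_example: "mixed_p_spin xi_example"
  by (auto simp: mixed_p_spin_def xi_example_def)

text \<open>Each of the n + 1 terms of the geometric sum is at least q^n. The bound tames the factor
  16016 in (1 - q) \<xi>'(q).\<close>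

lemma one_minus_times_power_le:
  fixes q :: real
  assumes "0 \<le> q" "q \<le> 1"
  shows "(real n + 1) * ((1 - q) * q ^ n) \<le> 1"
proof -
  have "(real n + 1) * q ^ n = (\<Sum>i<Suc n. q ^ n)" by simp
  also have "\<dots> \<le> (\<Sum>i<Suc n. q ^ i)"
    using assms by (intro sum_mono power_decreasing) auto
  finally have "(1 - q) * ((real n + 1) * q ^ n) \<le> (1 - q) * (\<Sum>i<Suc n. q ^ i)"
    using assms by (intro mult_left_mono) auto
  also have "\<dots> = 1 - q ^ Suc n" by (rule one_diff_power_eq[symmetric])
  also have "\<dots> \<le> 1" using assms by simp
  finally show ?thesis by (simp add: mult_ac)
qed

theorem theorem1:
  "\<exists>\<xi>0 :: real poly. mixed_p_spin \<xi>0 \<and> poly (pderiv (pderiv \<xi>0)) 0 > 0 \<and> \<not> AT \<xi>0 \<subseteq> RS \<xi>0"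
proof (intro exI[of _ xi_example] conjI mixed_p_spin_xi_example)
  show "poly (pderiv (pderiv xi_example)) 0 > 0" by (simp add: xi_example_eval)
  interpret parisi_model xi_example
  proof
    show "coeff xi_example i \<ge> 0" for i
      using mixed_p_spin_xi_example by (simp add: mixed_p_spin_def)
    show "poly (pderiv (pderiv xi_example)) t > 0" if "t \<ge> 0" for t
      using that by (simp add: xi_example_eval add_pos_nonneg)
    show "poly (pderiv xi_example) 0 = 0" "poly xi_example 0 = 0" by (simp_all add: xi_example_eval)
  qed
  have sc: "scaled_xi xi_example 1 = xi_example" by (simp add: scaled_xi_def)
  have "(1, 0) \<in> AT xi_example"
  proof -
    interpret std: prob_space std_normal_distribution
      using prob_space_normal_density[of 1 0] by simp
    have Q0: "0 \<in> Q_star xi_example 1 0"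
      by (simp add: Q_star_def sc deriv_0)
    \<comment> \<open>At q = 0 and h = 0 the Gaussian argument is 0, so the expectation of sech^4 is
      1 and \<xi>''(0) = 1 remains.\<close>
    have "alpha_at xi_example 1 0 0 = 1"
      using std.prob_space by (simp add: alpha_at_def sc deriv_0 xi_example_eval)
    \<comment> \<open>A real infimum lies below its members only for a set that is bounded
      below.\<close>
    moreover have "bdd_below (alpha_at xi_example 1 0 ` Q_star xi_example 1 0)"
    proof (rule bdd_belowI2[of _ 0])
      fix q assume "q \<in> Q_star xi_example 1 0"
      then have "q \<ge> 0" by (simp add: Q_star_def)
      then show "0 \<le> alpha_at xi_example 1 0 q"
        unfolding alpha_at_def sc using convex[of q]
        by (intro mult_nonneg_nonneg integral_nonneg_AE AE_I2) auto
    qed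
    ultimately have "alpha xi_example 1 0 \<le> 1"
      unfolding alpha_def using cINF_lower[OF _ Q0, of "alpha_at xi_example 1 0"] by simp
    then show ?thesis by (simp add: AT_def)
  qed
  moreover have "(1, 0) \<notin> RS xi_example"
  proof
    assume "(1, 0) \<in> RS xi_example"
    then obtain q where q: "q \<in> {0..1}" and min: "is_parisi_measure xi_example 1 0 (return unit_interval q)"
      by (auto simp: RS_def)
    have "parisi_functional xi_example 1 0 (return unit_interval q) \<le> parisi_functional xi_example 1 0 two_atoms"
      using min two_atoms_prob by (auto simp: is_parisi_measure_def is_arg_min_def not_less)
    also have "\<dots> \<le> 2 * ln 2 + 33 / 8"
      using parisi_functional_two_atoms_le by (simp add: xi_example_eval)
    finally have up: "parisi_functional xi_example 1 0 (return unit_interval q) \<le> 2 * ln 2 + 33 / 8" .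
    have ln2: "ln 2 \<le> (25 / 36 :: real)" by (rule ln2_le_25_over_36)
    \<comment> \<open>Half the power in \<xi>': sqrt(\<xi>'(q)) is at least of order a, and in (1 -
      q) \<xi>'(q) one factor a is absorbed by 1 - q, leaving a term linear in a.\<close>
    define a where "a = q ^ 500"
    have a: "0 \<le> a" "a \<le> 1" using q by (auto simp: a_def power_le_one)
    have a2: "q ^ 1000 = a\<^sup>2" by (simp add: a_def flip: power_mult)
    have a3: "q ^ 1001 = q * a\<^sup>2" using power_Suc[of q 1000] a2 by simp
    have Pq: "P q = q + 16016 * a\<^sup>2" by (simp add: xi_example_eval a2)
    let ?D = "poly xi_example q + (1 - q) * P q"
    have D: "?D \<le> 1 / 2 + 16 * a\<^sup>2 + 32 * a"
    proof -
      have "?D = (q - q\<^sup>2 / 2) + 16 * (q * a\<^sup>2) + 16016 * ((1 - q) * a) * a"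
        unfolding Pq xi_example_eval(1) a3 by (simp add: power2_eq_square algebra_simps)
      moreover have "q - q\<^sup>2 / 2 \<le> 1 / 2"
        using zero_le_power2[of "1 - q"] by (simp add: power2_eq_square algebra_simps)
      moreover have "q * a\<^sup>2 \<le> 1 * a\<^sup>2" using q by (intro mult_right_mono) auto
      moreover have "501 * ((1 - q) * a) \<le> 1"
        using one_minus_times_power_le[of q 500] q by (simp add: a_def)
      then have "16016 * ((1 - q) * a) \<le> 32" by linarith
      \<comment> \<open>Here 32 is 16016/501 rounded up.\<close>
      then have "16016 * ((1 - q) * a) * a \<le> 32 * a" using a by (intro mult_right_mono) auto
      ultimately show ?thesis by linarith
    qed
    have xi1: "poly xi_example 1 = 33 / 2" by (simp add: xi_example_eval)
    define \<delta> where "\<delta> = ?D"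
    have \<delta>: "poly xi_example 1 - poly xi_example q - (1 - q) * P q = 33 / 2 - \<delta>"
      by (simp add: \<delta>_def xi1)
    note D = D[folded \<delta>_def] and ge = parisi_functional_dirac_ge[OF q, unfolded \<delta>, THEN order_trans, OF up]
    define l :: real where "l = ln 2"
    note ge = ge[folded l_def] and ln2 = ln2[folded l_def]
    show False
    proof (cases "a \<le> 1 / 10")
      case True
      then have "a\<^sup>2 \<le> 1 / 100" using a power_mono[of a "1 / 10" 2] by (simp add: power2_eq_square)
      \<comment> \<open>At most 0.5 + 0.16 + 3.2. The Dirac value is then at least (33/2 - 4)/2 =
        6.25, above 2 * 25/36 + 33/8.\<close>
      then have "\<delta> \<le> 4" using D True by linarith
      then show False
        using ge(1) ln2 by (simp add: field_simps)
    next
      case False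
      \<comment> \<open>89^2 = 7921 is below 16016/2 = 8008. Doubled, the Gaussian term contributes
        178 a, against at most 48 a in \<delta>.\<close>
      have "(89 * a)\<^sup>2 \<le> P q / 2" using q a by (simp add: Pq power_mult_distrib)
      then have "89 * a \<le> sqrt (P q / 2)" by (rule real_le_rsqrt)
      moreover have "a\<^sup>2 \<le> a" using a by (simp add: power2_eq_square mult_left_le)
      moreover have "2 * sqrt (P q / 2) + 33 / 2 - \<delta> \<le> 6 * l + 33 / 4"
        using ge(2) by (simp add: field_simps)
      moreover have "6 * l + 33 / 4 \<le> 13" using ln2 by simp
      ultimately show False
        using D False by linarith
    qed
  qed
  ultimately show "\<not> AT xi_example \<subseteq> RS xi_example" by blast
qed

end
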